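(* Let $F$ be a non-Archimedean local field. Then $\mathbb{P}\mathfrak{gl}_2(F)$ is multiplicity-free as a $PGL_2(F)\times PGL_2(F)$-variety; that is, for every irreducible admissible representation $\pi$ of $PGL_2(F)\times PGL_2(F)$, $$\dim \operatorname{Hom}_{PGL_2(F)\times PGL_2(F)}\bigl(\mathcal{S}(\mathbb{P}\mathfrak{gl}_2(F)),\pi\bigr)\le 1 .$$
   Context: $\mathbb{P}\mathfrak{gl}_2(F)$ is the projective space of nonzero $2\times 2$ matrices over $F$ modulo nonzero scalars, with the topology coming from $F$. The group $PGL_2(F)\times PGL_2(F)$ acts on it by $([g],[h]).[x]=[gxh^{-1}]$. For a Hausdorff, locally compact, totally disconnected space $Y$, $\mathcal{S}(Y)$ denotes the space of locally constant compactly supported functions $Y\to\mathbb{C}$. Representations are complex, and admissible has its usual meaning (smooth, with finite-dimensional spaces of invariants under compact open subgroups). *)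

theory Defs
  imports
    "HOL-Analysis.Analysis"
    "HOL-Algebra.Coset"
    "HOL-Library.Function_Algebras"
begin

section \<open>Non-Archimedean local fields\<close>

text \<open>The absolute value is not part of the structure: only the topology that it induces is.\<close>

class nonarch_local_field = field + topological_space +
  assumes nonarch_abs_ex:
      "\<exists>v :: 'a \<Rightarrow> real.
         (\<forall>x. 0 \<le> v x) \<and> (\<forall>x. v x = 0 \<longleftrightarrow> x = 0) \<and>
         (\<forall>x y. v (x * y) = v x * v y) \<and>
         (\<forall>x y. v (x + y) \<le> max (v x) (v y)) \<and>
         (\<exists>x. x \<noteq> 0 \<and> v x \<noteq> 1) \<and>
         (\<forall>U. open U \<longleftrightarrow> (\<forall>x\<in>U. \<exists>e>0. \<forall>y. v (y - x) < e \<longrightarrow> y \<in> U))"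
    and locally_compact: "\<exists>U K. open U \<and> compact K \<and> x \<in> U \<and> U \<subseteq> K"


section \<open>Smooth functions with compact support\<close>

text \<open>Functions on the carrier of \<open>Y\<close> are represented by their extension by zero.\<close>

definition schwartz :: "'y topology \<Rightarrow> ('y \<Rightarrow> complex) set" where
  "schwartz Y = {f. (\<forall>y. y \<notin> topspace Y \<longrightarrow> f y = 0) \<and>
     (\<forall>y\<in>topspace Y. \<exists>U. openin Y U \<and> y \<in> U \<and> (\<forall>z\<in>U. f z = f y)) \<and>
     compactin Y (Y closure_of {y \<in> topspace Y. f y \<noteq> 0})}"

definition translate ::
    "('g, 'm) monoid_scheme \<Rightarrow> 'y topology \<Rightarrow> ('g \<Rightarrow> 'y \<Rightarrow> 'y) \<Rightarrow> 'g \<Rightarrow> ('y \<Rightarrow> complex) \<Rightarrow> 'y \<Rightarrow> complex"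
  where "translate G Y act g f = (\<lambda>y. if y \<in> topspace Y then f (act (inv\<^bsub>G\<^esub> g) y) else 0)"


section \<open>Complex representations\<close>

definition group_rep ::
    "('g, 'm) monoid_scheme \<Rightarrow> (complex \<Rightarrow> 'v::ab_group_add \<Rightarrow> 'v) \<Rightarrow> ('g \<Rightarrow> 'v \<Rightarrow> 'v) \<Rightarrow> bool" where
  "group_rep G smul \<rho> \<longleftrightarrow> vector_space smul \<and>
     (\<forall>g\<in>carrier G. Vector_Spaces.linear smul smul (\<rho> g)) \<and>
     \<rho> \<one>\<^bsub>G\<^esub> = id \<and>
     (\<forall>g\<in>carrier G. \<forall>h\<in>carrier G. \<rho> (g \<otimes>\<^bsub>G\<^esub> h) = \<rho> g \<circ> \<rho> h)"

definition irreducible_rep ::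
    "('g, 'm) monoid_scheme \<Rightarrow> (complex \<Rightarrow> 'v::ab_group_add \<Rightarrow> 'v) \<Rightarrow> ('g \<Rightarrow> 'v \<Rightarrow> 'v) \<Rightarrow> bool" where
  "irreducible_rep G smul \<rho> \<longleftrightarrow> group_rep G smul \<rho> \<and> (\<exists>v::'v. v \<noteq> 0) \<and>
     (\<forall>W. module.subspace smul W \<and> (\<forall>g\<in>carrier G. \<rho> g ` W \<subseteq> W) \<longrightarrow> W = {0} \<or> W = UNIV)"

definition smooth_rep ::
    "('g, 'm) monoid_scheme \<Rightarrow> 'g topology \<Rightarrow> (complex \<Rightarrow> 'v::ab_group_add \<Rightarrow> 'v) \<Rightarrow>
      ('g \<Rightarrow> 'v \<Rightarrow> 'v) \<Rightarrow> bool" where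
  "smooth_rep G T smul \<rho> \<longleftrightarrow> group_rep G smul \<rho> \<and>
     (\<forall>v. openin T {g \<in> carrier G. \<rho> g v = v})"

text \<open>The library's \<open>dim\<close> is \<open>0\<close> on infinite-dimensional subspaces, so a bound on it is only
  meaningful together with \<open>finite_dim\<close>.\<close>

definition finite_dim :: "('k::field \<Rightarrow> 'v::ab_group_add \<Rightarrow> 'v) \<Rightarrow> 'v set \<Rightarrow> bool" where
  "finite_dim smul W \<longleftrightarrow> (\<exists>B. finite B \<and> B \<subseteq> W \<and> W \<subseteq> module.span smul B)"

definition admissible_rep ::
    "('g, 'm) monoid_scheme \<Rightarrow> 'g topology \<Rightarrow> (complex \<Rightarrow> 'v::ab_group_add \<Rightarrow> 'v) \<Rightarrow>
      ('g \<Rightarrow> 'v \<Rightarrow> 'v) \<Rightarrow> bool" where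
  "admissible_rep G T smul \<rho> \<longleftrightarrow> smooth_rep G T smul \<rho> \<and>
     (\<forall>K. subgroup K G \<and> openin T K \<and> compactin T K \<longrightarrow>
        finite_dim smul {v. \<forall>k\<in>K. \<rho> k v = v})"

text \<open>A linear map on the subspace \<open>schwartz Y\<close> is represented by its extension by zero, so that
  it is determined by its values on \<open>schwartz Y\<close> and the maps form a subspace of the function
  space, with scalars acting by \<open>hom_smul\<close>.\<close>

definition Hom_schwartz ::
    "('g, 'm) monoid_scheme \<Rightarrow> 'y topology \<Rightarrow> ('g \<Rightarrow> 'y \<Rightarrow> 'y) \<Rightarrow>
      (complex \<Rightarrow> 'v::ab_group_add \<Rightarrow> 'v) \<Rightarrow> ('g \<Rightarrow> 'v \<Rightarrow> 'v) \<Rightarrow> (('y \<Rightarrow> complex) \<Rightarrow> 'v) set" where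
  "Hom_schwartz G Y act smul \<rho> = {T.
     (\<forall>f\<in>schwartz Y. \<forall>f'\<in>schwartz Y. T (\<lambda>y. f y + f' y) = T f + T f') \<and>
     (\<forall>c. \<forall>f\<in>schwartz Y. T (\<lambda>y. c * f y) = smul c (T f)) \<and>
     (\<forall>g\<in>carrier G. \<forall>f\<in>schwartz Y. T (translate G Y act g f) = \<rho> g (T f)) \<and>
     (\<forall>f. f \<notin> schwartz Y \<longrightarrow> T f = 0)}"

definition hom_smul ::
    "(complex \<Rightarrow> 'v \<Rightarrow> 'v) \<Rightarrow> complex \<Rightarrow> (('y \<Rightarrow> complex) \<Rightarrow> 'v) \<Rightarrow> ('y \<Rightarrow> complex) \<Rightarrow> 'v" where
  "hom_smul smul c T = (\<lambda>f. smul c (T f))"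


section \<open>The quotient topology\<close>

definition quotient_topology :: "'a topology \<Rightarrow> ('a \<Rightarrow> 'b) \<Rightarrow> 'b topology" where
  "quotient_topology X q =
     topology (\<lambda>U. U \<subseteq> q ` topspace X \<and> openin X {x \<in> topspace X. q x \<in> U})"

lemma openin_quotient_topology:
  "openin (quotient_topology X q) U \<longleftrightarrow>
     U \<subseteq> q ` topspace X \<and> openin X {x \<in> topspace X. q x \<in> U}"
proof -
  have "istopology (\<lambda>U. U \<subseteq> q ` topspace X \<and> openin X {x \<in> topspace X. q x \<in> U})"
    unfolding istopology_def
  proof (intro conjI allI impI)
    fix S T assume "S \<subseteq> q ` topspace X \<and> openin X {x \<in> topspace X. q x \<in> S}"
      and "T \<subseteq> q ` topspace X \<and> openin X {x \<in> topspace X. q x \<in> T}"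
    moreover have "{x \<in> topspace X. q x \<in> S \<inter> T} =
        {x \<in> topspace X. q x \<in> S} \<inter> {x \<in> topspace X. q x \<in> T}"
      by blast
    ultimately show "S \<inter> T \<subseteq> q ` topspace X" "openin X {x \<in> topspace X. q x \<in> S \<inter> T}"
      by auto
  next
    fix \<K> assume K: "\<forall>S\<in>\<K>. S \<subseteq> q ` topspace X \<and> openin X {x \<in> topspace X. q x \<in> S}"
    then show "\<Union> \<K> \<subseteq> q ` topspace X" by blast
    have "{x \<in> topspace X. q x \<in> \<Union> \<K>} = (\<Union>S\<in>\<K>. {x \<in> topspace X. q x \<in> S})"
      by blast
    then show "openin X {x \<in> topspace X. q x \<in> \<Union> \<K>}"
      using K by (metis (no_types, lifting) imageE openin_Union)
  qed
  then show ?thesis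
    by (simp add: quotient_topology_def)
qed

lemma topspace_quotient_topology: "topspace (quotient_topology X q) = q ` topspace X"
proof
  show "topspace (quotient_topology X q) \<subseteq> q ` topspace X"
    using openin_quotient_topology[of X q "topspace (quotient_topology X q)"] by simp
  have "{x \<in> topspace X. q x \<in> q ` topspace X} = topspace X" by blast
  then show "q ` topspace X \<subseteq> topspace (quotient_topology X q)"
    using openin_quotient_topology[of X q "q ` topspace X"] by (simp add: openin_subset)
qed

lemma quotient_map_quotient_topology: "quotient_map X (quotient_topology X q) q"
  by (auto simp: quotient_map_def topspace_quotient_topology openin_quotient_topology)


section \<open>The group and the projective space\<close>

definition GL2 :: "('f::field ^ 2 ^ 2) monoid" where
  "GL2 = \<lparr>carrier = {g. invertible g}, mult = (**), one = mat 1\<rparr>"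

definition scalars2 :: "('f::field ^ 2 ^ 2) set" where
  "scalars2 = {mat c | c. c \<noteq> 0}"

definition PGL2 :: "('f::field ^ 2 ^ 2) set monoid" where
  "PGL2 = GL2 Mod scalars2"

text \<open>The class \<open>[x]\<close> of a matrix modulo nonzero scalars. For invertible \<open>x\<close> it is the coset of
  \<open>x\<close> in \<open>PGL2\<close>, so that \<open>PGL2\<close> is a subset of the projective space of all nonzero matrices.\<close>

definition proj_class :: "'f::field ^ 2 ^ 2 \<Rightarrow> ('f ^ 2 ^ 2) set" where
  "proj_class x = {mat c ** x | c. c \<noteq> 0}"

definition PGL2_top :: "('f::{field,topological_space} ^ 2 ^ 2) set topology" where
  "PGL2_top = quotient_topology (top_of_set {g. invertible g}) proj_class"

definition Pgl2_top :: "('f::{field,topological_space} ^ 2 ^ 2) set topology" where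
  "Pgl2_top = quotient_topology (top_of_set {x. x \<noteq> 0}) proj_class"

text \<open>The action \<open>([g], [h]).[x] = [g x h\<^sup>-\<^sup>1]\<close>, written as a product of classes so that no
  representatives have to be chosen; see \<open>pgl_act_proj_class\<close> below.\<close>

definition pgl_act ::
    "('f::field ^ 2 ^ 2) set \<times> ('f ^ 2 ^ 2) set \<Rightarrow> ('f ^ 2 ^ 2) set \<Rightarrow> ('f ^ 2 ^ 2) set" where
  "pgl_act gh X = {g ** x ** matrix_inv h | g x h. g \<in> fst gh \<and> x \<in> X \<and> h \<in> snd gh}"

lemma mat_mult_nth: "(mat c ** (A :: 'f::field ^ 2 ^ 2)) $ i $ j = c * A $ i $ j"
  by (simp add: matrix_matrix_mult_def mat_def if_distrib[of "\<lambda>a. a * _"] cong: if_cong)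

lemma mult_mat_nth: "((A :: 'f::field ^ 2 ^ 2) ** mat c) $ i $ j = c * A $ i $ j"
  by (simp add: matrix_matrix_mult_def mat_def if_distrib[of "\<lambda>a. _ * a"] mult.commute cong: if_cong)

lemma mat_commute: "mat c ** (A :: 'f::field ^ 2 ^ 2) = A ** mat c"
  by (simp add: vec_eq_iff mat_mult_nth mult_mat_nth)

lemma mat_mult_mat: "mat c ** mat d = (mat (c * d) :: 'f::field ^ 2 ^ 2)"
  by (simp add: vec_eq_iff mat_mult_nth) (simp add: mat_def)

lemma matrix_inv_unique:
  assumes "(A :: 'f::field ^ 2 ^ 2) ** B = mat 1" "B ** A = mat 1"
  shows "matrix_inv A = B"
proof -
  have "A ** matrix_inv A = mat 1 \<and> matrix_inv A ** A = mat 1"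
    unfolding matrix_inv_def by (rule someI[of _ B]) (use assms in simp)
  then show ?thesis
    using assms by (metis matrix_mul_assoc matrix_mul_lid matrix_mul_rid)
qed

lemma matrix_inv_laws:
  assumes "invertible (h :: 'f::field ^ 2 ^ 2)"
  shows "h ** matrix_inv h = mat 1" "matrix_inv h ** h = mat 1"
  using assms unfolding invertible_def using matrix_inv_unique by blast+

lemma matrix_inv_scale:
  assumes "invertible (h :: 'f::field ^ 2 ^ 2)" "c \<noteq> 0"
  shows "matrix_inv (mat c ** h) = mat (inverse c) ** matrix_inv h"
proof (rule matrix_inv_unique)
  have "mat c ** h ** (mat (inverse c) ** matrix_inv h) = mat c ** mat (inverse c) ** (h ** matrix_inv h)"
    by (metis mat_commute matrix_mul_assoc)
  then show "mat c ** h ** (mat (inverse c) ** matrix_inv h) = mat 1"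
    using assms by (simp add: matrix_inv_laws mat_mult_mat)
  have "mat (inverse c) ** matrix_inv h ** (mat c ** h) = mat (inverse c) ** mat c ** (matrix_inv h ** h)"
    by (metis mat_commute matrix_mul_assoc)
  then show "mat (inverse c) ** matrix_inv h ** (mat c ** h) = mat 1"
    using assms by (simp add: matrix_inv_laws mat_mult_mat)
qed

lemma pgl_act_proj_class:
  assumes "invertible (h :: 'f::field ^ 2 ^ 2)"
  shows "pgl_act (proj_class g, proj_class h) (proj_class x) = proj_class (g ** x ** matrix_inv h)"
proof
  have eq: "mat a ** g ** (mat b ** x) ** matrix_inv (mat c ** h) =
      mat (a * b * inverse c) ** (g ** x ** matrix_inv h)" if "c \<noteq> 0" for a b c
    unfolding matrix_inv_scale[OF assms that]
    by (simp add: vec_eq_iff matrix_matrix_mult_def sum_2 mat_def forall_2 algebra_simps)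
  show "pgl_act (proj_class g, proj_class h) (proj_class x) \<subseteq> proj_class (g ** x ** matrix_inv h)"
    unfolding pgl_act_def proj_class_def
    by (clarsimp simp: eq) (metis mult_eq_0_iff nonzero_imp_inverse_nonzero)
  show "proj_class (g ** x ** matrix_inv h) \<subseteq> pgl_act (proj_class g, proj_class h) (proj_class x)"
  proof
    fix y assume "y \<in> proj_class (g ** x ** matrix_inv h)"
    then obtain c where c: "c \<noteq> 0" "y = mat c ** (g ** x ** matrix_inv h)"
      by (auto simp: proj_class_def)
    have self: "z \<in> proj_class z" for z :: "'f ^ 2 ^ 2"
      unfolding proj_class_def by (rule CollectI, rule exI[of _ 1]) simp
    have "mat c ** g \<in> proj_class g"
      using c(1) by (auto simp: proj_class_def)
    moreover have "y = mat c ** g ** x ** matrix_inv h"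
      by (simp add: c(2) matrix_mul_assoc)
    ultimately show "y \<in> pgl_act (proj_class g, proj_class h) (proj_class x)"
      unfolding pgl_act_def using self by auto
  qed
qed

lemma carrier_PGL2: "carrier PGL2 = proj_class ` {g :: 'f::field ^ 2 ^ 2. invertible g}"
  by (auto simp: PGL2_def GL2_def FactGroup_def RCOSETS_def r_coset_def scalars2_def proj_class_def)

lemma group_GL2: "group (GL2 :: ('f::field ^ 2 ^ 2) monoid)"
proof (rule groupI)
  show "\<exists>y\<in>carrier GL2. y \<otimes>\<^bsub>GL2\<^esub> x = \<one>\<^bsub>GL2\<^esub>" if "x \<in> carrier GL2" for x :: "'f ^ 2 ^ 2"
    using that unfolding GL2_def invertible_def by auto
  have "invertible (mat 1 :: 'f ^ 2 ^ 2)"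
    unfolding invertible_def by (intro exI[of _ "mat 1"]) simp
  then show "\<one>\<^bsub>GL2\<^esub> \<in> carrier (GL2 :: ('f ^ 2 ^ 2) monoid)"
    by (simp add: GL2_def)
qed (auto simp: GL2_def invertible_mult matrix_mul_assoc)

lemma normal_scalars2: "(scalars2 :: ('f::field ^ 2 ^ 2) set) \<lhd> GL2"
proof -
  interpret group "GL2 :: ('f ^ 2 ^ 2) monoid" by (rule group_GL2)
  have inv: "invertible (mat c :: 'f ^ 2 ^ 2)" if "c \<noteq> 0" for c
    using that unfolding invertible_def by (intro exI[of _ "mat (inverse c)"]) (simp add: mat_mult_mat)
  have inv_eq: "inv\<^bsub>GL2\<^esub> (mat c :: 'f ^ 2 ^ 2) = mat (inverse c)" if "c \<noteq> 0" for c
    by (rule inv_equality) (use that in \<open>auto simp: GL2_def mat_mult_mat inv\<close>)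
  have "subgroup (scalars2 :: ('f ^ 2 ^ 2) set) GL2"
  proof (rule subgroupI)
    show "(scalars2 :: ('f ^ 2 ^ 2) set) \<subseteq> carrier GL2" by (auto simp: scalars2_def GL2_def inv)
    show "(scalars2 :: ('f ^ 2 ^ 2) set) \<noteq> {}" by (auto simp: scalars2_def intro: exI[of _ 1])
    show "inv\<^bsub>GL2\<^esub> a \<in> scalars2" if "a \<in> scalars2" for a :: "'f ^ 2 ^ 2"
      using that by (auto simp: scalars2_def inv_eq)
    show "a \<otimes>\<^bsub>GL2\<^esub> b \<in> scalars2" if "a \<in> scalars2" "b \<in> scalars2" for a b :: "'f ^ 2 ^ 2"
      using that by (auto simp: scalars2_def GL2_def mat_mult_mat)
  qed
  then show ?thesis
    by (rule normalI) (auto simp: GL2_def scalars2_def r_coset_def l_coset_def mat_commute)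
qed

lemma group_PGL2: "group (PGL2 :: ('f::field ^ 2 ^ 2) set monoid)"
  unfolding PGL2_def by (rule normal.factorgroup_is_group[OF normal_scalars2])

end

theory Submission
  imports Defs "HOL-Computational_Algebra.Fundamental_Theorem_Algebra"
begin

text \<open>Let \<open>G = PGL\<^sub>2(F)\<close>, an open orbit whose complement, the rank one matrices, is a product of two
  projective lines. If an intertwiner \<open>T\<close> is nonzero on \<open>\<S>(G)\<close>, then any other intertwiner is on \<open>\<S>(G)\<close> a
  multiple of \<open>T\<close>: both are determined by central vectors of a simple finite-dimensional Hecke bimodule.
  This settles the case that no nonzero intertwiner vanishes on \<open>\<S>(G)\<close>.

  Otherwise fix a nonzero \<open>T\<^sub>0\<close> that vanishes on \<open>\<S>(G)\<close>, so that it factors through the functions on the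
  boundary. Let \<open>Z\<^sub>m\<close> be the set of \<open>[x]\<close> with \<open>x\<^sub>1\<^sub>1 = 1\<close>, \<open>x\<^sub>1\<^sub>2\<close> and \<open>x\<^sub>2\<^sub>1\<close> in the maximal ideal \<open>(\<omega>)\<close>, and
  \<open>det x \<in> (\<omega>\<^sup>m)\<close>. Since a projective line has no invariant measure, the vectors of \<open>\<pi>\<close> fixed by the product of
  an Iwahori subgroup and its transpose form the line spanned by \<open>T\<^sub>0 1\<^bsub>Z\<^sub>1\<^esub>\<close>. A sum \<open>A\<close> of group elements
  maps \<open>1\<^bsub>Z\<^sub>m\<^esub>\<close> to \<open>1\<^bsub>Z\<^sub>m\<^sub>+\<^sub>1\<^esub>\<close>. As \<open>Z\<^sub>1\<close> and \<open>Z\<^sub>2\<close> have the same boundary, \<open>A\<close> fixes that line. For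
  every intertwiner \<open>T\<close> the vector \<open>T 1\<^bsub>Z\<^sub>1\<^esub>\<close> lies on the line, so \<open>T\<close> kills \<open>1\<^bsub>Z\<^sub>1\<^esub> - 1\<^bsub>Z\<^sub>2\<^esub>\<close>. But
  \<open>Z\<^sub>1 - Z\<^sub>2\<close> is a coset of the Iwahori subgroup, so \<open>T\<close> kills its indicator function, and hence all of
  \<open>\<S>(G)\<close>: otherwise \<open>T(\<S>(G)) = \<pi>\<close>, while \<open>T\<close> kills every Iwahori-fixed element of \<open>\<S>(G)\<close>. Finally, \<open>T\<close> minus a multiple of \<open>T\<^sub>0\<close>
  also kills \<open>1\<^bsub>Z\<^sub>1\<^esub>\<close>, whose translates generate the functions on the boundary.\<close>


section \<open>The absolute value\<close>

text \<open>The danger is one intertwiner living on the open orbit next to an independent one living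
  on the boundary. For want of an invariant measure, the functions on a projective line have only
  the Steinberg representation \<open>St\<close> as an irreducible quotient, so the danger concerns
  \<open>\<pi> = St x St\<close> alone. For this \<open>\<pi>\<close> a nonzero map from
  \<open>\<S>(G)\<close> to \<open>\<pi>\<close> does exist, and what has to be shown is that it
  does not extend. The sets \<open>Z\<^sub>m\<close> detect this: on the boundary they cannot be
  told apart, but \<open>A\<close>, being a sum of group elements, acts on \<open>\<pi>\<close>
  itself, so its effect computed with \<open>T\<^sub>0\<close> binds every \<open>T\<close>. The
  Iwahori subgroup is large enough for its fixed vectors to form a line and small enough for
  \<open>Z\<^sub>1 - Z\<^sub>2\<close> to be a single coset. On the open orbit a convolution
  identity compares the kernels of two intertwiners, and Schur's lemma rests on an eigenvector,
  which exists by admissibility. Integration is replaced throughout by finite sums, over finite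
  orbits and finite sets of cosets.\<close>

definition vabs :: "'f::nonarch_local_field \<Rightarrow> real" where
  "vabs = (SOME v.
         (\<forall>x. 0 \<le> v x) \<and> (\<forall>x. v x = 0 \<longleftrightarrow> x = 0) \<and>
         (\<forall>x y. v (x * y) = v x * v y) \<and>
         (\<forall>x y. v (x + y) \<le> max (v x) (v y)) \<and>
         (\<exists>x. x \<noteq> 0 \<and> v x \<noteq> 1) \<and>
         (\<forall>U. open U \<longleftrightarrow> (\<forall>x\<in>U. \<exists>e>0. \<forall>y. v (y - x) < e \<longrightarrow> y \<in> U)))"

lemma
  fixes x y :: "'f::nonarch_local_field"
  shows vabs_nonneg [simp]: "0 \<le> vabs x"
    and vabs_eq_0_iff [simp]: "vabs x = 0 \<longleftrightarrow> x = 0"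
    and vabs_mult: "vabs (x * y) = vabs x * vabs y"
    and vabs_add: "vabs (x + y) \<le> max (vabs x) (vabs y)"
    and vabs_nontrivial: "\<exists>z :: 'f. z \<noteq> 0 \<and> vabs z \<noteq> 1"
    and open_iff_vabs: "open U \<longleftrightarrow> (\<forall>x\<in>U. \<exists>e>0. \<forall>y :: 'f. vabs (y - x) < e \<longrightarrow> y \<in> U)"
  using someI_ex[OF nonarch_abs_ex[where 'a = 'f], folded vabs_def] by blast+

lemma vabs_not_less_0 [simp]: "\<not> vabs (x :: 'f::nonarch_local_field) < 0"
  by (simp only: not_less vabs_nonneg)

lemma vabs_0 [simp]: "vabs (0 :: 'f::nonarch_local_field) = 0"
  by simp

lemma vabs_1 [simp]: "vabs (1 :: 'f::nonarch_local_field) = 1"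
  using vabs_mult[of "1 :: 'f" 1] by simp

lemma vabs_pos_iff [simp]: "0 < vabs (x :: 'f::nonarch_local_field) \<longleftrightarrow> x \<noteq> 0"
  using vabs_nonneg[of x] vabs_eq_0_iff[of x] by linarith

lemma vabs_minus [simp]: "vabs (- x :: 'f::nonarch_local_field) = vabs x"
proof -
  have "vabs (-1 :: 'f) ^ 2 = 1"
    by (simp add: power2_eq_square flip: vabs_mult)
  then have "vabs (-1 :: 'f) = 1"
    using vabs_nonneg[of "-1 :: 'f"] by (simp add: power2_eq_1_iff)
  then show ?thesis
    using vabs_mult[of "-1" x] by simp
qed

lemma vabs_diff: "vabs (x - y :: 'f::nonarch_local_field) \<le> max (vabs x) (vabs y)"
  using vabs_add[of x "- y"] by simp

lemma vabs_diff_commute: "vabs (x - y :: 'f::nonarch_local_field) = vabs (y - x)"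
  using vabs_minus[of "x - y"] by simp

lemma vabs_inverse: "vabs (inverse x :: 'f::nonarch_local_field) = inverse (vabs x)"
proof (cases "x = 0")
  case False
  then have "vabs x * vabs (inverse x) = 1"
    by (simp flip: vabs_mult)
  then show ?thesis
    by (simp add: inverse_unique)
qed simp

lemma vabs_divide: "vabs (x / y :: 'f::nonarch_local_field) = vabs x / vabs y"
  by (simp add: divide_inverse vabs_mult vabs_inverse)

lemma vabs_power: "vabs (x ^ n :: 'f::nonarch_local_field) = vabs x ^ n"
  by (induction n) (simp_all add: vabs_mult)

lemma vabs_add_le: "vabs x \<le> r \<Longrightarrow> vabs y \<le> r \<Longrightarrow> vabs (x + y :: 'f::nonarch_local_field) \<le> r"
  using vabs_add[of x y] by linarith

lemma vabs_add_less: "vabs x < r \<Longrightarrow> vabs y < r \<Longrightarrow> vabs (x + y :: 'f::nonarch_local_field) < r"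
  using vabs_add[of x y] by linarith

lemma vabs_diff_le: "vabs x \<le> r \<Longrightarrow> vabs y \<le> r \<Longrightarrow> vabs (x - y :: 'f::nonarch_local_field) \<le> r"
  using vabs_diff[of x y] by linarith

lemma vabs_diff_less: "vabs x < r \<Longrightarrow> vabs y < r \<Longrightarrow> vabs (x - y :: 'f::nonarch_local_field) < r"
  using vabs_diff[of x y] by linarith

text \<open>Triangles are isosceles: \<open>x = (x - y) + y\<close> bounds \<open>vabs x\<close> by
  \<open>vabs y\<close>, and in \<open>y = x - (x - y)\<close> the difference is too small to attain
  the maximum.\<close>

lemma vabs_eq_of_close: "vabs (x - y) < vabs y \<Longrightarrow> vabs (x :: 'f::nonarch_local_field) = vabs y"
  using vabs_add[of "x - y" y] vabs_diff[of x "x - y"] by simp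

lemma vabs_small_ex:
  assumes "0 < e"
  obtains a :: "'f::nonarch_local_field" where "a \<noteq> 0" "vabs a < e" "vabs a < 1"
proof -
  obtain z :: 'f where z: "z \<noteq> 0" "vabs z \<noteq> 1" using vabs_nontrivial by blast
  define b where "b = (if vabs z < 1 then z else inverse z)"
  have b: "b \<noteq> 0" "vabs b < 1"
    using z by (auto simp: b_def vabs_inverse inverse_less_1_iff)
  obtain n where n: "vabs b ^ n < min e 1"
    using real_arch_pow_inv[of "min e 1" "vabs b"] b assms by auto
  show thesis
    by (rule that[of "b ^ n"]) (use b n in \<open>auto simp: vabs_power\<close>)
qed

lemma open_vabs_ball_le: "a \<noteq> 0 \<Longrightarrow> open {y :: 'f::nonarch_local_field. vabs (y - x) \<le> vabs a}"
  unfolding open_iff_vabs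
proof safe
  fix y assume a: "a \<noteq> 0" "vabs (y - x) \<le> vabs a"
  show "\<exists>e>0. \<forall>z. vabs (z - y) < e \<longrightarrow> z \<in> {y. vabs (y - x) \<le> vabs a}"
    using a vabs_add_le[of "_ - y" "vabs a" "y - x"] by (intro exI[of _ "vabs a"]) force
qed

lemma open_vabs_less: "open {y :: 'f::nonarch_local_field. vabs y < r}"
  unfolding open_iff_vabs
proof safe
  fix y :: 'f assume a: "vabs y < r"
  then have "0 < r" using vabs_nonneg[of y] by linarith
  then show "\<exists>e>0. \<forall>z. vabs (z - y) < e \<longrightarrow> z \<in> {y. vabs y < r}"
    using a vabs_add_less[of "_ - y" r y] by (intro exI[of _ r]) force
qed

lemma closed_vabs_le: "closed {y :: 'f::nonarch_local_field. vabs y \<le> r}"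
proof -
  have "\<exists>e>0. \<forall>z. vabs (z - y) < e \<longrightarrow> r < vabs z" if "r < vabs y" for y :: 'f
  \<comment> \<open>For \<open>y = 0\<close> the assumption reads \<open>r < 0\<close>, so any
    radius works; otherwise nearby points have the same absolute value as \<open>y\<close>.\<close>
  proof (cases "y = 0")
    case True
    then show ?thesis using that by (intro exI[of _ 1]) (auto intro: less_le_trans)
  next
    case False
    then show ?thesis using that
      by (intro exI[of _ "vabs y"]) (auto dest: vabs_eq_of_close)
  qed
  then have "open {y :: 'f. \<not> vabs y \<le> r}"
    unfolding open_iff_vabs by (auto simp: not_le)
  then show ?thesis
    by (simp add: closed_def Collect_neg_eq)
qed

lemma continuous_on_mult_vabs: "continuous_on UNIV (\<lambda>x :: 'f::nonarch_local_field. a * x)"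
proof (cases "a = 0")
  case False
  have "open ((\<lambda>x. a * x) -` U)" if "open U" for U
    unfolding open_iff_vabs
  proof
    fix x assume "x \<in> (\<lambda>x. a * x) -` U"
    then obtain e where e: "e > 0" "\<And>y. vabs (y - a * x) < e \<Longrightarrow> y \<in> U"
      using \<open>open U\<close> unfolding open_iff_vabs by auto
    have "a * y \<in> U" if "vabs (y - x) < e / vabs a" for y
    proof (rule e(2))
      have "vabs (a * y - a * x) = vabs a * vabs (y - x)"
        by (simp add: algebra_simps flip: vabs_mult)
      then show "vabs (a * y - a * x) < e"
        using that False by (simp add: field_simps)
    qed
    then show "\<exists>e>0. \<forall>y. vabs (y - x) < e \<longrightarrow> y \<in> (\<lambda>x. a * x) -` U"
      using e(1) False by (intro exI[of _ "e / vabs a"]) auto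
  qed
  then show ?thesis
    by (simp add: continuous_on_open_vimage)
qed simp

text \<open>A compact neighbourhood of 0 contains a closed disc of radius \<open>vabs a\<close>;
  multiplication by \<open>inverse a\<close> carries it onto the unit disc.\<close>

lemma compact_vabs_le_1: "compact {x :: 'f::nonarch_local_field. vabs x \<le> 1}"
proof -
  obtain U K :: "'f set" where UK: "open U" "compact K" "0 \<in> U" "U \<subseteq> K"
    using locally_compact by blast
  then obtain e where e: "e > 0" "\<And>y. vabs (y - 0) < e \<Longrightarrow> y \<in> U"
    unfolding open_iff_vabs by blast
  obtain a :: 'f where a: "a \<noteq> 0" "vabs a < e"
    by (rule vabs_small_ex[OF e(1)])
  have "K \<inter> {x :: 'f. vabs x \<le> vabs a} = {x :: 'f. vabs x \<le> vabs a}"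
    using a e UK by fastforce
  then have "compact {x :: 'f. vabs x \<le> vabs a}"
    using compact_Int_closed[OF UK(2) closed_vabs_le, of "vabs a"] by simp
  then have "compact ((\<lambda>x. inverse a * x) ` {x :: 'f. vabs x \<le> vabs a})"
    by (rule compact_continuous_image[rotated]) (rule continuous_on_subset[OF continuous_on_mult_vabs], simp)
  also have "(\<lambda>x. inverse a * x) ` {x :: 'f. vabs x \<le> vabs a} = {x. vabs x \<le> 1}"
  proof (intro equalityI subsetI)
    fix x :: 'f assume "x \<in> {x. vabs x \<le> 1}"
    then show "x \<in> (\<lambda>x. inverse a * x) ` {x. vabs x \<le> vabs a}"
      using a by (intro image_eqI[of _ _ "a * x"]) (auto simp: vabs_mult mult_left_le)
  qed (use a in \<open>auto simp: inverse_eq_divide vabs_divide\<close>)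
  finally show ?thesis .
qed

text \<open>Compactness makes the value group discrete: the open unit disc \<open>P\<close> is
  compact, and if its absolute values had no maximum, the discs \<open>vabs x < vabs y\<close> with
  \<open>y\<close> in \<open>P\<close> would form an open cover without finite subcover.\<close>

lemma uniformizer_ex:
  "\<exists>p :: 'f::nonarch_local_field. p \<noteq> 0 \<and> vabs p < 1 \<and> (\<forall>x :: 'f. vabs x < 1 \<longrightarrow> vabs x \<le> vabs p)"
proof (rule ccontr)
  assume "\<nexists>p :: 'f. p \<noteq> 0 \<and> vabs p < 1 \<and> (\<forall>x :: 'f. vabs x < 1 \<longrightarrow> vabs x \<le> vabs p)"
  then have *: "\<exists>x :: 'f. vabs x < 1 \<and> vabs p < vabs x" if "p \<noteq> 0" "vabs p < 1" for p :: 'f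
    using that by force
  define P where "P = {x :: 'f. vabs x < 1}"
  have "closed P"
  proof -
    have "open {x :: 'f. \<not> vabs x < 1}"
      unfolding open_iff_vabs
    proof safe
      fix x :: 'f assume "\<not> vabs x < 1"
      then show "\<exists>e>0. \<forall>y. vabs (y - x) < e \<longrightarrow> y \<in> {x. \<not> vabs x < 1}"
        by (intro exI[of _ 1]) (force dest: vabs_eq_of_close[OF less_le_trans])
    qed
    then show ?thesis by (simp add: P_def closed_def Collect_neg_eq)
  qed
  moreover have "{x :: 'f. vabs x \<le> 1} \<inter> P = P"
    by (auto simp: P_def)
  ultimately have "compact P"
    using compact_Int_closed[OF compact_vabs_le_1, of P] by simp
  have cov: "P \<subseteq> (\<Union>y\<in>P. {x. vabs x < vabs y})"
  proof
    fix x assume x: "x \<in> P"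
    obtain a :: 'f where "a \<noteq> 0" "vabs a < 1"
      by (rule vabs_small_ex[OF zero_less_one])
    then have "\<exists>y\<in>P. vabs x < vabs y"
      using x *[of x] by (cases "x = 0") (auto simp: P_def)
    then show "x \<in> (\<Union>y\<in>P. {x. vabs x < vabs y})"
      by blast
  qed
  obtain C where C: "C \<subseteq> P" "finite C" "P \<subseteq> (\<Union>y\<in>C. {x. vabs x < vabs y})"
    by (rule compactE_image[OF \<open>compact P\<close> _ cov]) (auto simp: open_vabs_less)
  have "0 \<in> P" by (simp add: P_def)
  then have "C \<noteq> {}" using C(3) by auto
  then have "Max (vabs ` C) \<in> vabs ` C" using C(2) by simp
  then obtain y where y: "y \<in> C" "vabs y = Max (vabs ` C)" by auto
  then obtain z where z: "z \<in> C" "vabs y < vabs z" using C by blast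
  then have "vabs z \<le> Max (vabs ` C)" using C(2) by simp
  then show False using y z by simp
qed

definition unif :: "'f::nonarch_local_field" where
  "unif = (SOME p. p \<noteq> 0 \<and> vabs p < 1 \<and> (\<forall>x :: 'f. vabs x < 1 \<longrightarrow> vabs x \<le> vabs p))"

lemma
  fixes x :: "'f::nonarch_local_field"
  shows unif_nonzero [simp]: "(unif :: 'f) \<noteq> 0"
    and vabs_unif_less_1: "vabs (unif :: 'f) < 1"
    and vabs_le_unif: "vabs x < 1 \<Longrightarrow> vabs x \<le> vabs (unif :: 'f)"
  using someI_ex[OF uniformizer_ex[where 'f = 'f], folded unif_def] by blast+

text \<open>Discreteness of the value group: a strict bound by \<open>vabs y\<close> is a weak bound
  by the next smaller value. This is how open and closed discs are converted into each
  other.\<close>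

lemma vabs_le_unif_mult_iff:
  "vabs x \<le> vabs (unif :: 'f) * vabs y \<longleftrightarrow> vabs x < vabs y" if "y \<noteq> 0" for x y :: "'f::nonarch_local_field"
proof -
  have "vabs (x / y) \<le> vabs (unif :: 'f) \<longleftrightarrow> vabs (x / y) < 1"
    using vabs_unif_less_1[where 'f = 'f] vabs_le_unif[of "x / y"] by linarith
  then show ?thesis using that by (simp add: vabs_divide field_simps)
qed

lemma vabs_unif_mult_less_iff:
  "vabs (unif :: 'f) * vabs x < vabs y \<longleftrightarrow> vabs x \<le> vabs y" if "y \<noteq> 0" for x y :: "'f::nonarch_local_field"
  using vabs_le_unif_mult_iff[OF that, of "unif * x"] by (simp add: vabs_mult mult_le_cancel_left_pos)

lemma residues_ex:
  fixes a :: "'f::nonarch_local_field"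
  assumes "a \<noteq> 0" "vabs a \<le> 1"
  obtains R :: "'f set" where "finite R" "\<And>r. r \<in> R \<Longrightarrow> vabs r \<le> 1"
    "\<And>x :: 'f. vabs x \<le> 1 \<Longrightarrow> \<exists>!r\<in>R. vabs (x - r) \<le> vabs a"
proof -
  let ?O = "{x :: 'f. vabs x \<le> 1}"
  have cov: "?O \<subseteq> (\<Union>x\<in>?O. {y. vabs (y - x) \<le> vabs a})" by auto
  obtain C where C: "C \<subseteq> ?O" "finite C" "?O \<subseteq> (\<Union>x\<in>C. {y. vabs (y - x) \<le> vabs a})"
    by (rule compactE_image[OF compact_vabs_le_1 _ cov]) (auto simp: open_vabs_ball_le assms)
  \<comment> \<open>A canonical point of the residue class of \<open>x\<close>: congruent arguments
    give \<open>SOME\<close> the same predicate (\<open>ceq\<close>), so the finite cover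
    \<open>C\<close> yields each class only once.\<close>
  define c where "c x = (SOME y. vabs (x - y) \<le> vabs a)" for x :: 'f
  have c: "vabs (x - c x) \<le> vabs a" for x
    unfolding c_def by (rule someI[of _ x]) simp
  have tri: "vabs (x - z) \<le> vabs a" if "vabs (x - y) \<le> vabs a" "vabs (y - z) \<le> vabs a" for x y z :: 'f
    using vabs_add_le[OF that] by simp
  have ceq: "c x = c y" if "vabs (x - y) \<le> vabs a" for x y
  proof -
    have "vabs (x - z) \<le> vabs a \<longleftrightarrow> vabs (y - z) \<le> vabs a" for z
      using that tri[of x y z] tri[of y x z] by (auto simp: vabs_diff_commute)
    then show ?thesis unfolding c_def by simp
  qed
  show thesis
  proof (rule that[of "c ` C"])
    show "vabs r \<le> 1" if "r \<in> c ` C" for r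
    proof -
      obtain x where "x \<in> C" "r = c x" using \<open>r \<in> c ` C\<close> by auto
      then show ?thesis using vabs_diff_le[of x 1 "x - c x"] C(1) c[of x] assms(2) by auto
    qed
    fix x :: 'f assume "vabs x \<le> 1"
    then obtain y where y: "y \<in> C" "vabs (x - y) \<le> vabs a" using C(3) by blast
    show "\<exists>!r\<in>c ` C. vabs (x - r) \<le> vabs a"
    proof (rule ex1I[of _ "c y"], use y tri[OF y(2) c[of y]] in blast)
      fix r assume r: "r \<in> c ` C \<and> vabs (x - r) \<le> vabs a"
      then obtain z where z: "z \<in> C" "r = c z" by auto
      then have "vabs (x - z) \<le> vabs a"
        using tri[of x "c z" z] r c[of z] by (simp add: vabs_diff_commute)
      then have "vabs (y - z) \<le> vabs a"
        using tri[of y x z] y(2) by (simp add: vabs_diff_commute)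
      then show "r = c y" using ceq z by metis
    qed
  qed (use C in auto)
qed

section \<open>Two by two matrices\<close>

definition mat2 :: "'a::zero \<Rightarrow> 'a \<Rightarrow> 'a \<Rightarrow> 'a \<Rightarrow> 'a ^ 2 ^ 2" where
  "mat2 a b c d = vector [vector [a, b], vector [c, d]]"

lemma mat2_nth [simp]:
  "mat2 a b c d $ 1 $ 1 = a" "mat2 a b c d $ 1 $ 2 = b"
  "mat2 a b c d $ 2 $ 1 = c" "mat2 a b c d $ 2 $ 2 = d"
  by (simp_all add: mat2_def)

lemma mat2_eqI:
  "x $ 1 $ 1 = y $ 1 $ 1 \<Longrightarrow> x $ 1 $ 2 = y $ 1 $ 2 \<Longrightarrow> x $ 2 $ 1 = y $ 2 $ 1 \<Longrightarrow> x $ 2 $ 2 = y $ 2 $ 2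
    \<Longrightarrow> x = (y :: 'a ^ 2 ^ 2)"
  by (simp add: vec_eq_iff forall_2)

lemma mat2_eq_iff [simp]: "mat2 a b c d = mat2 a' b' c' d' \<longleftrightarrow> a = a' \<and> b = b' \<and> c = c' \<and> d = d'"
proof
  assume "mat2 a b c d = mat2 a' b' c' d'"
  from arg_cong[OF this, of "\<lambda>x. (x $ 1 $ 1, x $ 1 $ 2, x $ 2 $ 1, x $ 2 $ 2)"]
  show "a = a' \<and> b = b' \<and> c = c' \<and> d = d'" by simp
qed simp

lemma mat2_collapse [simp]: "mat2 (x $ 1 $ 1) (x $ 1 $ 2) (x $ 2 $ 1) (x $ 2 $ 2) = (x :: 'a::zero ^ 2 ^ 2)"
  by (rule mat2_eqI) simp_all

lemma mat2_cases [case_names mat2]: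
  obtains a b c d where "x = mat2 a b c d"
  using mat2_collapse[of x] by (rule that[OF sym])

lemma mat2_mult:
  "mat2 a b c d ** mat2 a' b' c' d' =
    mat2 (a * a' + b * c') (a * b' + b * d') (c * a' + d * c') (c * b' + d * (d' :: 'a::semiring_1))"
  by (rule mat2_eqI) (simp_all add: matrix_matrix_mult_def sum_2)

lemma mat2_diff: "mat2 a b c d - mat2 a' b' c' d' = mat2 (a - a') (b - b') (c - c') (d - (d' :: 'a::ab_group_add))"
  by (rule mat2_eqI) simp_all

lemma mat_eq_mat2: "mat c = mat2 c 0 0 c"
  by (rule mat2_eqI) (simp_all add: mat_def)

lemma zero_eq_mat2: "0 = mat2 0 0 0 0"
  by (rule mat2_eqI) simp_all

lemma det_mat2 [simp]: "det (mat2 a b c d) = a * d - b * (c :: 'a::comm_ring_1)"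
  by (simp add: det_2)

lemma transpose_mat2 [simp]: "transpose (mat2 a b c d) = mat2 a c b d"
  by (rule mat2_eqI) (simp_all add: transpose_def)

lemma invertible_mat2_iff: "invertible (mat2 a b c d) \<longleftrightarrow> a * d - b * c \<noteq> (0 :: 'a::field)"
  by (simp add: invertible_det_nz)

lemma matrix_inv_mat2:
  assumes "a * d - b * c \<noteq> (0 :: 'a::field)"
  shows "matrix_inv (mat2 a b c d) =
    mat2 (d / (a * d - b * c)) (- b / (a * d - b * c)) (- c / (a * d - b * c)) (a / (a * d - b * c))"
  by (rule matrix_inv_unique; use assms in \<open>simp add: mat2_mult mat_eq_mat2 divide_simps; simp add: algebra_simps\<close>)

lemma invertible_matrix_inv: "invertible g \<Longrightarrow> invertible (matrix_inv (g :: 'a::field ^ 2 ^ 2))"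
  unfolding invertible_def[of "matrix_inv g"] by (intro exI[of _ g]) (simp add: matrix_inv_laws)

lemma matrix_inv_mult:
  fixes g h :: "'a::field ^ 2 ^ 2"
  assumes "invertible g" "invertible h"
  shows "matrix_inv (g ** h) = matrix_inv h ** matrix_inv g"
proof (rule matrix_inv_unique)
  have "g ** h ** (matrix_inv h ** matrix_inv g) = g ** (h ** matrix_inv h) ** matrix_inv g"
    by (simp only: matrix_mul_assoc)
  then show "g ** h ** (matrix_inv h ** matrix_inv g) = mat 1"
    using assms by (simp add: matrix_inv_laws)
  have "matrix_inv h ** matrix_inv g ** (g ** h) = matrix_inv h ** (matrix_inv g ** g) ** h"
    by (simp only: matrix_mul_assoc)
  then show "matrix_inv h ** matrix_inv g ** (g ** h) = mat 1"
    using assms by (simp add: matrix_inv_laws)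
qed

lemma matrix_inv_inv: "invertible g \<Longrightarrow> matrix_inv (matrix_inv g) = (g :: 'a::field ^ 2 ^ 2)"
  by (rule matrix_inv_unique) (auto simp: matrix_inv_laws)

lemma matrix_inv_mat_1 [simp]: "matrix_inv (mat 1) = (mat 1 :: 'a::field ^ 2 ^ 2)"
  by (rule matrix_inv_unique) auto

lemma invertible_mat_1 [simp]: "invertible (mat 1 :: 'a::field ^ 2 ^ 2)"
  by (simp add: invertible_det_nz)

lemma invertible_mat: "c \<noteq> 0 \<Longrightarrow> invertible (mat c :: 'a::field ^ 2 ^ 2)"
  by (simp add: invertible_det_nz mat_eq_mat2)

lemma mult_invertible_eq_0_iff:
  fixes g x h :: "'a::field ^ 2 ^ 2"
  assumes "invertible g" "invertible h"
  shows "g ** x ** h = 0 \<longleftrightarrow> x = 0"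
proof
  have zero: "a ** 0 ** b = (0 :: 'a ^ 2 ^ 2)" for a b
    by (simp add: vec_eq_iff matrix_matrix_mult_def)
  assume "g ** x ** h = 0"
  then have "matrix_inv g ** (g ** x ** h) ** matrix_inv h = 0"
    by (simp add: zero)
  also have "matrix_inv g ** (g ** x ** h) ** matrix_inv h = (matrix_inv g ** g) ** x ** (h ** matrix_inv h)"
    by (simp add: matrix_mul_assoc)
  finally show "x = 0" using assms by (simp add: matrix_inv_laws)
qed (simp add: vec_eq_iff matrix_matrix_mult_def)

lemma mat_mult_mat2: "mat t ** mat2 a b c d = mat2 (t * a) (t * b) (t * c) (t * (d :: 'a::field))"
  by (simp add: mat_eq_mat2 mat2_mult)

lemma mat_mult_assoc3: "g ** (mat c ** x) ** h = mat c ** (g ** x ** h)" for g x h :: "'a::field ^ 2 ^ 2"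
proof -
  have "g ** (mat c ** x) ** h = (g ** mat c) ** x ** h"
    by (simp only: matrix_mul_assoc)
  also have "g ** mat c = mat c ** g"
    by (simp only: mat_commute)
  finally show ?thesis
    by (simp only: matrix_mul_assoc)
qed

lemma mult_diff_distrib: "g ** x ** h - g ** y ** h = g ** (x - y) ** h" for g x y h :: "'a::field ^ 2 ^ 2"
  by (simp add: vec_eq_iff forall_2 matrix_matrix_mult_def sum_2 algebra_simps)

lemma transpose_matrix_inv:
  assumes "invertible g"
  shows "transpose (matrix_inv g) = matrix_inv (transpose (g :: 'a::field ^ 2 ^ 2))"
  by (rule matrix_inv_unique[symmetric])
    (simp_all only: matrix_inv_laws[OF assms] transpose_mat matrix_transpose_mul[symmetric])

lemma invertible_transpose2: "invertible (transpose g) \<longleftrightarrow> invertible (g :: 'a::field ^ 2 ^ 2)"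
  by (simp add: invertible_det_nz)

lemma transpose_0 [simp]: "transpose 0 = (0 :: 'a::zero ^ 2 ^ 2)"
  by (simp add: transpose_def vec_eq_iff)

lemma transpose_eq_0_iff [simp]: "transpose x = 0 \<longleftrightarrow> x = (0 :: 'a::zero ^ 2 ^ 2)"
  by (auto simp: vec_eq_iff transpose_def)


section \<open>The maximum norm on matrices and the topology it defines\<close>

definition mnorm :: "'f::nonarch_local_field ^ 2 ^ 2 \<Rightarrow> real" where
  "mnorm x = max (max (vabs (x $ 1 $ 1)) (vabs (x $ 1 $ 2))) (max (vabs (x $ 2 $ 1)) (vabs (x $ 2 $ 2)))"

lemma mnorm_mat2: "mnorm (mat2 a b c d) = max (max (vabs a) (vabs b)) (max (vabs c) (vabs d))"
  by (simp add: mnorm_def)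

lemma mnorm_le_iff: "mnorm x \<le> r \<longleftrightarrow> (\<forall>i j. vabs (x $ i $ j) \<le> r)"
  by (auto simp: mnorm_def forall_2)

lemma mnorm_less_iff: "mnorm x < r \<longleftrightarrow> (\<forall>i j. vabs (x $ i $ j) < r)"
  by (auto simp: mnorm_def forall_2)

lemma vabs_nth_le_mnorm: "vabs (x $ i $ j) \<le> mnorm x"
  using mnorm_le_iff by blast

lemma mnorm_attained: "\<exists>i j. mnorm x = vabs (x $ i $ j)"
  unfolding mnorm_def max_def by metis

lemma mnorm_nonneg [simp]: "0 \<le> mnorm x"
  using mnorm_attained[of x] by auto

lemma mnorm_eq_0_iff [simp]: "mnorm x = 0 \<longleftrightarrow> x = 0"
proof
  assume "mnorm x = 0"
  then have "vabs (x $ i $ j) = 0" for i j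
    using vabs_nth_le_mnorm[of x i j] vabs_nonneg[of "x $ i $ j"] by linarith
  then show "x = 0" by (simp add: vec_eq_iff)
qed (simp add: mnorm_def)

lemma mnorm_0 [simp]: "mnorm 0 = 0"
  by simp

lemma mnorm_pos_iff [simp]: "0 < mnorm x \<longleftrightarrow> x \<noteq> 0"
  using mnorm_nonneg[of x] mnorm_eq_0_iff[of x] by linarith

lemma mnorm_add_le: "mnorm x \<le> r \<Longrightarrow> mnorm y \<le> r \<Longrightarrow> mnorm (x + y) \<le> r"
  by (auto simp: mnorm_le_iff intro: vabs_add_le)

lemma mnorm_add_less: "mnorm x < r \<Longrightarrow> mnorm y < r \<Longrightarrow> mnorm (x + y) < r"
  by (auto simp: mnorm_less_iff intro: vabs_add_less)

lemma mnorm_minus [simp]: "mnorm (- x) = mnorm x"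
  by (simp add: mnorm_def)

lemma mnorm_diff_commute: "mnorm (x - y) = mnorm (y - x)"
  using mnorm_minus[of "x - y"] by simp

lemma mnorm_eq_of_close: "mnorm (x - y) < mnorm y \<Longrightarrow> mnorm x = mnorm y"
proof -
  assume *: "mnorm (x - y) < mnorm y"
  have "mnorm x \<le> mnorm y"
    using mnorm_add_le[of "x - y" "mnorm y" y] * by simp
  moreover have "\<not> mnorm x < mnorm y"
    using mnorm_add_less[of "y - x" "mnorm y" x] * by (auto simp: mnorm_diff_commute)
  ultimately show ?thesis by simp
qed

lemma mnorm_mult_le: "mnorm (x ** y) \<le> mnorm x * mnorm y"
  unfolding mnorm_le_iff[of "x ** y"]
proof (intro allI)
  fix i j
  have "vabs (x $ i $ k * y $ k $ j) \<le> mnorm x * mnorm y" for k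
    by (simp add: vabs_mult mult_mono vabs_nth_le_mnorm)
  then show "vabs ((x ** y) $ i $ j) \<le> mnorm x * mnorm y"
    by (simp add: matrix_matrix_mult_def sum_2 vabs_add_le)
qed

lemma mnorm_mat_mult: "mnorm (mat c ** x) = vabs c * mnorm x"
  by (simp add: mnorm_def mat_mult_nth vabs_mult max_mult_distrib_left)

lemma mnorm_transpose [simp]: "mnorm (transpose x) = mnorm x"
  by (simp add: mnorm_def transpose_def max.commute max.left_commute max.assoc)

text \<open>The norm is the absolute value of some entry, so dividing by that entry normalises the
  matrix. The normalised (primitive) matrices form a compact set that meets every class of nonzero
  matrices.\<close>

lemma primitive_multiple:
  assumes "x \<noteq> (0 :: 'f::nonarch_local_field ^ 2 ^ 2)"
  obtains c where "c \<noteq> 0" "mnorm (mat c ** x) = 1"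
proof -
  obtain i j where ij: "mnorm x = vabs (x $ i $ j)" using mnorm_attained by blast
  moreover have "mnorm x \<noteq> 0" using assms by simp
  ultimately show thesis
    by (intro that[of "inverse (x $ i $ j)"]) (auto simp: mnorm_mat_mult vabs_inverse)
qed

text \<open>Open sets of a vector type are described by boxes, and a matrix is a vector of vectors,
  so boxes are unfolded twice; the four radii have a positive minimum.\<close>

lemma open_iff_mnorm:
  "open S \<longleftrightarrow> (\<forall>x\<in>S. \<exists>e>0. \<forall>y :: 'f::nonarch_local_field ^ 2 ^ 2. mnorm (y - x) < e \<longrightarrow> y \<in> S)"
proof (intro iffI ballI)
  fix x assume "open S" "x \<in> S"
  then have "\<exists>A. (\<forall>i. open (A i) \<and> x $ i \<in> A i) \<and> (\<forall>y. (\<forall>i. y $ i \<in> A i) \<longrightarrow> y \<in> S)"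
    by (intro bspec[OF iffD1[OF open_vec_def]])
  then obtain A where A: "\<And>i. open (A i)" "\<And>i. x $ i \<in> A i" "\<And>y. (\<forall>i. y $ i \<in> A i) \<Longrightarrow> y \<in> S"
    by blast
  have "\<exists>B. (\<forall>j. open (B j) \<and> x $ i $ j \<in> B j) \<and> (\<forall>y. (\<forall>j. y $ j \<in> B j) \<longrightarrow> y \<in> A i)" for i
    by (rule bspec[OF iffD1[OF open_vec_def A(1)] A(2)])
  then have "\<exists>B. \<forall>i. (\<forall>j. open (B i j) \<and> x $ i $ j \<in> B i j) \<and> (\<forall>y. (\<forall>j. y $ j \<in> B i j) \<longrightarrow> y \<in> A i)"
    by (intro choice) blast
  then obtain B where B: "\<And>i j. open (B i j)" "\<And>i j. x $ i $ j \<in> B i j"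
      "\<And>i y. (\<forall>j. y $ j \<in> B i j) \<Longrightarrow> y \<in> A i"
    by blast
  have "\<exists>e>0. \<forall>z. vabs (z - x $ i $ j) < e \<longrightarrow> z \<in> B i j" for i j
    using B(1,2)[of i j] unfolding open_iff_vabs by blast
  then have "\<exists>e. \<forall>i j. e i j > 0 \<and> (\<forall>z. vabs (z - x $ i $ j) < e i j \<longrightarrow> z \<in> B i j)"
    by (intro choice allI)
  then obtain e where e: "\<And>i j. e i j > 0" "\<And>i j z. vabs (z - x $ i $ j) < e i j \<Longrightarrow> z \<in> B i j"
    by blast
  define d where "d = min (min (e 1 1) (e 1 2)) (min (e 2 1) (e 2 2))"
  have d: "d \<le> e i j" for i j
  proof -
    have "\<forall>i j. d \<le> e i j" by (auto simp: d_def forall_2)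
    then show ?thesis by blast
  qed
  have "y \<in> S" if "mnorm (y - x) < d" for y
  proof (rule A(3), rule allI, rule B(3), rule allI, rule e(2))
    fix i j show "vabs (y $ i $ j - x $ i $ j) < e i j"
      using that d[of i j] by (auto simp: mnorm_less_iff intro: less_le_trans)
  qed
  moreover have "d > 0" using e(1) by (simp add: d_def)
  ultimately show "\<exists>e>0. \<forall>y. mnorm (y - x) < e \<longrightarrow> y \<in> S" by blast
next
  assume *: "\<forall>x\<in>S. \<exists>e>0. \<forall>y. mnorm (y - x) < e \<longrightarrow> y \<in> S"
  have op: "open {z. vabs (z - c) < e}" for c :: 'f and e
    unfolding open_iff_vabs
  proof safe
    fix y assume y: "vabs (y - c) < e"
    then have "e > 0" using vabs_nonneg[of "y - c"] by linarith
    then show "\<exists>d>0. \<forall>z. vabs (z - y) < d \<longrightarrow> z \<in> {z. vabs (z - c) < e}"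
      using y vabs_add_less[of "_ - y" e "y - c"] by (intro exI[of _ e]) force
  qed
  show "open S"
    unfolding open_vec_def[of S]
  proof
    fix x assume "x \<in> S"
    then obtain e where e: "e > 0" "\<And>y. mnorm (y - x) < e \<Longrightarrow> y \<in> S" using * by blast
    let ?A = "\<lambda>i. {r :: 'f ^ 2. \<forall>j. r $ j \<in> {z. vabs (z - x $ i $ j) < e}}"
    have "open (?A i)" for i by (rule open_vector_box) (simp add: op)
    moreover have "x $ i \<in> ?A i" for i using e(1) by simp
    moreover have "y \<in> S" if "\<forall>i. y $ i \<in> ?A i" for y
      using that by (intro e(2)) (simp add: mnorm_less_iff)
    ultimately show "\<exists>A. (\<forall>i. open (A i) \<and> x $ i \<in> A i) \<and> (\<forall>y. (\<forall>i. y $ i \<in> A i) \<longrightarrow> y \<in> S)"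
      by (intro exI[of _ ?A]) blast
  qed
qed

lemma compact_mnorm_le_1: "compact {x :: 'f::nonarch_local_field ^ 2 ^ 2. mnorm x \<le> 1}"
proof -
  let ?O = "{x :: 'f. vabs x \<le> 1}"
  let ?f = "\<lambda>((a, b), c, d). mat2 a b c (d :: 'f)"
  have eq: "?f = (\<lambda>p. \<chi> i. if i = 1 then (\<chi> j. if j = 1 then fst (fst p) else snd (fst p))
                    else (\<chi> j. if j = 1 then fst (snd p) else snd (snd p)))"
    by (auto intro!: mat2_eqI)
  have "continuous_on ((?O \<times> ?O) \<times> ?O \<times> ?O) (\<lambda>p. if i = 1
      then (\<chi> j. if j = 1 then fst (fst p) else snd (fst p)) :: 'f ^ 2
      else (\<chi> j. if j = 1 then fst (snd p) else snd (snd p)))" for i :: 2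
    by (cases "i = 1"; simp; rule continuous_on_vec_lambda; rename_tac j; case_tac "j = 1";
        simp; intro continuous_intros)
  then have 1: "continuous_on ((?O \<times> ?O) \<times> ?O \<times> ?O) ?f"
    unfolding eq by (rule continuous_on_vec_lambda)
  have "compact (?f ` ((?O \<times> ?O) \<times> ?O \<times> ?O))"
    by (intro compact_continuous_image[OF 1] compact_Times compact_vabs_le_1)
  also have "?f ` ((?O \<times> ?O) \<times> ?O \<times> ?O) = {x. mnorm x \<le> 1}"
  proof (intro equalityI subsetI)
    fix x :: "'f ^ 2 ^ 2" assume "x \<in> {x. mnorm x \<le> 1}"
    then show "x \<in> ?f ` ((?O \<times> ?O) \<times> ?O \<times> ?O)"
      by (intro image_eqI[of _ _ "((x $ 1 $ 1, x $ 1 $ 2), x $ 2 $ 1, x $ 2 $ 2)"])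
        (auto simp: mnorm_le_iff)
  qed (auto simp: mnorm_mat2)
  finally show ?thesis .
qed

lemma compact_mnorm_eq_1: "compact {x :: 'f::nonarch_local_field ^ 2 ^ 2. mnorm x = 1}"
proof -
  have "open {x :: 'f ^ 2 ^ 2. mnorm x < 1}"
    unfolding open_iff_mnorm
  proof safe
    fix x :: "'f ^ 2 ^ 2" assume "mnorm x < 1"
    then show "\<exists>e>0. \<forall>y. mnorm (y - x) < e \<longrightarrow> y \<in> {x. mnorm x < 1}"
      using mnorm_add_less[of "_ - x" 1 x] by (intro exI[of _ 1]) force
  qed
  then have "compact ({x :: 'f ^ 2 ^ 2. mnorm x \<le> 1} - {x. mnorm x < 1})"
    by (rule compact_diff[OF compact_mnorm_le_1])
  also have "{x :: 'f ^ 2 ^ 2. mnorm x \<le> 1} - {x. mnorm x < 1} = {x. mnorm x = 1}"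
    by auto
  finally show ?thesis .
qed

section \<open>Locally constant homogeneous functions\<close>

definition gl2o :: "('f::nonarch_local_field ^ 2 ^ 2) set" where
  "gl2o = {g. mnorm g \<le> 1 \<and> vabs (det g) = 1}"

lemma gl2o_invertible: "g \<in> gl2o \<Longrightarrow> invertible g"
  by (auto simp: gl2o_def invertible_det_nz)

lemma one_in_gl2o [simp]: "mat 1 \<in> gl2o"
  by (simp add: gl2o_def mat_eq_mat2 mnorm_mat2)

lemma gl2o_mult: "g \<in> gl2o \<Longrightarrow> h \<in> gl2o \<Longrightarrow> g ** h \<in> gl2o"
  using mnorm_mult_le[of g h] mult_mono[of "mnorm g" 1 "mnorm h" 1]
  by (auto simp: gl2o_def det_mul vabs_mult)

lemma gl2o_matrix_inv:
  assumes "g \<in> gl2o"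
  shows "matrix_inv g \<in> gl2o"
proof (cases g rule: mat2_cases)
  case (mat2 a b c d)
  have D: "vabs (a * d - b * c) = 1" "a * d - b * c \<noteq> 0"
    using assms by (auto simp: gl2o_def mat2)
  have "vabs (det g * det (matrix_inv g)) = 1"
    using matrix_inv_laws[OF gl2o_invertible[OF assms]] by (simp flip: det_mul)
  then have "vabs (det (matrix_inv g)) = 1"
    using assms by (simp add: gl2o_def vabs_mult)
  then show ?thesis
    using assms D unfolding gl2o_def mat2 matrix_inv_mat2[OF D(2)]
    by (simp add: mnorm_mat2 vabs_divide del: det_mat2)
qed

lemma mnorm_mult_gl2o_le:
  assumes "g \<in> gl2o" "h \<in> gl2o"
  shows "mnorm (g ** x ** h) \<le> mnorm x"
proof -
  have "mnorm (g ** x ** h) \<le> mnorm (g ** x) * mnorm h" by (rule mnorm_mult_le)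
  also have "\<dots> \<le> mnorm (g ** x) * 1"
    using assms by (intro mult_left_mono) (auto simp: gl2o_def)
  also have "\<dots> \<le> mnorm g * mnorm x" using mnorm_mult_le[of g x] by simp
  also have "\<dots> \<le> 1 * mnorm x"
    using assms by (intro mult_right_mono) (auto simp: gl2o_def)
  finally show ?thesis by simp
qed

lemma matrix_inv_cancel:
  fixes g x h :: "'f::field ^ 2 ^ 2"
  assumes "invertible g" "invertible h"
  shows "matrix_inv g ** (g ** x ** h) ** matrix_inv h = x"
proof -
  have "matrix_inv g ** (g ** x ** h) ** matrix_inv h = (matrix_inv g ** g) ** x ** (h ** matrix_inv h)"
    by (simp only: matrix_mul_assoc)
  then show ?thesis using assms by (simp add: matrix_inv_laws)
qed

text \<open>Integral matrices do not increase the norm, and the inverses are integral as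
  well.\<close>

lemma mnorm_mult_gl2o:
  assumes "g \<in> gl2o" "h \<in> gl2o"
  shows "mnorm (g ** x ** h) = mnorm x"
proof (rule antisym)
  show "mnorm x \<le> mnorm (g ** x ** h)"
    using mnorm_mult_gl2o_le[OF gl2o_matrix_inv gl2o_matrix_inv, OF assms, of "g ** x ** h"]
      matrix_inv_cancel[of g h x] assms by (simp add: gl2o_invertible)
qed (rule mnorm_mult_gl2o_le[OF assms])

definition cong_subgroup :: "'f::nonarch_local_field \<Rightarrow> ('f ^ 2 ^ 2) set" where
  "cong_subgroup a = {g. mnorm (g - mat 1) \<le> vabs a}"

lemma cong_subgroup_gl2o:
  assumes "vabs a < 1" "g \<in> cong_subgroup a"
  shows "g \<in> gl2o"
proof (cases g rule: mat2_cases)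
  case (mat2 p q r s)
  have le: "vabs (p - 1) \<le> vabs a" "vabs q \<le> vabs a" "vabs r \<le> vabs a" "vabs (s - 1) \<le> vabs a"
    using assms(2) by (auto simp: cong_subgroup_def mat2 mat_eq_mat2 mat2_diff mnorm_mat2)
  have one: "vabs p = 1" "vabs s = 1"
    using le assms(1) vabs_eq_of_close[of p 1] vabs_eq_of_close[of s 1] by auto
  have "vabs (q * r) < 1"
    using le assms(1) mult_le_one[of "vabs q" "vabs r"] mult_strict_mono[of "vabs q" 1 "vabs r" 1]
    by (cases "q = 0 \<or> r = 0") (auto simp: vabs_mult)
  then have "vabs (p * s - q * r) = vabs (p * s)"
    using one by (intro vabs_eq_of_close) (simp add: vabs_mult)
  then show ?thesis
    using one le assms(1) by (auto simp: gl2o_def mat2 mnorm_mat2 vabs_mult)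
qed

lemma cong_subgroup_one [simp]: "mat 1 \<in> cong_subgroup a"
  by (simp add: cong_subgroup_def)

lemma cong_subgroup_mult:
  assumes "vabs a < 1" "g \<in> cong_subgroup a" "h \<in> cong_subgroup a"
  shows "g ** h \<in> cong_subgroup a"
proof -
  have "mat 1 ** (g - mat 1) ** h = mat 1 ** g ** h - mat 1 ** mat 1 ** h"
    by (rule mult_diff_distrib[symmetric])
  then have "g ** h - mat 1 = mat 1 ** (g - mat 1) ** h + (h - mat 1)"
    by simp
  also have "mnorm \<dots> \<le> vabs a"
    using assms cong_subgroup_gl2o[OF assms(1)]
    by (intro mnorm_add_le order_trans[OF mnorm_mult_gl2o_le]) (auto simp: cong_subgroup_def)
  finally show ?thesis by (simp add: cong_subgroup_def)
qed

lemma cong_subgroup_matrix_inv: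
  assumes "vabs a < 1" "g \<in> cong_subgroup a"
  shows "matrix_inv g \<in> cong_subgroup a"
proof -
  have g: "g \<in> gl2o" using assms by (rule cong_subgroup_gl2o)
  have "matrix_inv g ** (mat 1 - g) ** mat 1 = matrix_inv g ** mat 1 ** mat 1 - matrix_inv g ** g ** mat 1"
    by (rule mult_diff_distrib[symmetric])
  then have "matrix_inv g - mat 1 = matrix_inv g ** (mat 1 - g) ** mat 1"
    using matrix_inv_laws[OF gl2o_invertible[OF g]] by simp
  also have "mnorm \<dots> \<le> mnorm (mat 1 - g)"
    using g by (intro mnorm_mult_gl2o_le gl2o_matrix_inv) auto
  finally show ?thesis
    using assms by (simp add: cong_subgroup_def mnorm_diff_commute)
qed


text \<open>The pullbacks of Schwartz functions on the projective space to the space of matrices, extended by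
  \<open>0\<close> at the zero matrix. The subspace \<open>lcf0\<close> corresponds to \<open>\<S>(PGL\<^sub>2)\<close>.\<close>

definition lcf :: "('f::nonarch_local_field ^ 2 ^ 2 \<Rightarrow> complex) set" where
  "lcf = {F. F 0 = 0 \<and> (\<forall>c x. c \<noteq> 0 \<longrightarrow> F (mat c ** x) = F x) \<and>
    (\<forall>x. x \<noteq> 0 \<longrightarrow> (\<exists>e>0. \<forall>y. mnorm (y - x) < e \<longrightarrow> F y = F x))}"

definition lcf0 :: "('f::nonarch_local_field ^ 2 ^ 2 \<Rightarrow> complex) set" where
  "lcf0 = {F \<in> lcf. \<forall>x. det x = 0 \<longrightarrow> F x = 0}"

text \<open>The point action takes \<open>x\<close> to \<open>g x h\<^sup>-\<^sup>1\<close>;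
  functions are pulled back along its inverse, which inverts \<open>g\<close> and leaves
  \<open>h\<close> as it is.\<close>

definition act :: "'f::nonarch_local_field ^ 2 ^ 2 \<Rightarrow> 'f ^ 2 ^ 2 \<Rightarrow> ('f ^ 2 ^ 2 \<Rightarrow> complex) \<Rightarrow> 'f ^ 2 ^ 2 \<Rightarrow> complex"
  where "act g h F = (\<lambda>x. F (matrix_inv g ** x ** h))"

lemma lcf_0: "F \<in> lcf \<Longrightarrow> F 0 = 0"
  and lcf_scale: "F \<in> lcf \<Longrightarrow> c \<noteq> 0 \<Longrightarrow> F (mat c ** x) = F x"
  and lcf_loc: "F \<in> lcf \<Longrightarrow> x \<noteq> 0 \<Longrightarrow> \<exists>e>0. \<forall>y. mnorm (y - x) < e \<longrightarrow> F y = F x"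
  unfolding lcf_def by blast+

lemma lcf0_lcf: "F \<in> lcf0 \<Longrightarrow> F \<in> lcf"
  by (simp add: lcf0_def)

lemma lcf0_det: "F \<in> lcf0 \<Longrightarrow> det x = 0 \<Longrightarrow> F x = 0"
  by (simp add: lcf0_def)

lemma lcf0I:
  assumes "F \<in> lcf" "\<And>x. x \<noteq> 0 \<Longrightarrow> det x = 0 \<Longrightarrow> F x = 0"
  shows "F \<in> lcf0"
proof -
  have "F x = 0" if "det x = 0" for x
    using assms(2)[OF _ that] lcf_0[OF assms(1)] by (cases "x = 0") simp_all
  then show ?thesis using assms(1) by (simp add: lcf0_def)
qed

lemma lcf_combine:
  assumes "F \<in> lcf" "G \<in> lcf" "\<phi> 0 0 = 0"
  shows "(\<lambda>x. \<phi> (F x) (G x)) \<in> lcf"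
proof -
  have "\<exists>e>0. \<forall>y. mnorm (y - x) < e \<longrightarrow> \<phi> (F y) (G y) = \<phi> (F x) (G x)" if x: "x \<noteq> 0" for x
  proof -
    obtain e where e: "e > 0" "\<forall>y. mnorm (y - x) < e \<longrightarrow> F y = F x"
      using lcf_loc[OF assms(1) x] by blast
    obtain d where d: "d > 0" "\<forall>y. mnorm (y - x) < d \<longrightarrow> G y = G x"
      using lcf_loc[OF assms(2) x] by blast
    have "\<phi> (F y) (G y) = \<phi> (F x) (G x)" if "mnorm (y - x) < min e d" for y
      using e(2)[rule_format, of y] d(2)[rule_format, of y] that by simp
    then show ?thesis using e(1) d(1) by (intro exI[of _ "min e d"]) (simp only: min_less_iff_conj, blast)
  qed
  then show ?thesis
    using assms by (simp add: lcf_def)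
qed

lemma zero_in_lcf: "(\<lambda>x. 0) \<in> lcf"
  by (auto simp: lcf_def intro: exI[of _ 1])

lemma lcf_add: "F \<in> lcf \<Longrightarrow> G \<in> lcf \<Longrightarrow> (\<lambda>x. F x + G x) \<in> lcf"
  by (rule lcf_combine[where \<phi> = "(+)"]) simp_all

lemma lcf_diff: "F \<in> lcf \<Longrightarrow> G \<in> lcf \<Longrightarrow> (\<lambda>x. F x - G x) \<in> lcf"
  by (rule lcf_combine[where \<phi> = "(-)"]) simp_all

lemma lcf_cmult: "F \<in> lcf \<Longrightarrow> (\<lambda>x. c * F x) \<in> lcf"
  by (rule lcf_combine[of F F "\<lambda>a b. c * a"]) simp_all

lemma lcf0_add: "F \<in> lcf0 \<Longrightarrow> G \<in> lcf0 \<Longrightarrow> (\<lambda>x. F x + G x) \<in> lcf0"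
  by (simp add: lcf0_def lcf_add)

lemma lcf0_cmult: "F \<in> lcf0 \<Longrightarrow> (\<lambda>x. c * F x) \<in> lcf0"
  by (simp add: lcf0_def lcf_cmult)

lemma lcf_act:
  assumes "F \<in> lcf" "invertible g" "invertible h"
  shows "act g h F \<in> lcf"
proof -
  have inv: "invertible (matrix_inv g)" using assms(2) by (rule invertible_matrix_inv)
  have "\<exists>e>0. \<forall>y. mnorm (y - x) < e \<longrightarrow> act g h F y = act g h F x" if "x \<noteq> 0" for x
  proof -
    let ?m = "\<lambda>x. matrix_inv g ** x ** h"
    have "?m x \<noteq> 0" using that mult_invertible_eq_0_iff[OF inv assms(3)] by blast
    from lcf_loc[OF assms(1) this]
    obtain e where e: "e > 0" "\<And>y. mnorm (y - ?m x) < e \<Longrightarrow> F y = F (?m x)" by blast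
    define C where "C = mnorm (matrix_inv g) * mnorm h + 1"
    have C: "C > 0" unfolding C_def by (intro add_nonneg_pos mult_nonneg_nonneg) auto
    have "F (?m y) = F (?m x)" if "mnorm (y - x) < e / C" for y
    proof (rule e(2))
      have "mnorm (?m y - ?m x) = mnorm (?m (y - x))" by (simp add: mult_diff_distrib)
      also have "\<dots> \<le> mnorm (matrix_inv g ** (y - x)) * mnorm h" by (rule mnorm_mult_le)
      also have "\<dots> \<le> mnorm (matrix_inv g) * mnorm (y - x) * mnorm h"
        by (intro mult_right_mono mnorm_mult_le) auto
      also have "\<dots> \<le> C * mnorm (y - x)" by (simp add: C_def algebra_simps)
      also have "\<dots> < e" using that C by (simp add: field_simps)
      finally show "mnorm (?m y - ?m x) < e" .
    qed
    moreover have "e / C > 0" using e(1) C by simp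
    ultimately show ?thesis unfolding act_def by blast
  qed
  moreover have "act g h F 0 = 0"
    using mult_invertible_eq_0_iff[OF inv assms(3), of 0] lcf_0[OF assms(1)] by (simp add: act_def)
  ultimately show ?thesis
    by (simp add: lcf_def act_def mat_mult_assoc3 lcf_scale[OF assms(1)])
qed

lemma lcf0_act:
  assumes "F \<in> lcf0" "invertible g" "invertible h"
  shows "act g h F \<in> lcf0"
proof (rule lcf0I)
  show "act g h F \<in> lcf" by (intro lcf_act lcf0_lcf assms)
  fix x :: "'a ^ 2 ^ 2" assume "det x = 0"
  then have "det (matrix_inv g ** x ** h) = 0" by (simp add: det_mul)
  then show "act g h F x = 0" unfolding act_def by (rule lcf0_det[OF assms(1)])
qed

lemma act_act:
  assumes "invertible g" "invertible g'"
  shows "act (g ** g') (h ** h') F = act g h (act g' h' F)"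
  using assms by (simp add: act_def matrix_inv_mult matrix_mul_assoc)

lemma act_one [simp]: "act (mat 1) (mat 1) F = F"
  by (simp add: act_def)

text \<open>Transposition exchanges the two factors of the group; with it statements about the right
  factor are reduced to the left one.\<close>

lemma lcf_transpose:
  assumes "F \<in> lcf"
  shows "(\<lambda>x. F (transpose x)) \<in> lcf"
proof -
  have "\<exists>e>0. \<forall>y. mnorm (y - x) < e \<longrightarrow> F (transpose y) = F (transpose x)" if x: "x \<noteq> 0" for x
  proof -
    have "transpose x \<noteq> 0" using x by simp
    from lcf_loc[OF assms this]
    obtain e where e: "e > 0" "\<And>y. mnorm (y - transpose x) < e \<Longrightarrow> F y = F (transpose x)"
      by blast
    have "mnorm (transpose y - transpose x) = mnorm (y - x)" for y
      using mnorm_transpose[of "y - x"] by (simp add: transpose_def vec_eq_iff mnorm_def)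
    then have "F (transpose y) = F (transpose x)" if "mnorm (y - x) < e" for y
      using that by (intro e(2)) simp
    then show ?thesis using e(1) by blast
  qed
  moreover have "transpose (mat c ** x) = mat c ** transpose x" for c and x :: "'a ^ 2 ^ 2"
    by (simp add: matrix_transpose_mul transpose_mat mat_commute)
  ultimately show ?thesis
    using lcf_0[OF assms] lcf_scale[OF assms] by (simp add: lcf_def)
qed

lemma lcf0_transpose: "F \<in> lcf0 \<Longrightarrow> (\<lambda>x. F (transpose x)) \<in> lcf0"
  by (rule lcf0I[OF lcf_transpose[OF lcf0_lcf]]) (assumption, erule lcf0_det, simp only: det_transpose)

text \<open>For a homogeneous set the radius has to scale with \<open>mnorm x\<close>. Nearby
  matrices have equal norm, so the last hypothesis also applies with \<open>x\<close> and
  \<open>y\<close> exchanged and gives both directions.\<close>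

lemma lcf_indicator:
  assumes "0 \<notin> S" "\<And>c x. c \<noteq> 0 \<Longrightarrow> x \<in> S \<Longrightarrow> mat c ** x \<in> S" "0 < e" "e \<le> 1"
    and "\<And>x y. x \<in> S \<Longrightarrow> mnorm (y - x) < e * mnorm x \<Longrightarrow> mnorm y = mnorm x \<Longrightarrow> y \<in> S"
  shows "(\<lambda>x. of_bool (x \<in> S)) \<in> lcf"
proof -
  have "mat c ** x \<in> S \<longleftrightarrow> x \<in> S" if "c \<noteq> 0" for c x
    using assms(2)[of c x] assms(2)[of "inverse c" "mat c ** x"] that
    by (auto simp: matrix_mul_assoc mat_mult_mat)
  moreover have "\<exists>d>0. \<forall>y. mnorm (y - x) < d \<longrightarrow> (y \<in> S \<longleftrightarrow> x \<in> S)" if "x \<noteq> 0" for x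
  proof -
    have "y \<in> S \<longleftrightarrow> x \<in> S" if *: "mnorm (y - x) < e * mnorm x" for y
    proof -
      have "e * mnorm x \<le> mnorm x" using assms(4) by (simp add: mult_left_le_one_le \<open>0 < e\<close> less_imp_le)
      then have "mnorm y = mnorm x" using * by (intro mnorm_eq_of_close) simp
      moreover have "mnorm (x - y) = mnorm (y - x)" by (rule mnorm_diff_commute)
      ultimately show ?thesis
        using assms(5)[of x y] assms(5)[of y x] * by metis
    qed
    moreover have "e * mnorm x > 0" using that \<open>0 < e\<close> by simp
    ultimately show ?thesis by blast
  qed
  ultimately show ?thesis
    using assms(1) unfolding lcf_def by (simp only: mem_Collect_eq of_bool_eq_iff) simp
qed


section \<open>Levels: uniform local constancy and finite orbits\<close>

definition has_level :: "'f::nonarch_local_field \<Rightarrow> ('f ^ 2 ^ 2 \<Rightarrow> complex) \<Rightarrow> bool" where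
  "has_level a F \<longleftrightarrow> a \<noteq> 0 \<and> vabs a < 1 \<and>
    (\<forall>x y. mnorm x = 1 \<longrightarrow> mnorm (y - x) \<le> vabs a \<longrightarrow> F y = F x)"

text \<open>A Lebesgue number argument on the compact set of primitive matrices: in an ultrametric
  the disc of radius \<open>e z\<close> around \<open>z\<close> contains every smaller disc around
  each of its points.\<close>

lemma level_ex:
  assumes "F \<in> lcf"
  obtains a where "has_level a F"
proof -
  let ?P = "{x :: 'a ^ 2 ^ 2. mnorm x = 1}"
  have "\<exists>e>0. \<forall>y. mnorm (y - x) < e \<longrightarrow> F y = F x" if "x \<in> ?P" for x
    using that by (intro lcf_loc[OF assms]) force
  then obtain e where e: "\<And>x. x \<in> ?P \<Longrightarrow> e x > 0"
      "\<And>x y. x \<in> ?P \<Longrightarrow> mnorm (y - x) < e x \<Longrightarrow> F y = F x" by metis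
  have op: "open {y. mnorm (y - x) < e x}" if "x \<in> ?P" for x
    unfolding open_iff_mnorm
  proof safe
    fix y assume "mnorm (y - x) < e x"
    then show "\<exists>d>0. \<forall>z. mnorm (z - y) < d \<longrightarrow> z \<in> {y. mnorm (y - x) < e x}"
      using e(1)[OF that] mnorm_add_less[of "_ - y" "e x" "y - x"] by (intro exI[of _ "e x"]) force
  qed
  have cov: "?P \<subseteq> (\<Union>x\<in>?P. {y. mnorm (y - x) < e x})" using e(1) by force
  obtain C where C: "C \<subseteq> ?P" "finite C" "?P \<subseteq> (\<Union>x\<in>C. {y. mnorm (y - x) < e x})"
    by (rule compactE_image[OF compact_mnorm_eq_1 op cov])
  have "mat 1 \<in> ?P" by (simp add: mat_eq_mat2 mnorm_mat2)
  then have "C \<noteq> {}" using C(3) by blast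
  then have "Min (e ` C) > 0" using C(1,2) e(1) by (subst Min_gr_iff) auto
  then obtain a :: 'a where a: "a \<noteq> 0" "vabs a < Min (e ` C)" "vabs a < 1"
    by (rule vabs_small_ex)
  have "F y = F x" if xy: "mnorm x = 1" "mnorm (y - x) \<le> vabs a" for x y
  proof -
    obtain z where z: "z \<in> C" "mnorm (x - z) < e z" using C(3) xy(1) by blast
    have "vabs a < e z" using a(2) C(2) z(1) by (auto intro: less_le_trans)
    then have "mnorm (y - z) < e z"
      using mnorm_add_less[of "y - x" "e z" "x - z"] xy(2) z by simp
    then show ?thesis
      using e(2)[of z x] e(2)[of z y] z C(1) by (simp add: subset_eq)
  qed
  then show thesis using a by (intro that[of a]) (unfold has_level_def, blast)
qed

text \<open>For primitive \<open>x\<close> the norms of \<open>k ** x - x\<close> and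
  \<open>x ** k - x\<close> are at most \<open>vabs a\<close>, and homogeneity reduces every nonzero
  \<open>x\<close> to this case. This is the smoothness of the representation on
  \<open>lcf\<close>.\<close>

lemma level_invariant:
  assumes "has_level a F" "F \<in> lcf" "k \<in> cong_subgroup a"
  shows "F (k ** x) = F x" "F (x ** k) = F x"
proof -
  have a: "vabs a < 1" using assms(1) by (simp add: has_level_def)
  have k: "k \<in> gl2o" "mnorm (k - mat 1) \<le> vabs a"
    using cong_subgroup_gl2o[OF a assms(3)] assms(3) by (auto simp: cong_subgroup_def)
  have zero: "k ** 0 = 0" "0 ** k = 0" by (simp_all add: vec_eq_iff matrix_matrix_mult_def)
  have main: "F (k ** x) = F x \<and> F (x ** k) = F x" if "mnorm x = 1" for x
  proof -
    have "mnorm (mat 1 ** (k - mat 1) ** x) \<le> vabs a" "mnorm (x ** (k - mat 1) ** mat 1) \<le> vabs a"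
      using mnorm_mult_le[of "k - mat 1" x] mnorm_mult_le[of x "k - mat 1"] k that by auto
    then have "mnorm (k ** x - x) \<le> vabs a" "mnorm (x ** k - x) \<le> vabs a"
      using mult_diff_distrib[of "mat 1" k x "mat 1"] mult_diff_distrib[of x k "mat 1" "mat 1"] by simp_all
    then show ?thesis using assms(1) that unfolding has_level_def by blast
  qed
  have "F (k ** x) = F x \<and> F (x ** k) = F x"
  proof (cases "x = 0")
    case False
    then obtain c where c: "c \<noteq> 0" "mnorm (mat c ** x) = 1" by (rule primitive_multiple)
    have "k ** (mat c ** x) = mat c ** (k ** x)" "(mat c ** x) ** k = mat c ** (x ** k)"
      by (metis mat_commute matrix_mul_assoc)+
    then show ?thesis using main[OF c(2)] lcf_scale[OF assms(2) c(1)] by simp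
  qed (simp add: zero)
  then show "F (k ** x) = F x" "F (x ** k) = F x" by auto
qed

lemma finite_image_factor:
  assumes "finite (k ` H)" "\<And>x y. x \<in> H \<Longrightarrow> y \<in> H \<Longrightarrow> k x = k y \<Longrightarrow> \<phi> x = \<phi> y"
  shows "finite (\<phi> ` H)"
proof (rule finite_surj[OF assms(1)])
  show "\<phi> ` H \<subseteq> (\<lambda>z. \<phi> (inv_into H k z)) ` k ` H"
  proof
    fix w assume "w \<in> \<phi> ` H"
    then obtain x where x: "x \<in> H" "w = \<phi> x" by auto
    then have "\<phi> (inv_into H k (k x)) = \<phi> x"
      by (intro assms(2)) (auto intro: inv_into_into f_inv_into_f)
    then show "w \<in> (\<lambda>z. \<phi> (inv_into H k z)) ` k ` H"
      using x by (auto intro!: image_eqI[of _ _ "k x"])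
  qed
qed

text \<open>If \<open>F\<close> has level \<open>a\<close>, the translate \<open>act g h F\<close>
  depends only on \<open>g\<close> and \<open>h\<close> modulo \<open>a\<close>, and by compactness
  there are finitely many such classes.\<close>

lemma finite_orbit:
  assumes "F \<in> lcf" "H \<subseteq> gl2o \<times> gl2o"
  shows "finite ((\<lambda>(g, h). act g h F) ` H)"
proof -
  obtain a where a: "has_level a F" using level_ex[OF assms(1)] by blast
  let ?O = "{x :: 'a ^ 2 ^ 2. mnorm x \<le> 1}"
  have op: "open {y. mnorm (y - x) \<le> vabs a}" for x
    unfolding open_iff_mnorm
  proof safe
    fix y assume "mnorm (y - x) \<le> vabs a"
    then show "\<exists>d>0. \<forall>z. mnorm (z - y) < d \<longrightarrow> z \<in> {y. mnorm (y - x) \<le> vabs a}"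
      using a mnorm_add_le[of "_ - y" "vabs a" "y - x"] unfolding has_level_def
      by (intro exI[of _ "vabs a"]) force
  qed
  have cov: "?O \<subseteq> (\<Union>x\<in>?O. {y. mnorm (y - x) \<le> vabs a})"
    by (force intro: bexI)
  obtain C where C: "C \<subseteq> ?O" "finite C" "?O \<subseteq> (\<Union>x\<in>C. {y. mnorm (y - x) \<le> vabs a})"
    by (rule compactE_image[OF compact_mnorm_le_1 op cov])
  define cl where "cl x = (SOME r. r \<in> C \<and> mnorm (x - r) \<le> vabs a)" for x
  have cl: "cl x \<in> C \<and> mnorm (x - cl x) \<le> vabs a" if "x \<in> ?O" for x
    unfolding cl_def by (rule someI_ex) (use C(3) that in auto)
  have close: "mnorm (x - y) \<le> vabs a" if "x \<in> ?O" "y \<in> ?O" "cl x = cl y" for x y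
    using mnorm_add_le[of "x - cl x" "vabs a" "cl y - y"] cl[OF that(1)] cl[OF that(2)] that(3)
    by (simp add: mnorm_diff_commute)
  show ?thesis
  proof (rule finite_image_factor[where k = "\<lambda>(g, h). (cl g, cl h)"])
    have "(\<lambda>(g, h). (cl g, cl h)) ` H \<subseteq> C \<times> C"
      using assms(2) cl by (fastforce simp: gl2o_def)
    then show "finite ((\<lambda>(g, h). (cl g, cl h)) ` H)"
      by (rule finite_subset) (use C(2) in simp)
    fix p p' assume pp: "p \<in> H" "p' \<in> H" "(case p of (g, h) \<Rightarrow> (cl g, cl h)) = (case p' of (g, h) \<Rightarrow> (cl g, cl h))"
    obtain g h g' h' where p: "p = (g, h)" "p' = (g', h')" by (cases p, cases p')
    have mem: "g \<in> gl2o" "h \<in> gl2o" "g' \<in> gl2o" "h' \<in> gl2o" using pp p assms(2) by auto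
    have gh: "mnorm (g - g') \<le> vabs a" "mnorm (h' - h) \<le> vabs a"
      using pp p mem by (auto intro!: close simp: gl2o_def)
    let ?i = "matrix_inv g" and ?j = "matrix_inv g'"
    have ij: "?i \<in> gl2o" "?j \<in> gl2o" using mem by (auto intro: gl2o_matrix_inv)
    \<comment> \<open>The resolvent identity: congruent elements of \<open>gl2o\<close> have
      congruent inverses.\<close>
    have "?j ** (g - g') ** ?i = ?j ** g ** ?i - ?j ** g' ** ?i"
      by (simp add: mult_diff_distrib)
    also have "?j ** g ** ?i = ?j ** (g ** ?i)" by (simp only: matrix_mul_assoc)
    finally have eq: "?j ** (g - g') ** ?i = ?j - ?i"
      using mem by (simp add: matrix_inv_laws gl2o_invertible)
    then have ji: "mnorm (?j - ?i) \<le> vabs a"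
      using mnorm_mult_gl2o_le[OF ij(2,1), of "g - g'"] gh(1) by simp
    have main: "act g h F x = act g' h' F x" if "mnorm x = 1" for x
    proof -
      have "?j ** x ** h' - ?i ** x ** h = (mat 1 ** (?j - ?i) ** (x ** h')) + (?i ** x) ** (h' - h) ** mat 1"
        unfolding mult_diff_distrib[symmetric] by (simp add: matrix_mul_assoc)
      also have "mnorm \<dots> \<le> vabs a"
      proof (rule mnorm_add_le)
        have "mnorm (mat 1 ** (?j - ?i) ** (x ** h')) \<le> mnorm (?j - ?i) * mnorm (mat 1 ** x ** h')"
          using mnorm_mult_le[of "?j - ?i" "x ** h'"] by simp
        then show "mnorm (mat 1 ** (?j - ?i) ** (x ** h')) \<le> vabs a"
          using mnorm_mult_gl2o[OF one_in_gl2o mem(4), of x] that ji by simp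
        have "mnorm ((?i ** x) ** (h' - h) ** mat 1) \<le> mnorm (?i ** x ** mat 1) * mnorm (h' - h)"
          using mnorm_mult_le[of "?i ** x" "h' - h"] by simp
        then show "mnorm ((?i ** x) ** (h' - h) ** mat 1) \<le> vabs a"
          using mnorm_mult_gl2o[OF ij(1) one_in_gl2o, of x] that gh by simp
      qed
      finally show ?thesis
        using a mnorm_mult_gl2o[OF ij(1) mem(2), of x] that unfolding has_level_def act_def by metis
    qed
    have lc: "act g h F \<in> lcf" "act g' h' F \<in> lcf"
      using mem by (auto intro!: lcf_act assms(1) gl2o_invertible)
    have "act g h F x = act g' h' F x" for x
    proof (cases "x = 0")
      case False
      then obtain c where "c \<noteq> 0" "mnorm (mat c ** x) = 1" by (rule primitive_multiple)
      then show ?thesis using main lc lcf_scale by metis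
    qed (simp add: lcf_0 lc)
    then show "(case p of (g, h) \<Rightarrow> act g h F) = (case p' of (g, h) \<Rightarrow> act g h F)"
      by (auto simp: p)
  qed
qed

section \<open>Compact open subgroups\<close>

text \<open>Take a polynomial \<open>p\<close> of least degree among the nonzero ones with
  \<open>p(\<phi>) w0 = 0\<close>. A root \<open>c\<close> splits off a factor,
  \<open>p = (X - c) r\<close>, and \<open>r(\<phi>) w0\<close> is nonzero by minimality, hence an
  eigenvector for \<open>c\<close>.\<close>

lemma eigenvector_ex:
  fixes smul :: "complex \<Rightarrow> 'v::ab_group_add \<Rightarrow> 'v"
  assumes vs: "vector_space smul" and lin: "Vector_Spaces.linear smul smul \<phi>"
    and W: "module.subspace smul W" "\<phi> ` W \<subseteq> W" "finite_dim smul W"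
    and w0: "w0 \<in> W" "w0 \<noteq> 0"
  shows "\<exists>c. \<exists>w\<in>W. w \<noteq> 0 \<and> \<phi> w = smul c w"
proof -
  interpret vector_space smul by (rule vs)
  interpret \<phi>: Vector_Spaces.linear smul smul \<phi> by (rule lin)
  \<comment> \<open>\<open>pe p\<close> is \<open>p(\<phi>) w\<^sub>0\<close>, evaluated by the Horner scheme.\<close>
  define pe where "pe p = fold_coeffs (\<lambda>a v. smul a w0 + \<phi> v) p 0" for p
  have pe_0: "pe 0 = 0" by (simp add: pe_def)
  have pe_pCons: "pe (pCons a p) = smul a w0 + \<phi> (pe p)" for a p
    by (cases "a = 0 \<and> p = 0") (auto simp: pe_def \<phi>.zero)
  have pe_add: "pe (p + q) = pe p + pe q" for p q
    by (induction p q rule: poly_induct2) (simp_all add: pe_0 pe_pCons \<phi>.add scale_left_distrib)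
  have pe_smult: "pe (smult c p) = smul c (pe p)" for c p
    by (induction p) (simp_all add: pe_0 pe_pCons \<phi>.scale scale_right_distrib)
  have pe_linear: "pe ([:- c, 1:] * r) = \<phi> (pe r) - smul c (pe r)" for c r
  proof -
    have "[:- c, 1:] * r = smult (- c) r + pCons 0 r" by simp
    then show ?thesis by (simp only: pe_add pe_smult pe_pCons) simp
  qed
  have pe_monom: "pe (monom c i) = smul c ((\<phi> ^^ i) w0)" for c i
    by (induction i) (simp_all add: monom_0 monom_Suc pe_0 pe_pCons \<phi>.scale \<phi>.zero)
  have pe_sum: "pe (sum f I) = (\<Sum>i\<in>I. pe (f i))" for f and I :: "nat set"
    by (induction I rule: infinite_finite_induct) (simp_all add: pe_0 pe_add)
  have pe_W: "pe p \<in> W" for p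
  proof (induction p)
    case 0 then show ?case using W(1) by (simp add: pe_0 subspace_0)
  next
    case (pCons a p)
    then show ?case using W(1,2) w0(1) unfolding pe_pCons
      by (intro subspace_add subspace_scale) auto
  qed
  obtain B where B: "finite B" "W \<subseteq> span B" using W(3) unfolding finite_dim_def by blast
  \<comment> \<open>These are \<open>card B + 1\<close> iterates, one more than the spanning set has
    elements, so they are dependent. A repetition among them is treated apart, since linear
    dependence speaks of sets.\<close>
  let ?u = "\<lambda>i. (\<phi> ^^ i) w0" and ?I = "{..card B}"
  have "?u i \<in> W" for i using W(2) w0(1) by (induction i) auto
  then have uB: "?u ` ?I \<subseteq> span B" using B(2) by blast
  have "\<exists>p. p \<noteq> 0 \<and> pe p = 0"
  proof (cases "inj_on ?u ?I")
    case False
    then obtain i j where ij: "i \<noteq> j" "?u i = ?u j" unfolding inj_on_def by blast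
    have "coeff (monom 1 i + monom (-1) j :: complex poly) i = 1" using ij by simp
    then have "monom 1 i + monom (-1) j \<noteq> (0 :: complex poly)" by (metis coeff_0 zero_neq_one)
    moreover have "pe (monom 1 i + monom (-1) j) = 0" using ij by (simp add: pe_add pe_monom)
    ultimately show ?thesis by blast
  next
    case True
    have "dependent (?u ` ?I)"
    proof (rule ccontr)
      assume "independent (?u ` ?I)"
      then have "card (?u ` ?I) \<le> card B"
        using independent_span_bound[OF B(1)] uB by blast
      then show False using True by (simp add: card_image)
    qed
    then obtain c i where c: "i \<in> ?I" "c (?u i) \<noteq> 0" "(\<Sum>v\<in>?u ` ?I. smul (c v) v) = 0"
      by (subst (asm) dependent_finite) auto
    define p where "p = (\<Sum>j\<in>?I. monom (c (?u j)) j)"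
    have "coeff p i = c (?u i)" using c(1) by (simp add: p_def coeff_sum)
    then have "p \<noteq> 0" using c(2) by auto
    moreover have "pe p = 0"
      using c(3) True by (simp add: p_def pe_sum pe_monom sum.reindex)
    ultimately show ?thesis by blast
  qed
  then obtain p where p: "p \<noteq> 0" "pe p = 0" "\<And>q. q \<noteq> 0 \<Longrightarrow> pe q = 0 \<Longrightarrow> degree p \<le> degree q"
    using ex_has_least_nat[of "\<lambda>p. p \<noteq> 0 \<and> pe p = 0" _ degree] by blast
  have "degree p \<noteq> 0"
  proof
    assume "degree p = 0"
    then obtain a where "p = [:a:]" by (rule degree_eq_zeroE)
    then show False using p(1,2) w0(2) by (simp add: pe_pCons pe_0 \<phi>.zero)
  qed
  then obtain c where "poly p c = 0"
    using fundamental_theorem_of_algebra[of p] by (auto simp: constant_degree)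
  then obtain r where r: "p = [:- c, 1:] * r" by (auto simp: poly_eq_0_iff_dvd dvd_def)
  have "r \<noteq> 0" using r p(1) by auto
  then have "degree p = Suc (degree r)" unfolding r by (subst degree_mult_eq) auto
  then have "pe r \<noteq> 0" using p(3)[OF \<open>r \<noteq> 0\<close>] by auto
  moreover have "\<phi> (pe r) = smul c (pe r)" using p(2) unfolding r pe_linear by simp
  ultimately show ?thesis using pe_W by blast
qed


text \<open>One radius \<open>e\<close> can serve for all elements because elements of
  \<open>gl2o\<close> are isometries. Compactness comes from lying in \<open>gl2o\<close>, as an
  open subgroup is closed.\<close>

locale compact_open_subgroup =
  fixes H :: "('f::nonarch_local_field ^ 2 ^ 2) set" and e :: real
  assumes gl2o: "H \<subseteq> gl2o"
    and one: "mat 1 \<in> H"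
    and mult: "\<And>g h. g \<in> H \<Longrightarrow> h \<in> H \<Longrightarrow> g ** h \<in> H"
    and minv: "\<And>g. g \<in> H \<Longrightarrow> matrix_inv g \<in> H"
    and e: "0 < e" "e \<le> 1"
    and nbhd: "\<And>g y. g \<in> H \<Longrightarrow> mnorm (y - g) < e \<Longrightarrow> y \<in> H"
begin

text \<open>The preimage in GL_2 of the image of \<open>H\<close> in PGL_2. The function
  \<open>ind\<close> below thus stands for the indicator of a compact open subgroup of
  PGL_2.\<close>

definition scaled :: "('f ^ 2 ^ 2) set" where
  "scaled = {mat c ** k | c k. c \<noteq> 0 \<and> k \<in> H}"

definition ind :: "'f ^ 2 ^ 2 \<Rightarrow> complex" where
  "ind x = of_bool (x \<in> scaled)"

lemma scaledI: "c \<noteq> 0 \<Longrightarrow> k \<in> H \<Longrightarrow> mat c ** k \<in> scaled"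
  unfolding scaled_def by blast

lemma subset_scaled: "k \<in> H \<Longrightarrow> k \<in> scaled"
  using scaledI[of 1 k] by simp

lemma invertible_H: "k \<in> H \<Longrightarrow> invertible k"
  using gl2o gl2o_invertible by blast

lemma scaled_invertible: "x \<in> scaled \<Longrightarrow> invertible x"
  unfolding scaled_def using invertible_mult[OF invertible_mat invertible_H] by blast

lemma scaled_mult:
  assumes "x \<in> scaled" "y \<in> scaled"
  shows "x ** y \<in> scaled"
proof -
  obtain c k d l where *: "x = mat c ** k" "y = mat d ** l" "c \<noteq> 0" "d \<noteq> 0" "k \<in> H" "l \<in> H"
    using assms unfolding scaled_def by blast
  have "x ** y = mat (d * c) ** (k ** l)"
    using mat_mult_assoc3[of "mat c ** k" d l "mat 1"]
    by (simp add: * matrix_mul_assoc mat_mult_mat)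
  then show ?thesis using * by (simp add: scaledI mult)
qed

lemma scaled_inv: "x \<in> scaled \<Longrightarrow> matrix_inv x \<in> scaled"
proof -
  assume "x \<in> scaled"
  then obtain c k where "c \<noteq> 0" "k \<in> H" "x = mat c ** k" unfolding scaled_def by blast
  then show ?thesis
    using scaledI[of "inverse c" "matrix_inv k"] by (simp add: matrix_inv_scale invertible_H minv)
qed

lemma scaled_scale: "c \<noteq> 0 \<Longrightarrow> x \<in> scaled \<Longrightarrow> mat c ** x \<in> scaled"
  using scaled_mult[OF scaledI[OF _ one]] by simp

lemma ind_lcf0: "ind \<in> lcf0"
proof (rule lcf0I)
  show "ind \<in> lcf"
    unfolding ind_def[abs_def]
  proof (rule lcf_indicator[OF _ _ e])
    show "0 \<notin> scaled"
      using scaled_invertible[of 0] by (auto simp: invertible_det_nz zero_eq_mat2)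
    fix x y assume x: "x \<in> scaled" and y: "mnorm (y - x) < e * mnorm x"
    obtain c k where ck: "c \<noteq> 0" "k \<in> H" "x = mat c ** k" using x unfolding scaled_def by blast
    have "mnorm (mat 1 :: 'f ^ 2 ^ 2) = 1" by (simp add: mat_eq_mat2 mnorm_mat2)
    then have k: "mnorm k = 1"
      using mnorm_mult_gl2o[of k "mat 1" "mat 1"] gl2o ck(2) by auto
    have "mat (inverse c) ** y - k = mat (inverse c) ** (y - x)"
      using mult_diff_distrib[of "mat (inverse c)" y "mat 1" x] ck
      by (simp add: matrix_mul_assoc mat_mult_mat)
    moreover have "mnorm x = vabs c" using ck k by (simp add: mnorm_mat_mult)
    ultimately have "mnorm (mat (inverse c) ** y - k) < e"
      using y ck(1) by (simp only: mnorm_mat_mult vabs_inverse) (simp add: field_simps)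
    then have "mat (inverse c) ** y \<in> H" by (rule nbhd[OF ck(2)])
    from scaledI[OF ck(1) this] show "y \<in> scaled"
      using ck(1) by (simp add: matrix_mul_assoc mat_mult_mat)
  qed (rule scaled_scale)
  show "ind x = 0" if "det x = 0" for x
    using that scaled_invertible[of x] by (auto simp: ind_def invertible_det_nz)
qed

lemma ind_mult_left: "k \<in> H \<Longrightarrow> ind (k ** x) = ind x"
proof -
  assume k: "k \<in> H"
  have "matrix_inv k ** (k ** x) = x"
    using matrix_inv_laws[OF invertible_H[OF k]] by (simp add: matrix_mul_assoc)
  then have "k ** x \<in> scaled \<longleftrightarrow> x \<in> scaled"
    using scaled_mult[of "matrix_inv k" "k ** x"] scaled_mult[of k x] subset_scaled[OF minv[OF k]]
      subset_scaled[OF k] by auto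
  then show ?thesis by (simp add: ind_def)
qed

text \<open>The primitive matrices with \<open>f x \<noteq> 0\<close> form a compact set of
  invertible matrices, so finitely many cosets \<open>g ** scaled\<close> cover the support, and
  \<open>f\<close> is constant on each.\<close>

lemma right_decomposition:
  assumes f: "f \<in> lcf0" and inv: "\<And>x k. k \<in> H \<Longrightarrow> f (x ** k) = f x"
  obtains R where "finite R" "\<And>g. g \<in> R \<Longrightarrow> invertible g"
    "\<And>x. f x = (\<Sum>g\<in>R. f g * ind (matrix_inv g ** x))"
proof -
  have lcf: "f \<in> lcf" using f by (rule lcf0_lcf)
  have nz: "invertible x" if "f x \<noteq> 0" for x
    using that lcf0_det[OF f, of x] by (auto simp: invertible_det_nz)
  have inv': "f (x ** q) = f x" if q: "q \<in> scaled" for x q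
  proof -
    obtain c k where ck: "c \<noteq> 0" "k \<in> H" "q = mat c ** k" using q unfolding scaled_def by blast
    have "x ** q = mat c ** (x ** k)"
      using mat_mult_assoc3[of x c k "mat 1"] ck(3) by simp
    then show ?thesis using ck lcf_scale[OF lcf] inv by simp
  qed
  have trans: "matrix_inv x ** z \<in> scaled"
    if "matrix_inv x ** y \<in> scaled" "matrix_inv y ** z \<in> scaled" "invertible y" for x y z :: "'f ^ 2 ^ 2"
  proof -
    have "matrix_inv x ** y ** (matrix_inv y ** z) = matrix_inv x ** (y ** matrix_inv y) ** z"
      by (simp only: matrix_mul_assoc)
    then show ?thesis
      using scaled_mult[OF that(1,2)] matrix_inv_laws[OF that(3)] by simp
  qed
  have sym: "matrix_inv y ** x \<in> scaled"
    if "matrix_inv x ** y \<in> scaled" "invertible x" "invertible y" for x y :: "'f ^ 2 ^ 2"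
    using scaled_inv[OF that(1)] that by (simp add: matrix_inv_mult invertible_matrix_inv matrix_inv_inv)
  \<comment> \<open>One representative for each coset, so that the finite cover below becomes
    disjoint and the sum counts every \<open>x\<close> once.\<close>
  define c where "c x = (SOME y. invertible y \<and> matrix_inv x ** y \<in> scaled)" for x :: "'f ^ 2 ^ 2"
  have c: "invertible (c x)" "matrix_inv x ** c x \<in> scaled" if "invertible x" for x
  proof -
    have "\<exists>y. invertible y \<and> matrix_inv x ** y \<in> scaled"
      using that matrix_inv_laws[OF that] subset_scaled[OF one] by (intro exI[of _ x]) simp
    from someI_ex[OF this] show "invertible (c x)" "matrix_inv x ** c x \<in> scaled"
      unfolding c_def by auto
  qed
  have c_eq: "c x = c y" if "matrix_inv x ** y \<in> scaled" "invertible x" "invertible y" for x y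
  proof -
    have "matrix_inv x ** z \<in> scaled \<longleftrightarrow> matrix_inv y ** z \<in> scaled" for z
      using trans[OF that(1) _ that(3), of z] trans[OF sym[OF that] _ that(2), of z] by blast
    then show ?thesis unfolding c_def by simp
  qed
  define D where "D = {x. mnorm x = 1 \<and> f x \<noteq> 0}"
  have "open {x. x \<noteq> 0 \<and> f x = 0}"
    unfolding open_iff_mnorm
  proof safe
    fix x :: "'f ^ 2 ^ 2" assume x: "x \<noteq> 0" "f x = 0"
    obtain d where d: "d > 0" "\<And>y. mnorm (y - x) < d \<Longrightarrow> f y = f x"
      using lcf_loc[OF lcf x(1)] by blast
    have "y \<noteq> 0" "f y = 0" if "mnorm (y - x) < min d (mnorm x)" for y
      using d(2)[of y] x that mnorm_eq_of_close[of y x] by auto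
    moreover have "min d (mnorm x) > 0" using d(1) x(1) by simp
    ultimately show "\<exists>d>0. \<forall>y. mnorm (y - x) < d \<longrightarrow> y \<in> {x. x \<noteq> 0 \<and> f x = 0}" by blast
  qed
  from compact_diff[OF compact_mnorm_eq_1 this]
  have "compact D"
    by (rule back_subst[of compact]) (force simp: D_def)
  moreover have "open {y. matrix_inv g ** y \<in> scaled}" if g: "invertible g" for g :: "'f ^ 2 ^ 2"
    unfolding open_iff_mnorm
  proof safe
    fix x :: "'f ^ 2 ^ 2" assume x: "matrix_inv g ** x \<in> scaled"
    have lc: "act g (mat 1) ind \<in> lcf" by (intro lcf_act lcf0_lcf ind_lcf0 g invertible_mat_1)
    have "act g (mat 1) ind x \<noteq> 0" using x by (simp add: act_def ind_def)
    then have "x \<noteq> 0" using lcf_0[OF lc] by auto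
    then obtain d where d: "d > 0" "\<And>y. mnorm (y - x) < d \<Longrightarrow> act g (mat 1) ind y = act g (mat 1) ind x"
      using lcf_loc[OF lc] by blast
    have "matrix_inv g ** y \<in> scaled" if "mnorm (y - x) < d" for y
      using d(2)[OF that] x by (simp add: act_def ind_def)
    then show "\<exists>d>0. \<forall>y. mnorm (y - x) < d \<longrightarrow> y \<in> {y. matrix_inv g ** y \<in> scaled}"
      using d(1) by blast
  qed
  moreover have "D \<subseteq> (\<Union>g\<in>D. {y. matrix_inv g ** y \<in> scaled})"
    using nz subset_scaled[OF one] by (fastforce simp: D_def matrix_inv_laws)
  ultimately obtain C where C: "C \<subseteq> D" "finite C" "D \<subseteq> (\<Union>g\<in>C. {y. matrix_inv g ** y \<in> scaled})"
    using nz by (elim compactE_image) (auto simp: D_def)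
  show thesis
  proof (rule that[of "c ` C"])
    have Cinv: "invertible g" if "g \<in> C" for g using that C(1) nz by (auto simp: D_def)
    show "invertible g" if "g \<in> c ` C" for g using that c(1) Cinv by auto
    fix x
    have eq: "f g = f x" if "invertible g" "matrix_inv g ** x \<in> scaled" for g :: "'f ^ 2 ^ 2"
    proof -
      have "g ** (matrix_inv g ** x) = x"
        using matrix_inv_laws[OF that(1)] by (simp add: matrix_mul_assoc)
      then show ?thesis using inv'[OF that(2), of g] by simp
    qed
    have "(\<Sum>g\<in>c ` C. f g * ind (matrix_inv g ** x)) = (\<Sum>g\<in>c ` C. f x * ind (matrix_inv g ** x))"
      using eq c(1) Cinv by (intro sum.cong) (auto simp: ind_def)
    also have "\<dots> = f x"
    proof (cases "f x = 0")
      case False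
      have ix: "invertible x" using nz False by blast
      have "x \<noteq> 0" using False lcf_0[OF lcf] by auto
      then obtain t where t: "t \<noteq> 0" "mnorm (mat t ** x) = 1" by (rule primitive_multiple)
      then have "mat t ** x \<in> D" using False lcf_scale[OF lcf t(1)] by (simp add: D_def)
      then obtain g where g: "g \<in> C" "matrix_inv g ** (mat t ** x) \<in> scaled" using C(3) by blast
      have "mat (inverse t) ** (matrix_inv g ** (mat t ** x)) = matrix_inv g ** x"
        using mat_mult_assoc3[of "matrix_inv g" t x "mat 1"] t
        by (simp add: matrix_mul_assoc mat_mult_mat)
      then have gx: "matrix_inv g ** x \<in> scaled"
        using scaled_scale[OF _ g(2), of "inverse t"] t by simp
      have "ind (matrix_inv r ** x) = of_bool (r = c g)" if r: "r \<in> c ` C" for r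
      proof -
        obtain g' where g': "g' \<in> C" "r = c g'" using r by blast
        note i = Cinv[OF g(1)] Cinv[OF g'(1)]
        have "r = c g" if "matrix_inv r ** x \<in> scaled"
        proof -
          have "matrix_inv g' ** x \<in> scaled"
            using trans[OF c(2)[OF i(2)] _ c(1)[OF i(2)]] that g' by blast
          then have "matrix_inv g' ** g \<in> scaled"
            using trans[OF _ sym[OF gx i(1) ix] ix] by blast
          then show ?thesis using c_eq i g' by blast
        qed
        moreover have "matrix_inv (c g) ** x \<in> scaled"
          using trans[OF sym[OF c(2)[OF i(1)] i(1) c(1)[OF i(1)]] gx i(1)] .
        ultimately have "matrix_inv r ** x \<in> scaled \<longleftrightarrow> r = c g" by metis
        then show ?thesis by (simp only: ind_def)
      qed
      then have "(\<Sum>r\<in>c ` C. f x * ind (matrix_inv r ** x)) = (\<Sum>r\<in>c ` C. if r = c g then f x else 0)"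
        by (intro sum.cong) auto
      also have "\<dots> = f x" using C(2) g(1) by simp
      finally show ?thesis .
    qed simp
    finally show "f x = (\<Sum>g\<in>c ` C. f g * ind (matrix_inv g ** x))" by simp
  qed (use C in simp)
qed

end

lemma gl2o_transpose: "g \<in> gl2o \<Longrightarrow> transpose g \<in> gl2o"
  by (simp add: gl2o_def)

lemma compact_open_subgroup_transpose:
  assumes "compact_open_subgroup H e"
  shows "compact_open_subgroup (transpose ` H) e"
proof -
  interpret compact_open_subgroup H e by (rule assms)
  show ?thesis
  proof
    show "transpose ` H \<subseteq> gl2o" using gl2o gl2o_transpose by blast
    show "mat 1 \<in> transpose ` H" using one by (metis image_eqI transpose_mat)
    show "g ** h \<in> transpose ` H" if "g \<in> transpose ` H" "h \<in> transpose ` H" for g h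
      using that mult by (auto simp: image_iff) (metis matrix_transpose_mul)
    show "matrix_inv g \<in> transpose ` H" if "g \<in> transpose ` H" for g
      using that minv by (auto simp: image_iff) (metis transpose_matrix_inv invertible_H)
    show "y \<in> transpose ` H" if "g \<in> transpose ` H" "mnorm (y - g) < e" for g y
    proof -
      have "mnorm (transpose y - transpose g) = mnorm (y - g)"
        using mnorm_transpose[of "y - g"] by (simp add: transpose_def vec_eq_iff mnorm_def)
      moreover have "transpose g \<in> H" using that(1) by auto
      ultimately have "transpose y \<in> H" using nbhd that(2) by simp
      then show ?thesis by (metis image_eqI transpose_transpose)
    qed
  qed (use e in auto)
qed

text \<open>Transposition turns left invariance under \<open>H\<close> into right invariance under
  the transposed subgroup, where \<open>right_decomposition\<close> applies.\<close>

lemma (in compact_open_subgroup) left_decomposition: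
  assumes f: "f \<in> lcf0" and inv: "\<And>x k. k \<in> H \<Longrightarrow> f (k ** x) = f x"
  obtains R where "finite R" "\<And>g. g \<in> R \<Longrightarrow> invertible g"
    "\<And>x. f x = (\<Sum>g\<in>R. f g * ind (x ** matrix_inv g))"
proof -
  interpret t: compact_open_subgroup "transpose ` H" e
    by (rule compact_open_subgroup_transpose) (rule compact_open_subgroup_axioms)
  have scl: "transpose x \<in> t.scaled \<longleftrightarrow> x \<in> scaled" for x
  proof
    assume "transpose x \<in> t.scaled"
    then obtain c k where "c \<noteq> 0" "k \<in> H" "transpose x = mat c ** transpose k"
      unfolding t.scaled_def by blast
    then show "x \<in> scaled"
      by (metis mat_commute matrix_transpose_mul transpose_mat transpose_transpose scaledI)
  next
    assume "x \<in> scaled"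
    then obtain c k where ck: "c \<noteq> 0" "k \<in> H" "x = mat c ** k" unfolding scaled_def by blast
    then have "transpose x = mat c ** transpose k"
      by (metis mat_commute matrix_transpose_mul transpose_mat)
    then show "transpose x \<in> t.scaled" using ck t.scaledI by simp
  qed
  obtain R where R: "finite R" "\<And>g. g \<in> R \<Longrightarrow> invertible g"
      "\<And>x. f (transpose x) = (\<Sum>g\<in>R. f (transpose g) * t.ind (matrix_inv g ** x))"
  proof (rule t.right_decomposition[OF lcf0_transpose[OF f]])
    fix x k assume "k \<in> transpose ` H"
    then show "f (transpose (x ** k)) = f (transpose x)"
      using inv by (auto simp: matrix_transpose_mul)
  qed (rule that)
  show thesis
  proof (rule that[of "transpose ` R"])
    show "finite (transpose ` R)" using R(1) by simp
    show "invertible g" if "g \<in> transpose ` R" for g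
      using that R(2) invertible_transpose2 by blast
    fix x
    have inj: "inj_on transpose R" by (metis inj_on_def transpose_transpose)
    have "t.ind (matrix_inv g ** transpose x) = ind (x ** matrix_inv (transpose g))" if "g \<in> R" for g
      using scl[of "x ** matrix_inv (transpose g)"] R(2)[OF that]
      by (simp add: ind_def t.ind_def matrix_transpose_mul flip: transpose_matrix_inv)
    then show "f x = (\<Sum>g\<in>transpose ` R. f g * ind (x ** matrix_inv g))"
      using R(3)[of "transpose x"] by (simp add: sum.reindex[OF inj])
  qed
qed

lemma compact_open_cong_subgroup:
  assumes "a \<noteq> 0" "vabs a < 1"
  shows "compact_open_subgroup (cong_subgroup a) (vabs a)"
proof
  show "y \<in> cong_subgroup a" if "g \<in> cong_subgroup a" "mnorm (y - g) < vabs a" for g y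
    using that mnorm_add_le[of "y - g" "vabs a" "g - mat 1"] by (simp add: cong_subgroup_def)
qed (use assms cong_subgroup_gl2o cong_subgroup_mult cong_subgroup_matrix_inv in auto)

section \<open>Intertwiners\<close>

text \<open>Common to \<open>lcf\<close> and \<open>lcf0\<close>, so that surjectivity, averaging
  and Schur's lemma are proved once for both.\<close>

definition invariant_space :: "('f::nonarch_local_field ^ 2 ^ 2 \<Rightarrow> complex) set \<Rightarrow> bool" where
  "invariant_space S \<longleftrightarrow> S \<subseteq> lcf \<and> (\<lambda>x. 0) \<in> S \<and>
    (\<forall>F\<in>S. \<forall>G\<in>S. (\<lambda>x. F x + G x) \<in> S) \<and> (\<forall>c. \<forall>F\<in>S. (\<lambda>x. c * F x) \<in> S) \<and>
    (\<forall>g h. invertible g \<longrightarrow> invertible h \<longrightarrow> (\<forall>F\<in>S. act g h F \<in> S))"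

lemma
  assumes "invariant_space S"
  shows invariant_space_lcf: "F \<in> S \<Longrightarrow> F \<in> lcf"
    and invariant_space_0: "(\<lambda>x. 0) \<in> S"
    and invariant_space_add: "F \<in> S \<Longrightarrow> G \<in> S \<Longrightarrow> (\<lambda>x. F x + G x) \<in> S"
    and invariant_space_cmult: "F \<in> S \<Longrightarrow> (\<lambda>x. c * F x) \<in> S"
    and invariant_space_act: "F \<in> S \<Longrightarrow> invertible g \<Longrightarrow> invertible h \<Longrightarrow> act g h F \<in> S"
  using assms unfolding invariant_space_def by blast+

lemma invariant_space_sum:
  assumes "invariant_space S" "\<And>i. i \<in> I \<Longrightarrow> F i \<in> S"
  shows "(\<lambda>x. \<Sum>i\<in>I. c i * F i x) \<in> S"
  using assms(2)
proof (induction I rule: infinite_finite_induct)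
  case (insert i I)
  then show ?case
    using invariant_space_add[OF assms(1) invariant_space_cmult[OF assms(1), of "F i" "c i"], of "\<lambda>x. \<Sum>i\<in>I. c i * F i x"]
    by simp
qed (simp_all add: invariant_space_0[OF assms(1)])

lemma invariant_space_lcf_self: "invariant_space lcf"
  by (simp add: invariant_space_def zero_in_lcf lcf_add lcf_cmult lcf_act)

lemma zero_in_lcf0: "(\<lambda>x. 0) \<in> lcf0"
  by (rule lcf0I[OF zero_in_lcf]) simp

lemma invariant_space_lcf0: "invariant_space lcf0"
  by (simp add: invariant_space_def zero_in_lcf0 lcf0_add lcf0_cmult lcf0_act subset_iff lcf0_lcf)

text \<open>Every subgroup of \<open>gl2o\<close> has finite orbits on \<open>lcf\<close>, which is
  what averaging uses. The group \<open>{mat 1}\<close> qualifies, so one can average in one factor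
  only.\<close>

definition compact_subgroup :: "('f::nonarch_local_field ^ 2 ^ 2) set \<Rightarrow> bool" where
  "compact_subgroup A \<longleftrightarrow> A \<subseteq> gl2o \<and> mat 1 \<in> A \<and> (\<forall>g\<in>A. \<forall>h\<in>A. g ** h \<in> A) \<and> (\<forall>g\<in>A. matrix_inv g \<in> A)"

text \<open>An irreducible admissible representation of PGL_2 x PGL_2, pulled back to pairs of
  invertible matrices so that no cosets have to be handled; admissibility enters through the
  principal congruence subgroups.\<close>

locale gl2_rep = vector_space smul
  for smul :: "complex \<Rightarrow> 'v::ab_group_add \<Rightarrow> 'v" +
  fixes \<rho> :: "'f::nonarch_local_field ^ 2 ^ 2 \<Rightarrow> 'f ^ 2 ^ 2 \<Rightarrow> 'v \<Rightarrow> 'v"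
  assumes linear_rho: "invertible g \<Longrightarrow> invertible h \<Longrightarrow> Vector_Spaces.linear smul smul (\<rho> g h)"
    and rho_one: "\<rho> (mat 1) (mat 1) v = v"
    and rho_mult: "invertible g \<Longrightarrow> invertible h \<Longrightarrow> invertible g' \<Longrightarrow> invertible h' \<Longrightarrow>
      \<rho> (g ** g') (h ** h') v = \<rho> g h (\<rho> g' h' v)"
    and irreducible: "subspace W \<Longrightarrow>
      (\<And>g h w. invertible g \<Longrightarrow> invertible h \<Longrightarrow> w \<in> W \<Longrightarrow> \<rho> g h w \<in> W) \<Longrightarrow> W = {0} \<or> W = UNIV"
    and admissible: "a \<noteq> 0 \<Longrightarrow> vabs a < 1 \<Longrightarrow>
      finite_dim smul {v. \<forall>g\<in>cong_subgroup a. \<forall>h\<in>cong_subgroup a. \<rho> g h v = v}"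
begin

lemma
  assumes "invertible g" "invertible h"
  shows rho_add: "\<rho> g h (v + w) = \<rho> g h v + \<rho> g h w"
    and rho_smul: "\<rho> g h (smul c v) = smul c (\<rho> g h v)"
    and rho_0: "\<rho> g h 0 = 0"
    and rho_diff: "\<rho> g h (v - w) = \<rho> g h v - \<rho> g h w"
proof -
  interpret r: Vector_Spaces.linear smul smul "\<rho> g h" by (rule linear_rho[OF assms])
  show "\<rho> g h (v + w) = \<rho> g h v + \<rho> g h w" "\<rho> g h (smul c v) = smul c (\<rho> g h v)"
    "\<rho> g h 0 = 0" "\<rho> g h (v - w) = \<rho> g h v - \<rho> g h w"
    by (simp_all add: r.add r.scale r.zero r.diff)
qed

text \<open>Values outside \<open>lcf\<close> are left free, so intertwiners are only ever compared
  on \<open>lcf\<close>.\<close>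

definition intertwiner :: "(('f ^ 2 ^ 2 \<Rightarrow> complex) \<Rightarrow> 'v) \<Rightarrow> bool" where
  "intertwiner T \<longleftrightarrow> (\<forall>F\<in>lcf. \<forall>G\<in>lcf. T (\<lambda>x. F x + G x) = T F + T G) \<and>
    (\<forall>c. \<forall>F\<in>lcf. T (\<lambda>x. c * F x) = smul c (T F)) \<and>
    (\<forall>g h. invertible g \<longrightarrow> invertible h \<longrightarrow> (\<forall>F\<in>lcf. T (act g h F) = \<rho> g h (T F)))"

lemma
  assumes "intertwiner T"
  shows intertwiner_add: "F \<in> lcf \<Longrightarrow> G \<in> lcf \<Longrightarrow> T (\<lambda>x. F x + G x) = T F + T G"
    and intertwiner_cmult: "F \<in> lcf \<Longrightarrow> T (\<lambda>x. c * F x) = smul c (T F)"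
    and intertwiner_act: "F \<in> lcf \<Longrightarrow> invertible g \<Longrightarrow> invertible h \<Longrightarrow> T (act g h F) = \<rho> g h (T F)"
  using assms unfolding intertwiner_def by blast+

lemma intertwiner_0: "intertwiner T \<Longrightarrow> T (\<lambda>x. 0) = 0"
  using intertwiner_cmult[of T "\<lambda>x. 0" 0] zero_in_lcf by simp

lemma intertwiner_diff:
  assumes "intertwiner T" "F \<in> lcf" "G \<in> lcf"
  shows "T (\<lambda>x. F x - G x) = T F - T G"
  using intertwiner_add[OF assms(1,2) lcf_cmult[OF assms(3), of "-1"]]
    intertwiner_cmult[OF assms(1,3), of "-1"] by simp

lemma intertwiner_sum:
  assumes "intertwiner T" "\<And>i. i \<in> I \<Longrightarrow> F i \<in> lcf"
  shows "T (\<lambda>x. \<Sum>i\<in>I. c i * F i x) = (\<Sum>i\<in>I. smul (c i) (T (F i)))"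
  using assms(2)
proof (induction I rule: infinite_finite_induct)
  case (insert i I)
  then have "F i \<in> lcf" "(\<lambda>x. \<Sum>i\<in>I. c i * F i x) \<in> lcf"
    using invariant_space_sum[OF invariant_space_lcf_self, of I F c] by auto
  then show ?case
    using insert intertwiner_add[OF assms(1) lcf_cmult, of "F i" _ "c i"]
      intertwiner_cmult[OF assms(1)] by simp
qed (simp_all add: intertwiner_0[OF assms(1)])

lemma intertwiner_lincomb:
  assumes "intertwiner T" "intertwiner T'"
  shows "intertwiner (\<lambda>F. T' F - smul c (T F))"
  unfolding intertwiner_def
proof (intro conjI ballI allI impI)
  fix F G :: "'f ^ 2 ^ 2 \<Rightarrow> complex" and d g h assume F: "F \<in> lcf"
  show "T' (\<lambda>x. d * F x) - smul c (T (\<lambda>x. d * F x)) = smul d (T' F - smul c (T F))"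
    by (simp add: intertwiner_cmult[OF assms(1) F] intertwiner_cmult[OF assms(2) F]
        scale_right_diff_distrib mult.commute)
  show "T' (\<lambda>x. F x + G x) - smul c (T (\<lambda>x. F x + G x)) = T' F - smul c (T F) + (T' G - smul c (T G))"
    if "G \<in> lcf"
    by (simp add: intertwiner_add[OF assms(1) F that] intertwiner_add[OF assms(2) F that]
        scale_right_distrib)
  show "T' (act g h F) - smul c (T (act g h F)) = \<rho> g h (T' F - smul c (T F))"
    if gh: "invertible g" "invertible h"
    by (simp add: intertwiner_act[OF assms(1) F gh] intertwiner_act[OF assms(2) F gh]
        rho_diff[OF gh] rho_smul[OF gh])
qed

text \<open>The image of \<open>S\<close> is an invariant subspace, hence everything by
  irreducibility.\<close>

lemma intertwiner_surj:
  assumes T: "intertwiner T" and S: "invariant_space S" and nz: "F0 \<in> S" "T F0 \<noteq> 0"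
  obtains F where "F \<in> S" "T F = v"
proof -
  note lcf = invariant_space_lcf[OF S]
  have "subspace (T ` S)"
  proof (rule subspaceI)
    show "0 \<in> T ` S" using intertwiner_0[OF T] invariant_space_0[OF S] by (metis imageI)
    show "x + y \<in> T ` S" if xy: "x \<in> T ` S" "y \<in> T ` S" for x y
    proof -
      obtain F G where "F \<in> S" "G \<in> S" "x = T F" "y = T G" using xy by blast
      then show ?thesis
        using intertwiner_add[OF T lcf lcf, of F G] invariant_space_add[OF S, of F G] by (metis imageI)
    qed
    show "smul c x \<in> T ` S" if x: "x \<in> T ` S" for c x
    proof -
      obtain F where "F \<in> S" "x = T F" using x by blast
      then show ?thesis
        using intertwiner_cmult[OF T lcf, of F c] invariant_space_cmult[OF S, of F c] by (metis imageI)
    qed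
  qed
  moreover have "\<rho> g h w \<in> T ` S" if w: "w \<in> T ` S" and gh: "invertible g" "invertible h" for g h w
  proof -
    obtain F where "F \<in> S" "w = T F" using w by blast
    then show ?thesis
      using intertwiner_act[OF T lcf, of F g h] invariant_space_act[OF S, of F g h] gh by (metis imageI)
  qed
  ultimately have "T ` S = {0} \<or> T ` S = UNIV" by (intro irreducible)
  then have "v \<in> T ` S" using nz by auto
  then show thesis using that by blast
qed

text \<open>Lifts vectors fixed by a compact group to fixed functions; this is the exactness of
  taking invariants.\<close>

lemma intertwiner_average:
  assumes T: "intertwiner T" and S: "invariant_space S" and F: "F \<in> S"
    and A: "compact_subgroup A" and B: "compact_subgroup B"
    and inv: "\<And>g h. g \<in> A \<Longrightarrow> h \<in> B \<Longrightarrow> \<rho> g h (T F) = T F"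
  obtains F' where "F' \<in> S" "T F' = T F" "\<And>g h. g \<in> A \<Longrightarrow> h \<in> B \<Longrightarrow> act g h F' = F'"
proof -
  \<comment> \<open>No Haar measure is needed: \<open>F\<close> has a finite orbit under a compact group.\<close>
  define \<Omega> where "\<Omega> = (\<lambda>(g, h). act g h F) ` (A \<times> B)"
  have AB: "A \<subseteq> gl2o" "B \<subseteq> gl2o" "mat 1 \<in> A" "mat 1 \<in> B"
    "\<And>g h. g \<in> A \<Longrightarrow> h \<in> A \<Longrightarrow> g ** h \<in> A" "\<And>g h. g \<in> B \<Longrightarrow> h \<in> B \<Longrightarrow> g ** h \<in> B"
    "\<And>g. g \<in> A \<Longrightarrow> matrix_inv g \<in> A" "\<And>g. g \<in> B \<Longrightarrow> matrix_inv g \<in> B"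
    using A B unfolding compact_subgroup_def by blast+
  have invt: "g \<in> A \<Longrightarrow> invertible g" "g \<in> B \<Longrightarrow> invertible g" for g
    using AB(1,2) gl2o_invertible by blast+
  have fin: "finite \<Omega>"
    unfolding \<Omega>_def by (rule finite_orbit[OF invariant_space_lcf[OF S F]]) (use AB in blast)
  have "act (mat 1) (mat 1) F \<in> \<Omega>" unfolding \<Omega>_def using AB(3,4) by (intro image_eqI[of _ _ "(mat 1, mat 1)"]) simp_all
  then have n: "card \<Omega> \<noteq> 0" using fin by auto
  have mem: "G \<in> S" "T G = T F" if G: "G \<in> \<Omega>" for G
  proof -
    obtain g h where gh: "g \<in> A" "h \<in> B" "G = act g h F" using G unfolding \<Omega>_def by auto
    then show "G \<in> S" "T G = T F"
      using invariant_space_act[OF S F, of g h] intertwiner_act[OF T invariant_space_lcf[OF S F], of g h]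
        inv invt by auto
  qed
  define F' where "F' = (\<lambda>x. \<Sum>G\<in>\<Omega>. (1 / of_nat (card \<Omega>)) * G x)"
  show thesis
  proof (rule that[of F'])
    show "F' \<in> S" unfolding F'_def by (rule invariant_space_sum[OF S mem(1)])
    have "T F' = (\<Sum>G\<in>\<Omega>. smul (1 / of_nat (card \<Omega>)) (T G))"
      unfolding F'_def by (rule intertwiner_sum[OF T invariant_space_lcf[OF S mem(1)]])
    also have "\<dots> = (\<Sum>G\<in>\<Omega>. smul (1 / of_nat (card \<Omega>)) (T F))"
      by (rule sum.cong) (simp_all add: mem)
    also have "\<dots> = smul (\<Sum>G\<in>\<Omega>. 1 / of_nat (card \<Omega>)) (T F)"
      by (rule scale_sum_left[symmetric])
    also have "(\<Sum>G\<in>\<Omega>. 1 / of_nat (card \<Omega>)) = (1 :: complex)" using n by simp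
    finally show "T F' = T F" by simp
    fix g h assume gh: "g \<in> A" "h \<in> B"
    note i = invt(1)[OF gh(1)] invt(2)[OF gh(2)]
    have "act g h G \<in> \<Omega>" if G: "G \<in> \<Omega>" for G
    proof -
      obtain g' h' where gh': "g' \<in> A" "h' \<in> B" "G = act g' h' F" using G unfolding \<Omega>_def by auto
      then have "act g h G = act (g ** g') (h ** h') F" using act_act[of g g' h h' F] i invt by simp
      then show ?thesis using gh gh' AB(5,6) unfolding \<Omega>_def by (auto intro!: image_eqI[of _ _ "(g ** g', h ** h')"])
    qed
    moreover have "inj_on (act g h) \<Omega>"
    proof (rule inj_on_inverseI)
      fix G
      show "act (matrix_inv g) (matrix_inv h) (act g h G) = G"
        using act_act[of "matrix_inv g" g "matrix_inv h" h G] i matrix_inv_laws[of g] matrix_inv_laws[of h]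
        by (simp add: invertible_matrix_inv)
    qed
    ultimately have "bij_betw (act g h) \<Omega> \<Omega>"
      using fin by (simp add: bij_betw_def endo_inj_surj image_subset_iff)
    then have "F' x = (\<Sum>G\<in>\<Omega>. (1 / of_nat (card \<Omega>)) * act g h G x)" for x
      unfolding F'_def by (rule sum.reindex_bij_betw[symmetric])
    then show "act g h F' = F'" unfolding act_def F'_def by (intro ext) metis
  qed
qed

text \<open>The inclusion of kernels lets \<open>T'\<close> factor as \<open>\<phi>\<close> after
  \<open>T\<close>, with \<open>\<phi>\<close> an endomorphism of the representation. Admissibility
  gives \<open>\<phi>\<close> an eigenvector, and its eigenspace is invariant, hence
  everything.\<close>

lemma schur:
  assumes T: "intertwiner T" and T': "intertwiner T'" and S: "invariant_space S"
    and F0: "F0 \<in> S" "T F0 \<noteq> 0" and ker: "\<And>F. F \<in> S \<Longrightarrow> T F = 0 \<Longrightarrow> T' F = 0"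
  obtains c where "\<And>F. F \<in> S \<Longrightarrow> T' F = smul c (T F)"
proof -
  note lcf = invariant_space_lcf[OF S]
  have surj: "\<exists>F. F \<in> S \<and> T F = v" for v
    by (rule intertwiner_surj[OF T S F0, of v]) blast
  define \<phi> where "\<phi> v = T' (SOME F. F \<in> S \<and> T F = v)" for v
  have phi: "\<phi> (T F) = T' F" if F: "F \<in> S" for F
  proof -
    define G where "G = (SOME G. G \<in> S \<and> T G = T F)"
    have G: "G \<in> S" "T G = T F" using someI_ex[OF surj[of "T F"], folded G_def] by auto
    have d: "(\<lambda>x. G x - F x) \<in> S"
      using invariant_space_add[OF S G(1) invariant_space_cmult[OF S F, of "-1"]] by simp
    have "T (\<lambda>x. G x - F x) = 0" using intertwiner_diff[OF T lcf lcf, OF G(1) F] G(2) by simp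
    then have "T' (\<lambda>x. G x - F x) = 0" by (rule ker[OF d])
    then have "T' G = T' F" using intertwiner_diff[OF T' lcf lcf, OF G(1) F] by simp
    then show ?thesis by (simp add: \<phi>_def G_def)
  qed
  have add: "\<phi> (v + w) = \<phi> v + \<phi> w" for v w
  proof -
    obtain F G where FG: "F \<in> S" "T F = v" "G \<in> S" "T G = w" using surj by metis
    then show ?thesis
      using phi[OF invariant_space_add[OF S FG(1,3)]] phi[OF FG(1)] phi[OF FG(3)]
        intertwiner_add[OF T lcf lcf] intertwiner_add[OF T' lcf lcf] by simp
  qed
  have scale: "\<phi> (smul c v) = smul c (\<phi> v)" for c v
  proof -
    obtain F where F: "F \<in> S" "T F = v" using surj by metis
    then show ?thesis
      using phi[OF invariant_space_cmult[OF S F(1)]] phi[OF F(1)]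
        intertwiner_cmult[OF T lcf] intertwiner_cmult[OF T' lcf] by simp
  qed
  have comm: "\<phi> (\<rho> g h v) = \<rho> g h (\<phi> v)" if gh: "invertible g" "invertible h" for g h v
  proof -
    obtain F where F: "F \<in> S" "T F = v" using surj by metis
    then show ?thesis
      using phi[OF invariant_space_act[OF S F(1) gh]] phi[OF F(1)]
        intertwiner_act[OF T lcf[OF F(1)] gh] intertwiner_act[OF T' lcf[OF F(1)] gh] by simp
  qed
  \<comment> \<open>A level of \<open>F0\<close> provides a congruence subgroup whose fixed space
    \<open>W\<close> is finite-dimensional and contains the nonzero vector
    \<open>T F0\<close>.\<close>
  obtain a where a: "has_level a F0" using level_ex[OF lcf[OF F0(1)]] by blast
  then have a': "a \<noteq> 0" "vabs a < 1" by (simp_all add: has_level_def)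
  have inv: "invertible g" if "g \<in> cong_subgroup a" for g
    using cong_subgroup_gl2o[OF a'(2) that] by (rule gl2o_invertible)
  define W where "W = {v. \<forall>g\<in>cong_subgroup a. \<forall>h\<in>cong_subgroup a. \<rho> g h v = v}"
  have "act g h F0 = F0" if "g \<in> cong_subgroup a" "h \<in> cong_subgroup a" for g h
    using level_invariant[OF a lcf[OF F0(1)]] that cong_subgroup_matrix_inv[OF a'(2)]
    by (simp add: act_def)
  then have TW: "T F0 \<in> W"
    using intertwiner_act[OF T lcf[OF F0(1)]] inv by (simp add: W_def) metis
  have subW: "subspace W"
    unfolding W_def by (rule subspaceI) (auto simp: rho_0 rho_add rho_smul inv)
  have phiW: "\<phi> ` W \<subseteq> W"
    by (auto simp: W_def inv simp flip: comm)
  have lin: "Vector_Spaces.linear smul smul \<phi>"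
    by unfold_locales (simp_all add: add scale)
  have finW: "finite_dim smul W" unfolding W_def by (rule admissible[OF a'])
  obtain c w where c: "w \<noteq> 0" "\<phi> w = smul c w"
    using eigenvector_ex[OF vector_space_axioms lin subW phiW finW TW F0(2)] by blast
  have "{v. \<phi> v = smul c v} = {0} \<or> {v. \<phi> v = smul c v} = UNIV"
  proof (rule irreducible)
    show "subspace {v. \<phi> v = smul c v}"
      by (rule subspaceI) (use scale[of 0 0] in \<open>auto simp: add scale scale_right_distrib mult.commute\<close>)
  qed (simp add: comm rho_smul)
  then have "\<phi> v = smul c v" for v using c by blast
  then show thesis using that[of c] phi by metis
qed

text \<open>The convolution of \<open>f\<close> and \<open>h\<^sub>0\<close> is a sum of left translates of \<open>h\<^sub>0\<close> and also a sum of right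
  translates of \<open>f\<close>; \<open>T\<close> maps the former to \<open>T' f\<close> and the latter to \<open>0\<close>.\<close>

lemma kernel_le_lcf0:
  assumes T: "intertwiner T" and T': "intertwiner T'"
    and F0: "F0 \<in> lcf0" "T F0 \<noteq> 0" and f: "f \<in> lcf0" "T f = 0"
  shows "T' f = 0"
proof -
  obtain a where a: "has_level a f" using level_ex[OF lcf0_lcf[OF f(1)]] by blast
  then have a': "a \<noteq> 0" "vabs a < 1" by (simp_all add: has_level_def)
  interpret K: compact_open_subgroup "cong_subgroup a" "vabs a"
    by (rule compact_open_cong_subgroup[OF a'])
  have cs: "compact_subgroup (cong_subgroup a)" "compact_subgroup {mat 1 :: 'f ^ 2 ^ 2}"
    using K.gl2o K.one K.mult K.minv by (auto simp: compact_subgroup_def)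
  have indK: "K.ind \<in> lcf" by (rule lcf0_lcf[OF K.ind_lcf0])
  \<comment> \<open>\<open>T\<close> is onto already on \<open>lcf0\<close>, so the vector
    \<open>T' K.ind\<close> has a preimage under \<open>T\<close> there. The vector is fixed by the
    congruence subgroup acting from the left, hence the preimage can be made left invariant.\<close>
  obtain h1 where h1: "h1 \<in> lcf0" "T h1 = T' K.ind"
    by (rule intertwiner_surj[OF T invariant_space_lcf0 F0])
  have "\<rho> g h (T h1) = T h1" if "g \<in> cong_subgroup a" "h \<in> {mat 1}" for g h
  proof -
    have "act g h K.ind = K.ind"
      using that K.ind_mult_left[OF K.minv] by (auto simp: act_def)
    then show ?thesis
      using intertwiner_act[OF T' indK, of g h] that K.invertible_H by (auto simp: h1)
  qed
  then obtain h0 where h0: "h0 \<in> lcf0" "T h0 = T h1"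
      "\<And>g h. g \<in> cong_subgroup a \<Longrightarrow> h \<in> {mat 1} \<Longrightarrow> act g h h0 = h0"
    using intertwiner_average[OF T invariant_space_lcf0 h1(1) cs] by metis
  have h0_inv: "h0 (k ** x) = h0 x" if k: "k \<in> cong_subgroup a" for k x
  proof -
    have "act (matrix_inv k) (mat 1) h0 x = h0 x" using h0(3)[OF K.minv[OF k]] by simp
    then show ?thesis using K.invertible_H[OF k] by (simp add: act_def matrix_inv_inv)
  qed
  obtain R' where R': "finite R'" "\<And>g. g \<in> R' \<Longrightarrow> invertible g"
      "\<And>x. h0 x = (\<Sum>r\<in>R'. h0 r * K.ind (x ** matrix_inv r))"
    by (rule K.left_decomposition[OF h0(1) h0_inv]) (assumption, rule that)
  obtain R where R: "finite R" "\<And>g. g \<in> R \<Longrightarrow> invertible g"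
      "\<And>x. f x = (\<Sum>g\<in>R. f g * K.ind (matrix_inv g ** x))"
    by (rule K.right_decomposition[OF f(1) level_invariant(2)[OF a lcf0_lcf[OF f(1)]]]) (assumption, rule that)
  have actg: "act g (mat 1) F \<in> lcf" if "g \<in> R" "F \<in> lcf" for g F
    using that R(2) by (intro lcf_act) auto
  have actr: "act (mat 1) (matrix_inv r) f \<in> lcf" if "r \<in> R'" for r
    using that R'(2) by (intro lcf_act lcf0_lcf f(1) invertible_matrix_inv) auto
  have "f = (\<lambda>x. \<Sum>g\<in>R. f g * act g (mat 1) K.ind x)"
    by (rule ext, subst R(3)) (simp add: act_def)
  then have "T' f = (\<Sum>g\<in>R. smul (f g) (T' (act g (mat 1) K.ind)))"
    using intertwiner_sum[OF T' actg[OF _ indK], of R "\<lambda>g. g" f] by simp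
  also have "\<dots> = (\<Sum>g\<in>R. smul (f g) (T (act g (mat 1) h0)))"
    using R(2) by (intro sum.cong refl arg_cong2[of _ _ _ _ smul])
      (simp add: intertwiner_act[OF T' indK] intertwiner_act[OF T lcf0_lcf[OF h0(1)]] h0(2) h1(2))
  also have "\<dots> = T (\<lambda>x. \<Sum>g\<in>R. f g * act g (mat 1) h0 x)"
    by (rule intertwiner_sum[OF T actg[OF _ lcf0_lcf[OF h0(1)]], symmetric])
  also have "(\<lambda>x. \<Sum>g\<in>R. f g * act g (mat 1) h0 x) =
      (\<lambda>x. \<Sum>r\<in>R'. h0 r * act (mat 1) (matrix_inv r) f x)"
  proof
    fix x
    have "(\<Sum>g\<in>R. f g * act g (mat 1) h0 x) =
        (\<Sum>g\<in>R. \<Sum>r\<in>R'. f g * (h0 r * K.ind (matrix_inv g ** x ** matrix_inv r)))"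
      by (simp add: act_def R'(3)[of "matrix_inv _ ** x"] sum_distrib_left)
    also have "\<dots> = (\<Sum>r\<in>R'. \<Sum>g\<in>R. f g * (h0 r * K.ind (matrix_inv g ** x ** matrix_inv r)))"
      by (rule sum.swap)
    also have "\<dots> = (\<Sum>r\<in>R'. h0 r * act (mat 1) (matrix_inv r) f x)"
      by (simp add: act_def R(3)[of "x ** matrix_inv _"] sum_distrib_left matrix_mul_assoc mult.left_commute)
    finally show "(\<Sum>g\<in>R. f g * act g (mat 1) h0 x) = (\<Sum>r\<in>R'. h0 r * act (mat 1) (matrix_inv r) f x)" .
  qed
  also have "T \<dots> = (\<Sum>r\<in>R'. smul (h0 r) (T (act (mat 1) (matrix_inv r) f)))"
    by (rule intertwiner_sum[OF T actr])
  also have "\<dots> = 0"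
    using R'(2) by (intro sum.neutral ballI)
      (simp add: intertwiner_act[OF T lcf0_lcf[OF f(1)]] invertible_matrix_inv f(2) rho_0)
  finally show ?thesis .
qed

lemma multiplicity_one_lcf0:
  assumes T: "intertwiner T" and T': "intertwiner T'" and F0: "F0 \<in> lcf0" "T F0 \<noteq> 0"
  obtains c where "\<And>F. F \<in> lcf0 \<Longrightarrow> T' F = smul c (T F)"
  using schur[OF T T' invariant_space_lcf0 F0 kernel_le_lcf0[OF T T' F0]] by blast

end

section \<open>Neighbourhoods of the boundary\<close>

lemma vabs_det_diff_le:
  assumes "mnorm x \<le> m" "mnorm y \<le> m" "mnorm (y - x) \<le> d"
  shows "vabs (det y - det x) \<le> m * d"
proof -
  have nn: "0 \<le> m" "0 \<le> d" using assms mnorm_nonneg order_trans by blast+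
  have e: "vabs (x $ i $ j) \<le> m" "vabs (y $ i $ j) \<le> m" "vabs (y $ i $ j - x $ i $ j) \<le> d" for i j
    using assms by (auto simp: mnorm_le_iff)
  have "det y - det x = (y $ 1 $ 1 * (y $ 2 $ 2 - x $ 2 $ 2) + x $ 2 $ 2 * (y $ 1 $ 1 - x $ 1 $ 1))
      - (y $ 1 $ 2 * (y $ 2 $ 1 - x $ 2 $ 1) + x $ 2 $ 1 * (y $ 1 $ 2 - x $ 1 $ 2))"
    by (simp add: det_2 algebra_simps)
  also have "vabs \<dots> \<le> m * d"
    by (intro vabs_diff_le vabs_add_le) (simp_all only: vabs_mult mult_mono e nn vabs_nonneg)
  finally show ?thesis .
qed

text \<open>The rank one matrices in \<open>corner a\<close> form a product of two discs in the projective line that does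
  not depend on \<open>a\<close>.\<close>

definition corner :: "'f::nonarch_local_field \<Rightarrow> ('f ^ 2 ^ 2) set" where
  "corner a = {x. x $ 1 $ 1 \<noteq> 0 \<and> vabs (x $ 1 $ 2) < vabs (x $ 1 $ 1) \<and>
    vabs (x $ 2 $ 1) < vabs (x $ 1 $ 1) \<and> vabs (det x) \<le> vabs a * (vabs (x $ 1 $ 1))\<^sup>2}"

definition ind_corner :: "'f::nonarch_local_field \<Rightarrow> 'f ^ 2 ^ 2 \<Rightarrow> complex" where
  "ind_corner a x = of_bool (x \<in> corner a)"

lemma mat2_in_corner: "mat2 p q r s \<in> corner a \<longleftrightarrow>
    p \<noteq> 0 \<and> vabs q < vabs p \<and> vabs r < vabs p \<and> vabs (p * s - q * r) \<le> vabs a * (vabs p)\<^sup>2"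
  by (simp add: corner_def)

text \<open>In \<open>p * s = (p * s - q * r) + q * r\<close> both terms are smaller than the square
  of \<open>vabs p\<close>. Hence in a corner the entry \<open>s\<close> is small automatically and
  the first entry realises the norm.\<close>

lemma vabs_le_of_det:
  assumes "p \<noteq> 0" "vabs q \<le> vabs p" "vabs r < vabs p" "vabs (p * s - q * r) < (vabs p)\<^sup>2"
  shows "vabs s < vabs (p :: 'f::nonarch_local_field)"
proof -
  have "vabs (q * r) \<le> vabs p * vabs r" using assms by (simp add: vabs_mult mult_right_mono)
  also have "\<dots> < (vabs p)\<^sup>2" using assms by (simp add: power2_eq_square)
  finally have "vabs ((p * s - q * r) + q * r) < (vabs p)\<^sup>2" using assms(4) by (intro vabs_add_less)
  then show ?thesis using assms(1) by (simp add: vabs_mult power2_eq_square)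
qed

lemma corner_vabs:
  assumes "vabs a < 1" "mat2 p q r s \<in> corner a"
  shows "vabs s < vabs p" "mnorm (mat2 p q r s) = vabs p"
proof -
  have *: "p \<noteq> 0" "vabs q < vabs p" "vabs r < vabs p" "vabs (p * s - q * r) \<le> vabs a * (vabs p)\<^sup>2"
    using assms(2) by (auto simp: mat2_in_corner)
  have "vabs a * (vabs p)\<^sup>2 < (vabs p)\<^sup>2" using assms(1) *(1) by simp
  with *(4) have "vabs (p * s - q * r) < (vabs p)\<^sup>2" by (rule le_less_trans)
  then show "vabs s < vabs p" by (rule vabs_le_of_det[OF *(1) less_imp_le[OF *(2)] *(3)])
  then show "mnorm (mat2 p q r s) = vabs p" using * by (simp add: mnorm_mat2)
qed

lemma ind_corner_lcf:
  assumes a: "a \<noteq> 0" "vabs a < 1"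
  shows "ind_corner a \<in> lcf"
  unfolding ind_corner_def[abs_def]
\<comment> \<open>A change of \<open>x\<close> by less than \<open>vabs a * mnorm x\<close> moves
  the determinant by at most \<open>vabs a * (mnorm x)\<^sup>2\<close>, exactly the tolerance in
  \<open>corner\<close>.\<close>
proof (rule lcf_indicator[where e = "vabs a"])
  show "0 \<notin> corner a" by (simp add: corner_def)
  fix c :: 'a and x :: "'a ^ 2 ^ 2" assume c: "c \<noteq> 0" and x: "x \<in> corner a"
  have "vabs (det (mat c ** x)) = (vabs c)\<^sup>2 * vabs (det x)"
    by (simp add: det_mul mat_eq_mat2 vabs_mult power2_eq_square)
  then show "mat c ** x \<in> corner a"
    using c x by (simp add: corner_def mat_mult_nth vabs_mult power_mult_distrib mult.left_commute)
next
  fix x y assume x: "x \<in> corner a" and y: "mnorm (y - x) < vabs a * mnorm x" "mnorm y = mnorm x"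
  have m: "mnorm x = vabs (x $ 1 $ 1)"
    using corner_vabs(2)[OF a(2), of "x $ 1 $ 1" "x $ 1 $ 2" "x $ 2 $ 1" "x $ 2 $ 2"] x by simp
  have nz: "x $ 1 $ 1 \<noteq> 0" using x by (simp add: corner_def)
  have "vabs a * mnorm x \<le> mnorm x" using a(2) by (simp add: mult_left_le_one_le)
  then have lt: "vabs (y $ i $ j - x $ i $ j) < mnorm x" for i j
    using y(1) vabs_nth_le_mnorm[of "y - x" i j] by simp
  have y11: "vabs (y $ 1 $ 1) = vabs (x $ 1 $ 1)"
    using lt[of 1 1] m by (intro vabs_eq_of_close) simp
  have off: "vabs (y $ i $ j) < vabs (x $ 1 $ 1)" if "vabs (x $ i $ j) < vabs (x $ 1 $ 1)" for i j
    using vabs_add_less[OF lt[of i j, unfolded m] that] by simp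
  have "vabs (det y - det x) \<le> mnorm x * (vabs a * mnorm x)"
    using y by (intro vabs_det_diff_le) auto
  also have "\<dots> = vabs a * (vabs (x $ 1 $ 1))\<^sup>2" by (simp add: m power2_eq_square)
  finally have "vabs ((det y - det x) + det x) \<le> vabs a * (vabs (x $ 1 $ 1))\<^sup>2"
    using x by (intro vabs_add_le) (auto simp: corner_def)
  moreover have "y $ 1 $ 1 \<noteq> 0" using y11 nz by (metis vabs_eq_0_iff)
  ultimately show "y \<in> corner a" using x off y11 by (simp add: corner_def)
qed (use a in auto)

lemma ind_corner_transpose: "ind_corner a (transpose x) = ind_corner a x"
  by (auto simp: ind_corner_def corner_def) (simp_all add: transpose_def)

lemma matrix_inv_lower:
  "t \<noteq> 0 \<Longrightarrow> matrix_inv (mat2 1 0 c t) = mat2 1 0 (- c / t) (1 / t :: 'a::field)"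
  by (subst matrix_inv_mat2) simp_all

text \<open>In the coordinate \<open>u / p\<close> the disc of radius \<open>vabs unif\<close>
  splits into discs of radius \<open>(vabs unif)\<^sup>2\<close> around the points
  \<open>unif * r\<close>, one for each residue \<open>r\<close>. The matrix for \<open>r\<close>
  carries the large disc onto that small one and multiplies the determinant by
  \<open>unif\<close>.\<close>

lemma ind_corner_sum:
  fixes a :: "'f::nonarch_local_field" and R :: "'f set"
  assumes R: "finite R" "\<And>r. r \<in> R \<Longrightarrow> vabs r \<le> 1"
    "\<And>x :: 'f. vabs x \<le> 1 \<Longrightarrow> \<exists>!r\<in>R. vabs (x - r) \<le> vabs (unif :: 'f)"
  shows "ind_corner (a * unif) x =
    (\<Sum>r\<in>R. act (mat2 1 0 (unif * r) unif) (mat 1) (ind_corner a) x)"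
proof (cases x rule: mat2_cases)
  case (mat2 p q u s)
  let ?w = "unif :: 'f"
  have main: "matrix_inv (mat2 1 0 (?w * r) ?w) ** x \<in> corner a \<longleftrightarrow>
      x \<in> corner (a * ?w) \<and> vabs (u / (?w * p) - r) \<le> vabs ?w" if r: "r \<in> R" for r
  proof (cases "p = 0")
    case False
    have "matrix_inv (mat2 1 0 (?w * r) ?w) ** x = mat2 p q (u / ?w - r * p) (s / ?w - r * q)"
      by (simp add: matrix_inv_lower mat2 mat2_mult)
    moreover have "p * (s / ?w - r * q) - q * (u / ?w - r * p) = (p * s - q * u) / ?w"
      by (simp add: field_simps)
    moreover have "vabs (u / ?w - r * p) < vabs p \<longleftrightarrow> vabs (u / (?w * p) - r) \<le> vabs ?w"
    proof -
      have "u / ?w - r * p = (u / (?w * p) - r) * p" using False by (simp add: field_simps)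
      then have "vabs (u / ?w - r * p) < vabs p \<longleftrightarrow> vabs (u / (?w * p) - r) < 1"
        using False by (simp add: vabs_mult)
      also have "\<dots> \<longleftrightarrow> vabs (u / (?w * p) - r) \<le> vabs ?w"
        using vabs_le_unif vabs_unif_less_1[where 'f = 'f] by (metis le_less_trans)
      finally show ?thesis .
    qed
    moreover have "vabs u < vabs p" if *: "vabs (u / (?w * p) - r) \<le> vabs ?w"
    proof -
      have "vabs (u / (?w * p) - r) \<le> 1" using * vabs_unif_less_1[where 'f = 'f] by linarith
      from vabs_add_le[OF this R(2)[OF r]] have "vabs (u / (?w * p)) \<le> 1" by simp
      then have "vabs u \<le> vabs ?w * vabs p" using False by (simp add: vabs_divide vabs_mult field_simps)
      then show ?thesis using vabs_le_unif_mult_iff[OF False] by blast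
    qed
    moreover have "vabs ((p * s - q * u) / ?w) \<le> vabs a * (vabs p)\<^sup>2 \<longleftrightarrow>
        vabs (p * s - q * u) \<le> vabs (a * ?w) * (vabs p)\<^sup>2"
      by (simp add: vabs_divide vabs_mult field_simps)
    ultimately show ?thesis unfolding mat2 by (simp only: mat2_in_corner) blast
  qed (simp add: matrix_inv_lower mat2 mat2_mult mat2_in_corner)
  have "(\<Sum>r\<in>R. act (mat2 1 0 (?w * r) ?w) (mat 1) (ind_corner a) x) =
      (\<Sum>r\<in>R. ind_corner (a * ?w) x * of_bool (vabs (u / (?w * p) - r) \<le> vabs ?w))"
    by (intro sum.cong refl) (simp add: act_def ind_corner_def main)
  also have "\<dots> = ind_corner (a * ?w) x"
  proof (cases "x \<in> corner (a * ?w)")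
    case True
    then have p: "p \<noteq> 0" "vabs u < vabs p" unfolding mat2 by (simp_all add: mat2_in_corner)
    then have "vabs u \<le> vabs ?w * vabs p" using vabs_le_unif_mult_iff by blast
    then have "vabs (u / (?w * p)) \<le> 1" using p by (simp add: vabs_divide vabs_mult field_simps)
    from R(3)[OF this] obtain r where r: "r \<in> R" "vabs (u / (?w * p) - r) \<le> vabs ?w"
        "\<And>r'. r' \<in> R \<Longrightarrow> vabs (u / (?w * p) - r') \<le> vabs ?w \<Longrightarrow> r' = r" by blast
    then have "vabs (u / (?w * p) - r') \<le> vabs ?w \<longleftrightarrow> r' = r" if "r' \<in> R" for r'
      using that by metis
    then have "(\<Sum>r'\<in>R. ind_corner (a * ?w) x * of_bool (vabs (u / (?w * p) - r') \<le> vabs ?w)) =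
        (\<Sum>r'\<in>R. if r' = r then ind_corner (a * ?w) x else 0)"
      by (intro sum.cong) auto
    then show ?thesis using R(1) r(1) by simp
  qed (simp add: ind_corner_def)
  finally show ?thesis by simp
qed

section \<open>The Iwahori subgroup (upper triangular modulo the maximal ideal) and its action on
  corners\<close>

definition iwahori :: "('f::nonarch_local_field ^ 2 ^ 2) set" where
  "iwahori = {k \<in> gl2o. vabs (k $ 2 $ 1) < 1}"

lemma iwahori_mat2: "mat2 p q r s \<in> iwahori \<longleftrightarrow>
    vabs p = 1 \<and> vabs q \<le> 1 \<and> vabs r < 1 \<and> vabs s = 1"
proof
  assume *: "mat2 p q r s \<in> iwahori"
  then have le: "vabs p \<le> 1" "vabs q \<le> 1" "vabs r < 1" "vabs s \<le> 1" "vabs (p * s - q * r) = 1"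
    by (auto simp: iwahori_def gl2o_def mnorm_mat2)
  have "vabs (q * r) < 1"
    using le mult_left_le_one_le[of "vabs r" "vabs q"] by (simp add: vabs_mult)
  then have "vabs (p * s) = 1"
    using vabs_eq_of_close[of "p * s" "p * s - q * r"] le(5) by simp
  then have ps: "vabs p * vabs s = 1" by (simp add: vabs_mult)
  then have "vabs p = 1" "vabs s = 1"
    using le(1,4) mult_left_le_one_le[of "vabs s" "vabs p"] mult_right_le_one_le[of "vabs p" "vabs s"] by auto
  then show "vabs p = 1 \<and> vabs q \<le> 1 \<and> vabs r < 1 \<and> vabs s = 1" using le by simp
next
  assume *: "vabs p = 1 \<and> vabs q \<le> 1 \<and> vabs r < 1 \<and> vabs s = 1"
  then have "vabs (q * r) < 1"
    using mult_left_le_one_le[of "vabs r" "vabs q"] by (simp add: vabs_mult)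
  then have "vabs (p * s - q * r) = vabs (p * s)"
    using * by (intro vabs_eq_of_close) (simp add: vabs_mult)
  then show "mat2 p q r s \<in> iwahori"
    using * by (simp add: iwahori_def gl2o_def mnorm_mat2 vabs_mult)
qed

text \<open>Distance less than 1 is congruence modulo the maximal ideal, and membership in
  \<open>iwahori\<close> depends only on integral entries modulo that ideal; hence the radius
  1.\<close>

lemma compact_open_iwahori: "compact_open_subgroup (iwahori :: ('f::nonarch_local_field ^ 2 ^ 2) set) 1"
proof
  show "iwahori \<subseteq> (gl2o :: ('f ^ 2 ^ 2) set)" by (auto simp: iwahori_def)
  show "mat 1 \<in> (iwahori :: ('f ^ 2 ^ 2) set)" by (simp add: mat_eq_mat2 iwahori_mat2)
  show "g ** h \<in> iwahori" if gh: "g \<in> iwahori" "h \<in> iwahori" for g h :: "'f ^ 2 ^ 2"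
  proof (cases g rule: mat2_cases; cases h rule: mat2_cases)
    fix a b c d a' b' c' d' assume *: "g = mat2 a b c d" "h = mat2 a' b' c' d'"
    have "vabs (c * a' + d * c') < 1"
      using gh unfolding * by (intro vabs_add_less) (auto simp: iwahori_mat2 vabs_mult)
    then show ?thesis
      using gl2o_mult[of g h] gh by (simp add: iwahori_def) (simp add: * mat2_mult)
  qed
  show "matrix_inv g \<in> iwahori" if g: "g \<in> iwahori" for g :: "'f ^ 2 ^ 2"
  proof (cases g rule: mat2_cases)
    case (mat2 a b c d)
    have D: "vabs (a * d - b * c) = 1" "a * d - b * c \<noteq> 0"
      using g by (auto simp: iwahori_def gl2o_def mat2)
    show ?thesis
      using gl2o_matrix_inv[of g] g unfolding iwahori_def mat2 matrix_inv_mat2[OF D(2)]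
      by (simp add: vabs_divide D(1))
  qed
  show "y \<in> iwahori" if "g \<in> iwahori" "mnorm (y - g) < 1" for g y :: "'f ^ 2 ^ 2"
  proof (cases g rule: mat2_cases; cases y rule: mat2_cases)
    fix a b c d a' b' c' d' assume *: "g = mat2 a b c d" "y = mat2 a' b' c' d'"
    have lt: "vabs (a' - a) < 1" "vabs (b' - b) < 1" "vabs (c' - c) < 1" "vabs (d' - d) < 1"
      using that(2) unfolding * by (auto simp: mat2_diff mnorm_mat2)
    have g: "vabs a = 1" "vabs b \<le> 1" "vabs c < 1" "vabs d = 1"
      using that(1) by (auto simp: * iwahori_mat2)
    show ?thesis
      using vabs_eq_of_close[of a' a] vabs_eq_of_close[of d' d] lt g
        vabs_add_le[of "b' - b" 1 b] vabs_add_less[of "c' - c" 1 c]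
      by (simp add: * iwahori_mat2)
  qed
qed auto

interpretation iwahori: compact_open_subgroup "iwahori :: ('f::nonarch_local_field ^ 2 ^ 2) set" 1
  by (rule compact_open_iwahori)

lemma mat2_in_iwahori_scaled:
  "mat2 p q r s \<in> iwahori.scaled \<longleftrightarrow> p \<noteq> 0 \<and> vabs q \<le> vabs p \<and> vabs r < vabs p \<and> vabs (p * s - q * r) = (vabs p)\<^sup>2"
proof
  assume "mat2 p q r s \<in> iwahori.scaled"
  then obtain c k where ck: "c \<noteq> 0" "k \<in> iwahori" "mat2 p q r s = mat c ** k"
    unfolding iwahori.scaled_def by blast
  show "p \<noteq> 0 \<and> vabs q \<le> vabs p \<and> vabs r < vabs p \<and> vabs (p * s - q * r) = (vabs p)\<^sup>2"
  proof (cases k rule: mat2_cases)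
    case (mat2 p' q' r' s')
    have k: "vabs p' = 1" "vabs q' \<le> 1" "vabs r' < 1" "vabs s' = 1"
      using ck(2) by (auto simp: mat2 iwahori_mat2)
    have eq: "p = c * p'" "q = c * q'" "r = c * r'" "s = c * s'"
      using ck(3) by (simp_all add: mat2 mat_mult_mat2)
    have "vabs (det k) = 1" using ck(2) by (simp add: iwahori_def gl2o_def)
    then have d: "vabs (p' * s' - q' * r') = 1" by (simp add: mat2)
    have "p * s - q * r = c * c * (p' * s' - q' * r')" by (simp add: eq algebra_simps)
    then have "vabs (p * s - q * r) = (vabs p)\<^sup>2" using d k by (simp add: vabs_mult eq power2_eq_square)
    then show ?thesis using k ck(1) by (auto simp: eq vabs_mult mult_left_le)
  qed
next
  assume *: "p \<noteq> 0 \<and> vabs q \<le> vabs p \<and> vabs r < vabs p \<and> vabs (p * s - q * r) = (vabs p)\<^sup>2"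
  have "vabs (q * r) \<le> vabs p * vabs r" using * by (simp add: vabs_mult mult_right_mono)
  also have "\<dots> < (vabs p)\<^sup>2" using * by (simp add: power2_eq_square)
  finally have "vabs (p * s) = vabs (p * s - q * r)"
    using * by (intro vabs_eq_of_close) simp
  then have "vabs s = vabs p" using * by (simp add: vabs_mult power2_eq_square)
  then have "mat2 1 (q / p) (r / p) (s / p) \<in> iwahori"
    using * by (simp add: iwahori_mat2 vabs_divide)
  from iwahori.scaledI[OF _ this, of p] show "mat2 p q r s \<in> iwahori.scaled"
    using * by (simp add: mat_mult_mat2)
qed

text \<open>Multiplying the second column by \<open>unif\<close> turns the strict bound on the upper
  right entry into the weak one of \<open>iwahori\<close>, and the two determinant bounds into
  \<open>\<le>\<close> and \<open><\<close> against the square of \<open>vabs p\<close>. Their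
  difference leaves equality, which is a unit determinant after division by
  \<open>p\<close>.\<close>

lemma iwahori_ind_eq:
  "iwahori.ind x = act (mat 1) (mat2 1 0 0 unif)
     (\<lambda>x. ind_corner (unif :: 'f) x - ind_corner (unif * unif) x) (x :: 'f::nonarch_local_field ^ 2 ^ 2)"
proof (cases x rule: mat2_cases)
  case (mat2 p q r s)
  let ?w = "unif :: 'f"
  define D where "D = p * s - q * r"
  have xh: "mat2 p q r s ** mat2 1 0 0 ?w = mat2 p (?w * q) r (?w * s)" by (simp add: mat2_mult mult.commute)
  have d: "p * (?w * s) - ?w * q * r = ?w * D" by (simp add: D_def algebra_simps)
  have q: "vabs (?w * q) < vabs p \<longleftrightarrow> vabs q \<le> vabs p" if "p \<noteq> 0"
    using vabs_unif_mult_less_iff[OF that] by (simp add: vabs_mult)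
  have 1: "vabs (?w * D) \<le> vabs ?w * (vabs p)\<^sup>2 \<longleftrightarrow> vabs D \<le> (vabs p)\<^sup>2"
    by (simp add: vabs_mult)
  have 2: "vabs (?w * D) \<le> vabs (?w * ?w) * (vabs p)\<^sup>2 \<longleftrightarrow> vabs D < (vabs p)\<^sup>2" if "p \<noteq> 0"
    using vabs_le_unif_mult_iff[of "p * p" D] that by (simp add: vabs_mult power2_eq_square)
  show ?thesis
    unfolding act_def iwahori.ind_def ind_corner_def
    by (cases "p = 0") (simp add: mat2 mat2_mult mat2_in_corner mat2_in_iwahori_scaled,
      auto simp: xh mat2_in_corner d 1 2 q mat2 mat2_in_iwahori_scaled simp flip: D_def)
qed

text \<open>Left multiplication by \<open>k\<close> changes the first entry by a unit up to smaller
  terms, and the determinant by a unit. One inclusion suffices, since it also holds for the inverse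
  of \<open>k\<close>.\<close>

lemma iwahori_mult_corner:
  assumes k: "k \<in> iwahori" and a: "vabs a < 1"
  shows "ind_corner a (k ** x) = ind_corner a x"
proof -
  have imp: "k ** x \<in> corner a" if k: "k \<in> iwahori" and x: "x \<in> corner a" for k x :: "'a ^ 2 ^ 2"
  proof (cases k rule: mat2_cases; cases x rule: mat2_cases)
    fix k1 k2 k3 k4 p q r s assume *: "k = mat2 k1 k2 k3 k4" "x = mat2 p q r s"
    have kk: "vabs k1 = 1" "vabs k2 \<le> 1" "vabs k3 < 1" "vabs k4 = 1"
      using k by (auto simp: * iwahori_mat2)
    have xx: "p \<noteq> 0" "vabs q < vabs p" "vabs r < vabs p" "vabs (p * s - q * r) \<le> vabs a * (vabs p)\<^sup>2"
      using x by (auto simp: * mat2_in_corner)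
    have s: "vabs s < vabs p" using corner_vabs(1)[OF a] x by (simp add: *)
    have lt: "vabs (k2 * z) < vabs p" if "vabs z < vabs p" for z
      using kk(2) that mult_right_le_one_le[of "vabs z" "vabs k2"] mult.commute[of "vabs z"]
      by (simp add: vabs_mult)
    have p': "vabs (k1 * p + k2 * r) = vabs p"
      using vabs_eq_of_close[of "k1 * p + k2 * r" "k1 * p"] lt[OF xx(3)] kk(1) by (simp add: vabs_mult)
    moreover have "k1 * p + k2 * r \<noteq> 0" using p' xx(1) by (metis vabs_eq_0_iff)
    moreover have "vabs (k1 * q + k2 * s) < vabs p"
      using lt[OF s] kk(1) xx(2) by (intro vabs_add_less) (simp_all add: vabs_mult)
    moreover have "vabs (k3 * p + k4 * r) < vabs p"
      using kk xx by (intro vabs_add_less) (simp_all add: vabs_mult)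
    moreover have "vabs (det (k ** x)) = vabs (det x)"
      using k by (simp add: det_mul vabs_mult iwahori_def gl2o_def)
    ultimately show ?thesis
      using xx(4) unfolding * mat2_mult corner_def by simp
  qed
  have "matrix_inv k ** (k ** x) = x"
    using matrix_inv_laws[OF iwahori.invertible_H[OF k]] by (simp add: matrix_mul_assoc)
  then have "k ** x \<in> corner a \<longleftrightarrow> x \<in> corner a"
    using imp[OF k, of x] imp[OF iwahori.minv[OF k], of "k ** x"] by auto
  then show ?thesis by (simp add: ind_corner_def)
qed

text \<open>Corners are symmetric under transposition, which turns right multiplication by
  \<open>k\<close> into left multiplication by an element of \<open>iwahori\<close>.\<close>

lemma corner_mult_iwahori:
  assumes "k \<in> transpose ` iwahori" "vabs a < 1"
  shows "ind_corner a (x ** k) = ind_corner a x"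
proof -
  obtain l where l: "l \<in> iwahori" "k = transpose l" using assms(1) by blast
  have "ind_corner a (x ** k) = ind_corner a (transpose (x ** k))"
    by (simp add: ind_corner_transpose)
  also have "transpose (x ** k) = l ** transpose x" by (simp add: l matrix_transpose_mul)
  also have "ind_corner a \<dots> = ind_corner a x"
    using iwahori_mult_corner[OF l(1) assms(2)] ind_corner_transpose by metis
  finally show ?thesis .
qed


section \<open>Rank one matrices: a column times a row, as points of a product of two projective
  lines\<close>

definition outer :: "'a::semiring_1 \<Rightarrow> 'a \<Rightarrow> 'a \<Rightarrow> 'a \<Rightarrow> 'a ^ 2 ^ 2" where
  "outer u1 u2 w1 w2 = mat2 (u1 * w1) (u1 * w2) (u2 * w1) (u2 * w2)"

lemma rank_one_cases:
  assumes "x \<noteq> 0" "det x = 0"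
  obtains u1 u2 w1 w2 :: "'a::field"
  where "x = outer u1 u2 w1 w2" "u1 \<noteq> 0 \<or> u2 \<noteq> 0" "w1 \<noteq> 0 \<or> w2 \<noteq> 0"
proof (cases x rule: mat2_cases)
  case (mat2 a b c d)
  have D: "a * d = b * c" using assms(2) by (simp add: mat2)
  consider "a \<noteq> 0" | "b \<noteq> 0" | "c \<noteq> 0" | "d \<noteq> 0" using assms(1) by (auto simp: mat2 zero_eq_mat2)
  then show thesis
  proof cases
    case 1
    show thesis by (rule that[of a c 1 "b / a"]) (use 1 D in \<open>auto simp: mat2 outer_def field_simps\<close>)
  next
    case 2
    show thesis by (rule that[of b d "a / b" 1]) (use 2 D in \<open>auto simp: mat2 outer_def field_simps\<close>)
  next
    case 3
    show thesis by (rule that[of a c 1 "d / c"]) (use 3 D in \<open>auto simp: mat2 outer_def field_simps\<close>)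
  next
    case 4
    show thesis by (rule that[of b d "c / d" 1]) (use 4 D in \<open>auto simp: mat2 outer_def field_simps\<close>)
  qed
qed

lemma mat2_mult_outer:
  "mat2 a b c d ** outer u1 u2 w1 w2 = outer (a * u1 + b * u2) (c * u1 + d * u2) w1 (w2 :: 'a::comm_ring_1)"
  by (simp add: outer_def mat2_mult algebra_simps)

lemma outer_mult_mat2:
  "outer u1 u2 w1 w2 ** mat2 a b c d = outer u1 u2 (w1 * a + w2 * c) (w1 * b + w2 * (d :: 'a::comm_ring_1))"
  by (simp add: outer_def mat2_mult algebra_simps)

lemma ind_corner_outer:
  "ind_corner a (outer u1 u2 w1 w2) = of_bool (vabs u2 < vabs u1) * of_bool (vabs w2 < vabs w1)"
proof -
  have "outer u1 u2 w1 w2 \<in> corner a \<longleftrightarrow> u1 \<noteq> 0 \<and> w1 \<noteq> 0 \<and> vabs w2 < vabs w1 \<and> vabs u2 < vabs u1"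
    by (auto simp: outer_def mat2_in_corner vabs_mult)
  moreover have "u1 \<noteq> 0" if "vabs u2 < vabs u1" for u1 u2 :: 'a
    using that vabs_nonneg[of u2] by (metis vabs_0 not_le)
  ultimately show ?thesis unfolding ind_corner_def by auto
qed

lemma mat_mult_outer: "mat t ** outer u1 u2 w1 w2 = outer (t * u1) (t * u2) w1 (w2 :: 'a::field)"
  by (simp add: outer_def mat_mult_mat2 mult.assoc)

lemma outer_scale:
  assumes "F \<in> lcf" "s \<noteq> 0" "t \<noteq> 0"
  shows "F (outer (s * u1) (s * u2) (t * w1) (t * w2)) = F (outer u1 u2 w1 w2)"
proof -
  have "outer (s * u1) (s * u2) (t * w1) (t * w2) = mat (s * t) ** outer u1 u2 w1 w2"
    by (simp add: mat_mult_outer) (simp add: outer_def mult_ac)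
  then show ?thesis using lcf_scale[OF assms(1)] assms by simp
qed

text \<open>The matrix \<open>mat2 0 1 unif 0\<close> exchanges the disc
  \<open>vabs u2 < vabs u1\<close> with its complement: its inverse takes \<open>(u1, u2)\<close> to
  \<open>(u2 / unif, u1)\<close>. The factor \<open>unif\<close> makes the weak inequality of the
  complement strict.\<close>

lemma vabs_swap_iff:
  assumes "u1 \<noteq> 0 \<or> u2 \<noteq> 0"
  shows "vabs u1 < vabs (u2 / (unif :: 'f)) \<longleftrightarrow> \<not> vabs u2 < vabs (u1 :: 'f::nonarch_local_field)"
proof (cases "u2 = 0")
  case False
  have "vabs u1 < vabs (u2 / (unif :: 'f)) \<longleftrightarrow> vabs (unif :: 'f) * vabs u1 < vabs u2"
    by (simp add: vabs_divide field_simps)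
  also have "\<dots> \<longleftrightarrow> vabs u1 \<le> vabs u2" by (rule vabs_unif_mult_less_iff[OF False])
  finally show ?thesis by auto
qed (use assms in auto)

lemma matrix_inv_swap: "matrix_inv (mat2 0 1 t 0) = mat2 0 (1 / t) 1 0" if "t \<noteq> (0 :: 'a::field)"
  by (subst matrix_inv_mat2) (use that in simp_all)

lemma invertible_swap: "t \<noteq> 0 \<Longrightarrow> invertible (mat2 0 1 t (0 :: 'a::field))"
  by (simp add: invertible_mat2_iff)

section \<open>Intertwiners vanishing on \<open>lcf0\<close>, and the effect of exchanging a disc
  with its complement\<close>

context gl2_rep
begin

text \<open>Functions that agree on rank one matrices differ by an element of \<open>lcf0\<close>,
  so such a \<open>T\<close> sees only functions on the boundary.\<close>

lemma kills_boundary_eq: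
  assumes T: "intertwiner T" and kills: "\<And>F. F \<in> lcf0 \<Longrightarrow> T F = 0"
    and FG: "F \<in> lcf" "G \<in> lcf"
    and eq: "\<And>u1 u2 w1 w2. u1 \<noteq> 0 \<or> u2 \<noteq> 0 \<Longrightarrow> w1 \<noteq> 0 \<or> w2 \<noteq> 0 \<Longrightarrow>
      F (outer u1 u2 w1 w2) = G (outer u1 u2 w1 w2)"
  shows "T F = T G"
proof -
  have "(\<lambda>x. F x - G x) \<in> lcf0"
  proof (rule lcf0I[OF lcf_diff[OF FG]])
    fix x :: "'f ^ 2 ^ 2" assume "x \<noteq> 0" "det x = 0"
    then obtain u1 u2 w1 w2 where "x = outer u1 u2 w1 w2" "u1 \<noteq> 0 \<or> u2 \<noteq> 0" "w1 \<noteq> 0 \<or> w2 \<noteq> 0"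
      by (rule rank_one_cases)
    then show "F x - G x = 0" using eq by simp
  qed
  then show ?thesis using kills intertwiner_diff[OF T FG] by simp
qed

abbreviation Z :: "'f ^ 2 ^ 2 \<Rightarrow> complex" where "Z \<equiv> ind_corner unif"

lemma Z_lcf: "Z \<in> lcf"
  by (rule ind_corner_lcf) (simp_all add: vabs_unif_less_1)

lemma unif_unif: "(unif * unif :: 'f) \<noteq> 0" "vabs (unif * unif :: 'f) < 1"
  using mult_strict_mono[of "vabs (unif :: 'f)" 1 "vabs (unif :: 'f)" 1] vabs_unif_less_1[where 'f = 'f]
  by (simp_all add: vabs_mult)

lemma Z2_lcf: "ind_corner (unif * unif :: 'f) \<in> lcf"
  by (rule ind_corner_lcf[OF unif_unif])

text \<open>Chosen once, so that the sum over \<open>step r\<close> is the same operator for every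
  intertwiner.\<close>

definition residues :: "'f set" where
  "residues = (SOME R. finite R \<and> (\<forall>r\<in>R. vabs r \<le> 1) \<and>
    (\<forall>x. vabs x \<le> 1 \<longrightarrow> (\<exists>!r\<in>R. vabs (x - r) \<le> vabs (unif :: 'f))))"

lemma
  shows finite_residues: "finite residues"
    and residues_le_1: "r \<in> residues \<Longrightarrow> vabs r \<le> 1"
    and residues_unique: "vabs x \<le> 1 \<Longrightarrow> \<exists>!r\<in>residues. vabs (x - r) \<le> vabs (unif :: 'f)"
proof -
  have "\<exists>R :: 'f set. finite R \<and> (\<forall>r\<in>R. vabs r \<le> 1) \<and>
    (\<forall>x. vabs x \<le> 1 \<longrightarrow> (\<exists>!r\<in>R. vabs (x - r) \<le> vabs (unif :: 'f)))"
    by (rule residues_ex[of "unif :: 'f"]) (use vabs_unif_less_1[where 'f = 'f] in auto)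
  from someI_ex[OF this, folded residues_def]
  show "finite residues" "r \<in> residues \<Longrightarrow> vabs r \<le> 1"
    "vabs x \<le> 1 \<Longrightarrow> \<exists>!r\<in>residues. vabs (x - r) \<le> vabs (unif :: 'f)" by blast+
qed

text \<open>The residues of 0 and 1 differ. That the residue field does not have size 1 is what
  excludes an invariant measure on the projective line.\<close>

lemma card_residues: "card residues \<noteq> 1"
proof
  assume "card residues = 1"
  then obtain r where r: "residues = {r}" by (auto simp: card_1_singleton_iff)
  have *: "vabs (1 - r) \<le> vabs (unif :: 'f)" "vabs (0 - r) \<le> vabs (unif :: 'f)"
    using residues_unique[of 0] residues_unique[of 1] unfolding r by auto
  from vabs_diff_le[OF *] show False using vabs_unif_less_1[where 'f = 'f] by simp
qed

definition step :: "'f \<Rightarrow> 'f ^ 2 ^ 2" where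
  "step r = mat2 1 0 (unif * r) unif"

lemma invertible_step: "invertible (step r)"
  by (simp add: step_def invertible_mat2_iff)

lemma intertwiner_Z2:
  assumes T: "intertwiner T"
  shows "T (ind_corner (unif * unif)) = (\<Sum>r\<in>residues. \<rho> (step r) (mat 1) (T Z))"
proof -
  have "ind_corner (unif * unif :: 'f) = (\<lambda>x. \<Sum>r\<in>residues. 1 * act (step r) (mat 1) Z x)"
    unfolding step_def
    by (rule ext, simp only: mult_1_left, rule ind_corner_sum[OF finite_residues residues_le_1 residues_unique])
  then have "T (ind_corner (unif * unif)) = (\<Sum>r\<in>residues. smul 1 (T (act (step r) (mat 1) Z)))"
    using intertwiner_sum[OF T, of residues "\<lambda>r. act (step r) (mat 1) Z" "\<lambda>_. 1"]
    by (simp add: lcf_act[OF Z_lcf invertible_step])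
  then show ?thesis by (simp add: intertwiner_act[OF T Z_lcf invertible_step])
qed

lemma kills_Z2:
  assumes "intertwiner T" "\<And>F. F \<in> lcf0 \<Longrightarrow> T F = 0"
  shows "T (ind_corner (unif * unif)) = T Z"
  by (rule kills_boundary_eq[OF assms Z2_lcf Z_lcf]) (simp_all add: ind_corner_outer)

text \<open>The two discs cover the projective line, so \<open>T S\<close> below comes from a function on the boundary that
  is constant in the first factor. It must vanish because the projective line carries no invariant
  measure: a disc is the disjoint union of translates of itself.\<close>

lemma kills_swap_left:
  assumes T: "intertwiner T" and kills: "\<And>F. F \<in> lcf0 \<Longrightarrow> T F = 0" and nz: "T Z \<noteq> 0"
  shows "T (act (mat2 0 1 unif 0) (mat 1) Z) = - T Z"
proof -
  let ?W = "mat2 0 1 unif (0 :: 'f)"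
  define S where "S = (\<lambda>x. Z x + act ?W (mat 1) Z x)"
  have W: "invertible ?W" by (rule invertible_swap) simp
  have lcfW: "act ?W (mat 1) Z \<in> lcf" by (intro lcf_act Z_lcf W invertible_mat_1)
  have S: "S \<in> lcf" unfolding S_def by (intro lcf_add Z_lcf lcfW)
  have S_outer: "S (outer u1 u2 w1 w2) = of_bool (vabs w2 < vabs w1)" if "u1 \<noteq> 0 \<or> u2 \<noteq> 0" for u1 u2 w1 w2
    using vabs_swap_iff[OF that]
    by (simp add: S_def act_def matrix_inv_swap mat2_mult_outer ind_corner_outer)
  have inv: "\<rho> g (mat 1) (T S) = T S" if g: "invertible g" for g
  proof -
    have "T (act g (mat 1) S) = T S"
    proof (rule kills_boundary_eq[OF T kills lcf_act[OF S g invertible_mat_1] S])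
      fix u1 u2 w1 w2 :: 'f assume u: "u1 \<noteq> 0 \<or> u2 \<noteq> 0" and w: "w1 \<noteq> 0 \<or> w2 \<noteq> 0"
      show "act g (mat 1) S (outer u1 u2 w1 w2) = S (outer u1 u2 w1 w2)"
      proof (cases "matrix_inv g" rule: mat2_cases)
        case (mat2 a b c d)
        have "a * u1 + b * u2 \<noteq> 0 \<or> c * u1 + d * u2 \<noteq> 0"
        proof (rule ccontr)
          assume "\<not> ?thesis"
          then have "matrix_inv g ** outer u1 u2 1 1 ** mat 1 = 0"
            by (simp add: mat2 mat2_mult_outer) (simp add: outer_def zero_eq_mat2)
          then have "outer u1 u2 1 1 = 0"
            using mult_invertible_eq_0_iff[OF invertible_matrix_inv[OF g] invertible_mat_1] by blast
          then show False using u by (auto simp: outer_def zero_eq_mat2)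
        qed
        then show ?thesis
          using u by (simp add: act_def mat2 mat2_mult_outer S_outer)
      qed
    qed
    then show ?thesis using intertwiner_act[OF T S g invertible_mat_1] by simp
  qed
  have "T S = 0"
  proof (rule ccontr)
    assume TS: "T S \<noteq> 0"
    \<comment> \<open>Vectors fixed by the left factor. This factor is normal in the product, so
      they form an invariant subspace; if it is nonzero, the left factor acts trivially on the whole
      space.\<close>
    define V where "V = {m. \<forall>g. invertible g \<longrightarrow> \<rho> g (mat 1) m = m}"
    have "subspace V"
      unfolding V_def by (rule subspaceI) (auto simp: rho_0 rho_add rho_smul)
    moreover have "\<rho> g h m \<in> V" if gh: "invertible g" "invertible h" and m: "m \<in> V" for g h m
      unfolding V_def
    proof safe
      fix k :: "'f ^ 2 ^ 2" assume k: "invertible k"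
      define l where "l = matrix_inv g ** k ** g"
      have l: "invertible l" unfolding l_def by (intro invertible_mult invertible_matrix_inv gh k)
      have "g ** l = (g ** matrix_inv g) ** k ** g" unfolding l_def by (simp only: matrix_mul_assoc)
      then have gl: "g ** l = k ** g" using gh by (simp add: matrix_inv_laws)
      have "\<rho> k (mat 1) (\<rho> g h m) = \<rho> (k ** g) (mat 1 ** h) m"
        using rho_mult[of k "mat 1" g h m] k gh by simp
      also have "\<dots> = \<rho> (g ** l) (h ** mat 1) m" by (simp add: gl)
      also have "\<dots> = \<rho> g h (\<rho> l (mat 1) m)" using rho_mult[of g h l "mat 1" m] l gh by simp
      also have "\<rho> l (mat 1) m = m" using m l unfolding V_def by blast
      finally show "\<rho> k (mat 1) (\<rho> g h m) = \<rho> g h m" .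
    qed
    ultimately have "V = {0} \<or> V = UNIV" by (intro irreducible)
    moreover have "T S \<in> V" using inv by (simp add: V_def)
    ultimately have "T Z \<in> V" using TS by blast
    \<comment> \<open>With a trivial left factor the sum over \<open>step r\<close> multiplies
      \<open>T Z\<close> by the number of residues, yet it fixes \<open>T Z\<close> because
      \<open>T\<close> kills \<open>lcf0\<close>.\<close>
    then have "T Z = (\<Sum>r\<in>residues. T Z)"
      using kills_Z2[OF T kills] intertwiner_Z2[OF T] invertible_step by (simp add: V_def)
    also have "\<dots> = smul (of_nat (card residues)) (T Z)"
      by (simp add: sum_constant_scale)
    finally have "smul (of_nat (card residues) - 1) (T Z) = 0"
      by (simp add: scale_left_diff_distrib)
    then have "of_nat (card residues) = (1 :: complex)" using nz by simp
    then show False using card_residues by (metis of_nat_1 of_nat_eq_iff)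
  qed
  then show ?thesis
    using intertwiner_add[OF T Z_lcf lcfW] by (simp add: S_def eq_neg_iff_add_eq_0 add.commute)
qed

text \<open>The twist by the automorphism that exchanges the factors and applies the inverse
  transpose to each: transposing \<open>g x h\<^sup>-\<^sup>1\<close> gives the action of the
  resulting pair on the transpose of \<open>x\<close>.\<close>

definition rho_t :: "'f ^ 2 ^ 2 \<Rightarrow> 'f ^ 2 ^ 2 \<Rightarrow> 'v \<Rightarrow> 'v" where
  "rho_t g h = \<rho> (transpose (matrix_inv h)) (transpose (matrix_inv g))"

lemma inv_transpose:
  assumes "invertible g"
  shows "invertible (transpose (matrix_inv g))"
    "transpose (matrix_inv (transpose (matrix_inv g))) = (g :: 'f ^ 2 ^ 2)"
  using assms by (simp_all add: invertible_transpose2 invertible_matrix_inv matrix_inv_inv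
      flip: transpose_matrix_inv)

lemma gl2_rep_transpose: "gl2_rep smul rho_t"
proof (intro gl2_rep.intro gl2_rep_axioms.intro vector_space_axioms)
  show "Vector_Spaces.linear smul smul (rho_t g h)" if "invertible g" "invertible h" for g h
    unfolding rho_t_def using that by (intro linear_rho inv_transpose)
  show "rho_t (mat 1) (mat 1) v = v" for v
    by (simp add: rho_t_def rho_one transpose_mat)
  show "rho_t (g ** g') (h ** h') v = rho_t g h (rho_t g' h' v)"
    if "invertible g" "invertible h" "invertible g'" "invertible h'" for g h g' h' v
    using that by (simp add: rho_t_def matrix_inv_mult matrix_transpose_mul rho_mult inv_transpose)
  show "W = {0} \<or> W = UNIV" if W: "subspace W"
    "\<And>g h w. invertible g \<Longrightarrow> invertible h \<Longrightarrow> w \<in> W \<Longrightarrow> rho_t g h w \<in> W" for W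
  proof (rule irreducible[OF W(1)])
    fix g h :: "'f ^ 2 ^ 2" and w assume gh: "invertible g" "invertible h" "w \<in> W"
    have "rho_t (transpose (matrix_inv h)) (transpose (matrix_inv g)) w \<in> W"
      by (intro W(2) inv_transpose gh)
    then show "\<rho> g h w \<in> W" using gh by (simp add: rho_t_def inv_transpose)
  qed
  show "finite_dim smul {v. \<forall>g\<in>cong_subgroup a. \<forall>h\<in>cong_subgroup a. rho_t g h v = v}"
    if a: "a \<noteq> 0" "vabs a < 1" for a
  proof -
    have t: "transpose (matrix_inv g) \<in> cong_subgroup a" if "g \<in> cong_subgroup a" for g
    proof -
      have "mnorm (transpose (matrix_inv g) - mat 1) = mnorm (matrix_inv g - mat 1)"
        using mnorm_transpose[of "matrix_inv g - mat 1"]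
        by (simp add: transpose_def mnorm_def mat_def)
      then show ?thesis using cong_subgroup_matrix_inv[OF a(2) that] by (simp add: cong_subgroup_def)
    qed
    have i: "invertible g" if "g \<in> cong_subgroup a" for g
      using cong_subgroup_gl2o[OF a(2) that] by (rule gl2o_invertible)
    have "{v. \<forall>g\<in>cong_subgroup a. \<forall>h\<in>cong_subgroup a. rho_t g h v = v} =
        {v. \<forall>g\<in>cong_subgroup a. \<forall>h\<in>cong_subgroup a. \<rho> g h v = v}"
    proof (intro equalityI subsetI CollectI ballI)
      fix v and g h :: "'f ^ 2 ^ 2" assume "v \<in> {v. \<forall>g\<in>cong_subgroup a. \<forall>h\<in>cong_subgroup a. rho_t g h v = v}"
        and gh: "g \<in> cong_subgroup a" "h \<in> cong_subgroup a"
      then have "rho_t (transpose (matrix_inv h)) (transpose (matrix_inv g)) v = v" using t by blast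
      then show "\<rho> g h v = v" using i gh by (simp add: rho_t_def inv_transpose)
    qed (use t in \<open>auto simp: rho_t_def\<close>)
    then show ?thesis using admissible[OF a] by simp
  qed
qed

lemma act_transpose:
  assumes "invertible g" "invertible h"
  shows "act g h F (transpose x) = act (transpose (matrix_inv h)) (transpose (matrix_inv g)) (\<lambda>x. F (transpose x)) x"
  using assms by (simp add: act_def matrix_transpose_mul inv_transpose matrix_mul_assoc
      transpose_matrix_inv[symmetric] invertible_matrix_inv matrix_inv_inv)

text \<open>The left version for the twisted representation and for \<open>T\<close> composed with
  transposition of the argument; \<open>mat2 0 1 (1 / unif) 0\<close> is the inverse transpose of
  \<open>mat2 0 1 unif 0\<close>.\<close>

lemma kills_swap_right:
  assumes T: "intertwiner T" and kills: "\<And>F. F \<in> lcf0 \<Longrightarrow> T F = 0" and nz: "T Z \<noteq> 0"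
  shows "T (act (mat 1) (mat2 0 1 (1 / unif) 0) Z) = - T Z"
proof -
  interpret t: gl2_rep smul rho_t by (rule gl2_rep_transpose)
  define T' where "T' F = T (\<lambda>x. F (transpose x))" for F
  have T': "t.intertwiner T'"
    unfolding t.intertwiner_def
  proof (intro conjI ballI allI impI)
    fix F G :: "'f ^ 2 ^ 2 \<Rightarrow> complex" and c g h assume F: "F \<in> lcf"
    note Ft = lcf_transpose[OF F]
    show "T' (\<lambda>x. F x + G x) = T' F + T' G" if "G \<in> lcf"
      unfolding T'_def by (rule intertwiner_add[OF T Ft lcf_transpose[OF that]])
    show "T' (\<lambda>x. c * F x) = smul c (T' F)"
      unfolding T'_def by (rule intertwiner_cmult[OF T Ft])
    show "T' (act g h F) = rho_t g h (T' F)" if "invertible g" "invertible h"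
      unfolding T'_def rho_t_def act_transpose[OF that]
      by (rule intertwiner_act[OF T Ft inv_transpose(1) inv_transpose(1)]) (use that in auto)
  qed
  have Zt: "(\<lambda>x. Z (transpose x)) = Z" by (simp add: ind_corner_transpose)
  have W: "invertible (mat2 0 1 unif (0 :: 'f))" by (rule invertible_swap) simp
  have "T' (act (mat2 0 1 unif 0) (mat 1) Z) = - T' Z"
    by (rule t.kills_swap_left[OF T']) (simp_all add: T'_def kills lcf0_transpose Zt nz)
  moreover have "(\<lambda>x. act (mat2 0 1 unif 0) (mat 1) Z (transpose x)) = act (mat 1) (mat2 0 1 (1 / unif) 0) Z"
    unfolding act_transpose[OF W invertible_mat_1] Zt
    by (simp add: matrix_inv_swap transpose_mat)
  ultimately show ?thesis by (simp add: T'_def Zt)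
qed

end

section \<open>Multiplicity one\<close>

lemma vabs_prod_diff_le:
  fixes x y :: "'f::nonarch_local_field"
  assumes "vabs x \<le> 1" "vabs y' \<le> 1" "vabs (x - x') \<le> d" "vabs (y - y') \<le> d"
  shows "vabs (x * y - x' * y') \<le> d"
proof -
  have "x * y - x' * y' = x * (y - y') + y' * (x - x')" by (simp add: algebra_simps)
  also have "vabs \<dots> \<le> d"
    using assms mult_mono[of "vabs x" 1 "vabs (y - y')" d] mult_mono[of "vabs y'" 1 "vabs (x - x')" d]
    by (intro vabs_add_le) (simp_all add: vabs_mult)
  finally show ?thesis .
qed

text \<open>In an index \<open>(b, c)\<close>, the flag selects the affine coordinate \<open>u\<^sub>2 / u\<^sub>1\<close> or \<open>u\<^sub>1 / u\<^sub>2\<close> of the projective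
  line, and \<open>c\<close> is the centre of a disc of radius \<open>\<bar>a\<bar>\<close> in it.\<close>

fun in_disc :: "'f::nonarch_local_field \<Rightarrow> bool \<times> 'f \<Rightarrow> 'f \<Rightarrow> 'f \<Rightarrow> bool" where
  "in_disc a (True, c) u1 u2 \<longleftrightarrow> u1 \<noteq> 0 \<and> vabs (u2 / u1 - c) \<le> vabs a"
| "in_disc a (False, c) u1 u2 \<longleftrightarrow> u2 \<noteq> 0 \<and> vabs (u1 / u2 - c) \<le> vabs a"

fun centre :: "bool \<times> 'f::nonarch_local_field \<Rightarrow> 'f \<times> 'f" where
  "centre (True, c) = (1, c)"
| "centre (False, c) = (c, 1)"

text \<open>Moves the standard disc \<open>vabs u2 < vabs u1\<close> onto the disc with the given
  index. The scale is \<open>a / unif\<close> because the standard disc is given by a strict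
  inequality.\<close>

fun chart :: "'f::nonarch_local_field \<Rightarrow> bool \<times> 'f \<Rightarrow> 'f ^ 2 ^ 2" where
  "chart a (True, c) = mat2 1 0 c (a / unif)"
| "chart a (False, c) = mat2 c (a / unif) 1 0"

text \<open>In the coordinate \<open>u1 / u2\<close> only centres in the maximal ideal are taken,
  since points with \<open>vabs u1 = vabs u2\<close> are covered by the other coordinate.\<close>

definition disc_index :: "'f::nonarch_local_field set \<Rightarrow> (bool \<times> 'f) set" where
  "disc_index R = {True} \<times> R \<union> {False} \<times> {c \<in> R. vabs c < 1}"

text \<open>Because \<open>vabs a < 1\<close>, a disc stays on its side of the condition
  \<open>vabs u2 \<le> vabs u1\<close>, which thus decides the coordinate; in that coordinate the
  discs are the classes modulo \<open>a\<close>.\<close>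

lemma disc_unique:
  fixes a :: "'f::nonarch_local_field"
  assumes a: "a \<noteq> 0" "vabs a < 1"
    and R: "\<And>r. r \<in> R \<Longrightarrow> vabs r \<le> 1" "\<And>x :: 'f. vabs x \<le> 1 \<Longrightarrow> \<exists>!r\<in>R. vabs (x - r) \<le> vabs a"
    and u: "u1 \<noteq> 0 \<or> u2 \<noteq> 0"
  shows "\<exists>!j. j \<in> disc_index R \<and> in_disc a j u1 u2"
proof (cases "vabs u2 \<le> vabs u1")
  case True
  have u1: "u1 \<noteq> 0"
  proof
    assume "u1 = 0"
    then have "vabs u2 = 0" using True vabs_nonneg[of u2] by simp
    then show False using u \<open>u1 = 0\<close> by simp
  qed
  then have "vabs (u2 / u1) \<le> 1" using True by (simp add: vabs_divide)
  from R(2)[OF this] obtain r where r: "r \<in> R" "vabs (u2 / u1 - r) \<le> vabs a"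
    "\<And>r'. r' \<in> R \<Longrightarrow> vabs (u2 / u1 - r') \<le> vabs a \<Longrightarrow> r' = r" by blast
  show ?thesis
  proof (rule ex1I[of _ "(True, r)"])
    show "(True, r) \<in> disc_index R \<and> in_disc a (True, r) u1 u2"
      using r(1,2) u1 by (simp add: disc_index_def)
    fix j assume j: "j \<in> disc_index R \<and> in_disc a j u1 u2"
    obtain b c where bc: "j = (b, c)" by (cases j)
    show "j = (True, r)"
    proof (cases b)
      case True
      then have "c = r" using j by (intro r(3)) (auto simp: bc disc_index_def)
      then show ?thesis using True by (simp add: bc)
    next
      case False
      then have c: "vabs c < 1" "u2 \<noteq> 0" "vabs (u1 / u2 - c) \<le> vabs a"
        using j by (auto simp: bc disc_index_def)
      then have "vabs ((u1 / u2 - c) + c) < 1" using a(2) by (intro vabs_add_less) auto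
      then have "vabs u1 < vabs u2" using c(2) by (simp add: vabs_divide)
      then show ?thesis using \<open>vabs u2 \<le> vabs u1\<close> by simp
    qed
  qed
next
  case False
  have u2: "u2 \<noteq> 0" using False by auto
  then have lt: "vabs (u1 / u2) < 1" using False by (simp add: vabs_divide)
  from R(2)[OF less_imp_le[OF this]] obtain r where r: "r \<in> R" "vabs (u1 / u2 - r) \<le> vabs a"
    "\<And>r'. r' \<in> R \<Longrightarrow> vabs (u1 / u2 - r') \<le> vabs a \<Longrightarrow> r' = r" by blast
  from vabs_diff_less[OF lt le_less_trans[OF r(2) a(2)]]
  have r1: "vabs r < 1" by simp
  show ?thesis
  proof (rule ex1I[of _ "(False, r)"])
    show "(False, r) \<in> disc_index R \<and> in_disc a (False, r) u1 u2"
      using r(1,2) r1 u2 by (simp add: disc_index_def)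
    fix j assume j: "j \<in> disc_index R \<and> in_disc a j u1 u2"
    obtain b c where bc: "j = (b, c)" by (cases j)
    show "j = (False, r)"
    proof (cases b)
      case True
      then have c: "vabs c \<le> 1" "u1 \<noteq> 0" "vabs (u2 / u1 - c) \<le> vabs a"
        using j R(1) by (auto simp: bc disc_index_def)
      then have "vabs ((u2 / u1 - c) + c) \<le> 1" using a(2) by (intro vabs_add_le) auto
      then have "vabs u2 \<le> vabs u1" using c(2) by (simp add: vabs_divide)
      then show ?thesis using \<open>\<not> vabs u2 \<le> vabs u1\<close> by simp
    next
      case False
      then have "c = r" using j by (intro r(3)) (auto simp: bc disc_index_def)
      then show ?thesis using False by (simp add: bc)
    qed
  qed
qed

lemma invertible_chart: "a \<noteq> 0 \<Longrightarrow> invertible (chart a j)"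
  by (cases "(a, j)" rule: chart.cases) (simp_all add: invertible_mat2_iff)

lemma vabs_disc_iff:
  assumes "a \<noteq> 0"
  shows "vabs ((u2 - c * u1) / (a / unif)) < vabs u1 \<longleftrightarrow>
    u1 \<noteq> 0 \<and> vabs (u2 / u1 - c) \<le> vabs (a :: 'f::nonarch_local_field)"
proof (cases "u1 = 0")
  case False
  have "vabs ((u2 - c * u1) / (a / unif)) < vabs u1 \<longleftrightarrow>
      vabs (unif :: 'f) * vabs (u2 - c * u1) < vabs (a * u1)"
    using assms by (simp add: vabs_divide vabs_mult divide_less_eq mult.commute)
  also have "\<dots> \<longleftrightarrow> vabs (u2 - c * u1) \<le> vabs (a * u1)"
    using assms False by (intro vabs_unif_mult_less_iff) simp
  also have "\<dots> \<longleftrightarrow> vabs (u2 / u1 - c) \<le> vabs a"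
  proof -
    have "u2 - c * u1 = (u2 / u1 - c) * u1" using False by (simp add: field_simps)
    then have "vabs (u2 - c * u1) = vabs (u2 / u1 - c) * vabs u1" by (simp only: vabs_mult)
    then show ?thesis using False by (simp add: vabs_mult)
  qed
  finally show ?thesis using False by simp
qed simp

lemma matrix_inv_chart:
  assumes "a \<noteq> (0 :: 'f::nonarch_local_field)"
  obtains p q r s where "matrix_inv (chart a j) = mat2 p q r s"
    "\<And>u1 u2. vabs (r * u1 + s * u2) < vabs (p * u1 + q * u2) \<longleftrightarrow> in_disc a j u1 u2"
proof (cases "(a, j)" rule: chart.cases)
  case (1 a' c)
  show thesis
  proof (rule that[of 1 0 "- c / (a / unif)" "1 / (a / unif)"])
    show "matrix_inv (chart a j) = mat2 1 0 (- c / (a / unif)) (1 / (a / unif))"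
      using 1 assms by (simp add: matrix_inv_lower)
    have "- c / (a / unif) * u1 + 1 / (a / unif) * u2 = (u2 - c * u1) / (a / unif)" for u1 u2
      using assms by (simp add: field_simps)
    then show "vabs (- c / (a / unif) * u1 + 1 / (a / unif) * u2) < vabs (1 * u1 + 0 * u2) \<longleftrightarrow> in_disc a j u1 u2" for u1 u2
      using vabs_disc_iff[OF assms, of u2 c u1] 1 by simp
  qed
next
  case (2 a' c)
  have nz: "c * 0 - a / unif * 1 \<noteq> 0" using assms by simp
  show thesis
  proof (rule that[of 0 1 "1 / (a / unif)" "- c / (a / unif)"])
    show "matrix_inv (chart a j) = mat2 0 1 (1 / (a / unif)) (- c / (a / unif))"
      using 2 assms matrix_inv_mat2[OF nz] by (simp add: field_simps)
    have "1 / (a / unif) * u1 + - c / (a / unif) * u2 = (u1 - c * u2) / (a / unif)" for u1 u2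
      using assms by (simp add: field_simps)
    then show "vabs (1 / (a / unif) * u1 + - c / (a / unif) * u2) < vabs (0 * u1 + 1 * u2) \<longleftrightarrow> in_disc a j u1 u2" for u1 u2
      using vabs_disc_iff[OF assms, of u1 c u2] 2 by simp
  qed
qed

text \<open>The second argument is an inverse transpose since \<open>act\<close> multiplies the row
  \<open>(w1, w2)\<close> from the right; on the row written as a column this is multiplication by
  the inverse of \<open>chart a k\<close>.\<close>

lemma ind_corner_chart:
  assumes "a \<noteq> (0 :: 'f::nonarch_local_field)"
  shows "act (chart a j) (transpose (matrix_inv (chart a k))) (ind_corner b) (outer u1 u2 w1 w2) =
    of_bool (in_disc a j u1 u2) * of_bool (in_disc a k w1 w2)"
proof -
  obtain p q r s where 1: "matrix_inv (chart a j) = mat2 p q r s"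
      "\<And>u1 u2. vabs (r * u1 + s * u2) < vabs (p * u1 + q * u2) \<longleftrightarrow> in_disc a j u1 u2"
    by (rule matrix_inv_chart[OF assms]) (rule that)
  obtain p' q' r' s' where 2: "matrix_inv (chart a k) = mat2 p' q' r' s'"
      "\<And>u1 u2. vabs (r' * u1 + s' * u2) < vabs (p' * u1 + q' * u2) \<longleftrightarrow> in_disc a k u1 u2"
    by (rule matrix_inv_chart[OF assms]) (rule that)
  show ?thesis
    using 1(2)[of u1 u2] 2(2)[of w1 w2]
    by (simp add: act_def 1(1) 2(1) mat2_mult_outer outer_mult_mat2 ind_corner_outer mult.commute)
qed

lemma in_disc_scale:
  assumes "in_disc a j u1 u2" "vabs (snd j) \<le> 1" "vabs a < 1"
  obtains s x1 x2 where "s \<noteq> 0" "u1 = s * x1" "u2 = s * x2" "vabs x1 \<le> 1" "vabs x2 \<le> 1"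
    "vabs (x1 - fst (centre j)) \<le> vabs a" "vabs (x2 - snd (centre j)) \<le> vabs a"
proof (cases "(a, j, u1, u2)" rule: in_disc.cases)
  case (1 a' c v1 v2)
  have "vabs ((u2 / u1 - c) + c) \<le> 1" using assms 1 by (intro vabs_add_le) auto
  then show thesis using that[of u1 1 "u2 / u1"] assms 1 by simp
next
  case (2 a' c v1 v2)
  have "vabs ((u1 / u2 - c) + c) \<le> 1" using assms 2 by (intro vabs_add_le) auto
  then show thesis using that[of u2 "u1 / u2" 1] assms 2 by simp
qed

definition centre_matrix :: "bool \<times> 'f::nonarch_local_field \<Rightarrow> bool \<times> 'f \<Rightarrow> 'f ^ 2 ^ 2" where
  "centre_matrix j k = outer (fst (centre j)) (snd (centre j)) (fst (centre k)) (snd (centre k))"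

lemma centre_le_1:
  assumes "vabs (snd j) \<le> 1"
  shows "vabs (fst (centre j)) \<le> 1" "vabs (snd (centre j)) \<le> 1"
    "vabs (fst (centre j)) = 1 \<or> vabs (snd (centre j)) = 1"
  using assms by (cases j rule: centre.cases; simp)+

lemma mnorm_centre_matrix:
  assumes "vabs (snd j) \<le> 1" "vabs (snd k) \<le> 1"
  shows "mnorm (centre_matrix j k) = 1"
proof (rule antisym)
  note 1 = centre_le_1[OF assms(1)] and 2 = centre_le_1[OF assms(2)]
  show "mnorm (centre_matrix j k) \<le> 1"
    using 1 2 by (auto simp: centre_matrix_def outer_def mnorm_mat2 vabs_mult intro!: mult_le_one)
  show "1 \<le> mnorm (centre_matrix j k)"
    using 1(3) 2(3) by (auto simp: centre_matrix_def outer_def mnorm_mat2 vabs_mult le_max_iff_disj)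
qed

text \<open>After scaling of both vectors, a point of the two discs lies within
  \<open>vabs a\<close> of the primitive matrix \<open>centre_matrix j k\<close>, and
  \<open>a\<close> is a level of \<open>F\<close>.\<close>

lemma disc_const:
  assumes F: "F \<in> lcf" "has_level a F"
    and u: "in_disc a j u1 u2" "vabs (snd j) \<le> 1" and w: "in_disc a k w1 w2" "vabs (snd k) \<le> 1"
  shows "F (outer u1 u2 w1 w2) = F (centre_matrix j k)"
proof -
  have a: "vabs a < 1" using F(2) by (simp add: has_level_def)
  obtain s x1 x2 where x: "s \<noteq> 0" "u1 = s * x1" "u2 = s * x2" "vabs x1 \<le> 1" "vabs x2 \<le> 1"
    "vabs (x1 - fst (centre j)) \<le> vabs a" "vabs (x2 - snd (centre j)) \<le> vabs a"
    by (rule in_disc_scale[OF u a])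
  obtain t y1 y2 where y: "t \<noteq> 0" "w1 = t * y1" "w2 = t * y2" "vabs y1 \<le> 1" "vabs y2 \<le> 1"
    "vabs (y1 - fst (centre k)) \<le> vabs a" "vabs (y2 - snd (centre k)) \<le> vabs a"
    by (rule in_disc_scale[OF w a])
  note k = centre_le_1[OF w(2)]
  have "mnorm (outer x1 x2 y1 y2 - centre_matrix j k) \<le> vabs a"
    using x y k by (auto simp: centre_matrix_def outer_def mat2_diff mnorm_mat2 intro!: vabs_prod_diff_le)
  then have "F (outer x1 x2 y1 y2) = F (centre_matrix j k)"
    using F(2) mnorm_centre_matrix[OF u(2) w(2)] unfolding has_level_def by blast
  moreover have "F (outer u1 u2 w1 w2) = F (outer x1 x2 y1 y2)"
    unfolding x(2,3) y(2,3) by (rule outer_scale[OF F(1) x(1) y(1)])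
  ultimately show ?thesis by simp
qed

lemma sum_of_bool_ex1:
  assumes "finite J" "\<exists>!j. j \<in> J \<and> P j"
  shows "(\<Sum>j\<in>J. of_bool (P j)) = (1 :: complex)"
proof -
  obtain j where j: "j \<in> J" "P j" "\<And>i. i \<in> J \<Longrightarrow> P i \<Longrightarrow> i = j" using assms(2) by blast
  then have "P i \<longleftrightarrow> i = j" if "i \<in> J" for i using that by metis
  then have "(\<Sum>i\<in>J. of_bool (P i)) = (\<Sum>i\<in>J. if i = j then 1 else (0 :: complex))"
    by (intro sum.cong refl) simp
  then show ?thesis using assms(1) j(1) by simp
qed

context gl2_rep
begin

text \<open>For a level \<open>a\<close> of \<open>F\<close>, the products of two discs of radius
  \<open>vabs a\<close> partition the boundary; \<open>F\<close> is constant on each, and each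
  indicator is the restriction of a translate of \<open>Z\<close>.\<close>

lemma kills_Z_imp_0:
  assumes T: "intertwiner T" and kills: "\<And>F. F \<in> lcf0 \<Longrightarrow> T F = 0" and Z: "T Z = 0"
    and F: "F \<in> lcf"
  shows "T F = 0"
proof -
  obtain a where a: "has_level a F" using level_ex[OF F] by blast
  then have a': "a \<noteq> 0" "vabs a < 1" by (simp_all add: has_level_def)
  obtain R :: "'f set" where R: "finite R" "\<And>r. r \<in> R \<Longrightarrow> vabs r \<le> 1"
      "\<And>x :: 'f. vabs x \<le> 1 \<Longrightarrow> \<exists>!r\<in>R. vabs (x - r) \<le> vabs a"
    by (rule residues_ex[of a]) (use a' in auto)
  define J where "J = disc_index R"
  have J: "finite J" "\<And>j. j \<in> J \<Longrightarrow> vabs (snd j) \<le> 1"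
    using R(1,2) by (auto simp: J_def disc_index_def)
  define A where "A = (\<lambda>(j, k). act (chart a j) (transpose (matrix_inv (chart a k))) Z)"
  have inv: "invertible (chart a j)" "invertible (transpose (matrix_inv (chart a j)))" for j
    using invertible_chart[OF a'(1), of j] by (simp_all only: inv_transpose(1))
  have A: "A p \<in> lcf" for p
    by (cases p) (auto simp: A_def intro!: lcf_act Z_lcf inv)
  define G where "G = (\<lambda>x. \<Sum>p\<in>J \<times> J. F (centre_matrix (fst p) (snd p)) * A p x)"
  have G: "G \<in> lcf" unfolding G_def by (rule invariant_space_sum[OF invariant_space_lcf_self A])
  have "T F = T G"
  proof (rule kills_boundary_eq[OF T kills F G])
    fix u1 u2 w1 w2 :: 'f assume u: "u1 \<noteq> 0 \<or> u2 \<noteq> 0" and w: "w1 \<noteq> 0 \<or> w2 \<noteq> 0"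
    have "G (outer u1 u2 w1 w2) =
        (\<Sum>p\<in>J \<times> J. F (outer u1 u2 w1 w2) * (of_bool (in_disc a (fst p) u1 u2) * of_bool (in_disc a (snd p) w1 w2)))"
      unfolding G_def
    proof (rule sum.cong[OF refl])
      fix p assume p: "p \<in> J \<times> J"
      show "F (centre_matrix (fst p) (snd p)) * A p (outer u1 u2 w1 w2) = F (outer u1 u2 w1 w2) *
          (of_bool (in_disc a (fst p) u1 u2) * of_bool (in_disc a (snd p) w1 w2))"
        using p disc_const[OF F a, of "fst p" u1 u2 "snd p" w1 w2] J(2)
        by (cases p) (auto simp: A_def ind_corner_chart[OF a'(1)])
    qed
    also have "\<dots> = F (outer u1 u2 w1 w2) *
        ((\<Sum>j\<in>J. of_bool (in_disc a j u1 u2)) * (\<Sum>k\<in>J. of_bool (in_disc a k w1 w2)))"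
    proof -
      have "(\<Sum>p\<in>J \<times> J. P (fst p) * Q (snd p)) = sum P J * sum Q J" for P Q :: "bool \<times> 'f \<Rightarrow> complex"
        by (simp only: sum_product sum.cartesian_product case_prod_unfold)
      from this[of "\<lambda>j. of_bool (in_disc a j u1 u2)" "\<lambda>k. of_bool (in_disc a k w1 w2)"]
      show ?thesis by (simp only: sum_distrib_left[symmetric])
    qed
    also have "\<dots> = F (outer u1 u2 w1 w2)"
      using sum_of_bool_ex1[OF J(1) disc_unique[OF a' R(2,3) u, folded J_def]]
        sum_of_bool_ex1[OF J(1) disc_unique[OF a' R(2,3) w, folded J_def]] by simp
    finally show "F (outer u1 u2 w1 w2) = G (outer u1 u2 w1 w2)" by simp
  qed
  also have "T G = (\<Sum>p\<in>J \<times> J. smul (F (centre_matrix (fst p) (snd p))) (T (A p)))"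
    unfolding G_def by (rule intertwiner_sum[OF T A])
  also have "\<dots> = 0"
  proof (rule sum.neutral, rule ballI)
    fix p
    have "T (A p) = 0"
      by (cases p) (simp add: A_def intertwiner_act[OF T Z_lcf inv] Z rho_0 inv)
    then show "smul (F (centre_matrix (fst p) (snd p))) (T (A p)) = 0" by simp
  qed
  finally show ?thesis .
qed

section \<open>Vectors fixed by the Iwahori subgroup and its transpose\<close>

definition iwahori_fixed :: "'v set" where
  "iwahori_fixed = {v. \<forall>g\<in>iwahori. \<forall>h\<in>transpose ` iwahori. \<rho> g h v = v}"

lemma compact_subgroup_iwahori:
  "compact_subgroup (iwahori :: ('f ^ 2 ^ 2) set)" "compact_subgroup (transpose ` iwahori :: ('f ^ 2 ^ 2) set)"
    "compact_subgroup {mat 1 :: 'f ^ 2 ^ 2}"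
proof -
  interpret t: compact_open_subgroup "transpose ` iwahori :: ('f ^ 2 ^ 2) set" 1
    by (rule compact_open_subgroup_transpose[OF compact_open_iwahori])
  show "compact_subgroup (iwahori :: ('f ^ 2 ^ 2) set)" "compact_subgroup (transpose ` iwahori :: ('f ^ 2 ^ 2) set)"
    "compact_subgroup {mat 1 :: 'f ^ 2 ^ 2}"
    unfolding compact_subgroup_def
    using iwahori.gl2o iwahori.one iwahori.mult iwahori.minv t.gl2o t.one t.mult t.minv by auto
qed

lemma act_iwahori_Z:
  assumes "g \<in> iwahori" "h \<in> transpose ` iwahori"
  shows "act g h Z = Z"
  using iwahori_mult_corner[OF iwahori.minv[OF assms(1)] vabs_unif_less_1]
    corner_mult_iwahori[OF assms(2) vabs_unif_less_1]
  by (simp add: act_def fun_eq_iff)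

lemma intertwiner_Z_fixed:
  assumes T: "intertwiner T"
  shows "T Z \<in> iwahori_fixed"
  unfolding iwahori_fixed_def
proof (intro CollectI ballI)
  fix g h :: "'f ^ 2 ^ 2" assume gh: "g \<in> iwahori" "h \<in> transpose ` iwahori"
  have "invertible g" "invertible h"
    using gh iwahori.invertible_H by (auto simp: invertible_transpose2)
  from intertwiner_act[OF T Z_lcf this] show "\<rho> g h (T Z) = T Z"
    by (simp only: act_iwahori_Z[OF gh])
qed

text \<open>On rank one matrices, an Iwahori-fixed function is a combination of four translates of \<open>Z\<close>.\<close>

lemma iwahori_fixed_line:
  assumes T: "intertwiner T" and kills: "\<And>F. F \<in> lcf0 \<Longrightarrow> T F = 0" and nz: "T Z \<noteq> 0"
    and m: "m \<in> iwahori_fixed"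
  obtains c where "m = smul c (T Z)"
proof -
  obtain f1 where f1: "f1 \<in> lcf" "T f1 = m"
    by (rule intertwiner_surj[OF T invariant_space_lcf_self Z_lcf nz])
  have "\<rho> g h (T f1) = T f1" if "g \<in> iwahori" "h \<in> transpose ` iwahori" for g h
    using m that unfolding f1(2) iwahori_fixed_def by blast
  then obtain f where f: "f \<in> lcf" "T f = T f1"
      "\<And>g h. g \<in> iwahori \<Longrightarrow> h \<in> transpose ` iwahori \<Longrightarrow> act g h f = f"
    using intertwiner_average[OF T invariant_space_lcf_self f1(1) compact_subgroup_iwahori(1,2)] by metis
  have left: "f (k ** x) = f x" if "k \<in> iwahori" for k x
  proof -
    have "act (matrix_inv k) (mat 1) f x = f x"
      using f(3)[OF iwahori.minv[OF that], of "mat 1"] compact_subgroup_iwahori(2)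
      by (simp add: compact_subgroup_def)
    then show ?thesis using iwahori.invertible_H[OF that] by (simp add: act_def matrix_inv_inv)
  qed
  have right: "f (x ** k) = f x" if "k \<in> transpose ` iwahori" for k x
  proof -
    have "act (mat 1) k f x = f x" using f(3)[OF iwahori.one that] by simp
    then show ?thesis by (simp add: act_def)
  qed
  \<comment> \<open>The Iwahori subgroup has two orbits on a projective line, the disc and its
    complement, represented by \<open>(1, 0)\<close> and \<open>(0, 1)\<close>; \<open>E\<close>
    lists the four products. Unipotent matrices \<open>k\<close> below move a point to its
    representative.\<close>
  define E where "E b c = (outer (of_bool b) (of_bool (\<not> b)) (of_bool c) (of_bool (\<not> c)) :: 'f ^ 2 ^ 2)" for b c
  have left': "f (outer u1 u2 w1 w2) = f (outer (of_bool (vabs u2 < vabs u1)) (of_bool (\<not> vabs u2 < vabs u1)) w1 w2)"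
    if u: "u1 \<noteq> 0 \<or> u2 \<noteq> 0" for u1 u2 w1 w2
  proof (cases "vabs u2 < vabs u1")
    case True
    then have u1: "u1 \<noteq> 0" by auto
    have k: "mat2 1 0 (u2 / u1) 1 \<in> iwahori" using True u1 by (simp add: iwahori_mat2 vabs_divide)
    have "f (outer u1 u2 w1 w2) = f (outer (u1 * 1) (u1 * (u2 / u1)) (1 * w1) (1 * w2))" using u1 by simp
    also have "\<dots> = f (outer 1 (u2 / u1) w1 w2)" by (rule outer_scale[OF f(1) u1]) simp
    also have "\<dots> = f (outer 1 0 w1 w2)" using left[OF k, of "outer 1 0 w1 w2"] by (simp add: mat2_mult_outer)
    finally show ?thesis using True by simp
  next
    case False
    have u2: "u2 \<noteq> 0"
    proof
      assume "u2 = 0"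
      then show False using False u by simp
    qed
    have k: "mat2 1 (u1 / u2) 0 1 \<in> iwahori" using False u2 by (simp add: iwahori_mat2 vabs_divide)
    have "f (outer u1 u2 w1 w2) = f (outer (u2 * (u1 / u2)) (u2 * 1) (1 * w1) (1 * w2))" using u2 by simp
    also have "\<dots> = f (outer (u1 / u2) 1 w1 w2)" by (rule outer_scale[OF f(1) u2]) simp
    also have "\<dots> = f (outer 0 1 w1 w2)" using left[OF k, of "outer 0 1 w1 w2"] by (simp add: mat2_mult_outer)
    finally show ?thesis using False by simp
  qed
  have right': "f (outer u1 u2 w1 w2) = f (outer u1 u2 (of_bool (vabs w2 < vabs w1)) (of_bool (\<not> vabs w2 < vabs w1)))"
    if w: "w1 \<noteq> 0 \<or> w2 \<noteq> 0" for u1 u2 w1 w2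
  proof (cases "vabs w2 < vabs w1")
    case True
    then have w1: "w1 \<noteq> 0" by auto
    have "mat2 1 0 (w2 / w1) 1 \<in> iwahori" using True w1 by (simp add: iwahori_mat2 vabs_divide)
    from imageI[OF this, of transpose] have k: "mat2 1 (w2 / w1) 0 1 \<in> transpose ` iwahori" by simp
    have "f (outer u1 u2 w1 w2) = f (outer (1 * u1) (1 * u2) (w1 * 1) (w1 * (w2 / w1)))" using w1 by simp
    also have "\<dots> = f (outer u1 u2 1 (w2 / w1))" by (rule outer_scale[OF f(1) _ w1]) simp
    also have "\<dots> = f (outer u1 u2 1 0)" using right[OF k, of "outer u1 u2 1 0"] by (simp add: outer_mult_mat2)
    finally show ?thesis using True by simp
  next
    case False
    have w2: "w2 \<noteq> 0"
    proof
      assume "w2 = 0"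
      then show False using False w by simp
    qed
    have "mat2 1 (w1 / w2) 0 1 \<in> iwahori" using False w2 by (simp add: iwahori_mat2 vabs_divide)
    from imageI[OF this, of transpose] have k: "mat2 1 0 (w1 / w2) 1 \<in> transpose ` iwahori" by simp
    have "f (outer u1 u2 w1 w2) = f (outer (1 * u1) (1 * u2) (w2 * (w1 / w2)) (w2 * 1))" using w2 by simp
    also have "\<dots> = f (outer u1 u2 (w1 / w2) 1)" by (rule outer_scale[OF f(1) _ w2]) simp
    also have "\<dots> = f (outer u1 u2 0 1)" using right[OF k, of "outer u1 u2 0 1"] by (simp add: outer_mult_mat2)
    finally show ?thesis using False by simp
  qed
  have f_outer: "f (outer u1 u2 w1 w2) = f (E (vabs u2 < vabs u1) (vabs w2 < vabs w1))"
    if "u1 \<noteq> 0 \<or> u2 \<noteq> 0" "w1 \<noteq> 0 \<or> w2 \<noteq> 0" for u1 u2 w1 w2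
    unfolding E_def using left'[OF that(1)] right'[OF that(2)] by simp
  let ?W = "mat2 0 1 unif (0 :: 'f)" and ?W' = "mat2 0 1 (1 / unif) (0 :: 'f)"
  have W: "invertible ?W" "invertible ?W'" by (rule invertible_swap; simp)+
  \<comment> \<open>The translates of \<open>Z\<close> whose restrictions to rank one matrices are
    the indicators of the four products of orbits.\<close>
  define A where "A b c = act (if b then mat 1 else ?W) (if c then mat 1 else ?W') Z" for b c
  have A_lcf: "A b c \<in> lcf" for b c unfolding A_def by (intro lcf_act Z_lcf) (auto simp: W)
  have A_outer: "A b c (outer u1 u2 w1 w2) =
      of_bool ((vabs u2 < vabs u1) = b) * of_bool ((vabs w2 < vabs w1) = c)"
    if u: "u1 \<noteq> 0 \<or> u2 \<noteq> 0" and w: "w1 \<noteq> 0 \<or> w2 \<noteq> 0" for b c u1 u2 w1 w2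
    using vabs_swap_iff[OF u] vabs_swap_iff[OF w]
    by (simp add: A_def act_def matrix_inv_swap mat2_mult_outer outer_mult_mat2 ind_corner_outer)
  define G where "G = (\<lambda>x. \<Sum>p\<in>UNIV. f (E (fst p) (snd p)) * A (fst p) (snd p) x)"
  have G: "G \<in> lcf" unfolding G_def by (rule invariant_space_sum[OF invariant_space_lcf_self A_lcf])
  have univ: "(UNIV :: (bool \<times> bool) set) = {(True, True), (True, False), (False, True), (False, False)}"
    by auto
  have "T f = T G"
  proof (rule kills_boundary_eq[OF T kills f(1) G])
    fix u1 u2 w1 w2 :: 'f assume uw: "u1 \<noteq> 0 \<or> u2 \<noteq> 0" "w1 \<noteq> 0 \<or> w2 \<noteq> 0"
    show "f (outer u1 u2 w1 w2) = G (outer u1 u2 w1 w2)"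
      unfolding f_outer[OF uw] by (simp add: G_def A_outer[OF uw] univ)
  qed
  also have "T G = (\<Sum>p\<in>UNIV. smul (f (E (fst p) (snd p))) (T (A (fst p) (snd p))))"
    unfolding G_def by (rule intertwiner_sum[OF T A_lcf])
  \<comment> \<open>Each exchange of a disc with its complement contributes a factor -1; exchanging
    in both factors gives 1.\<close>
  also have "\<dots> = (\<Sum>p\<in>UNIV. smul (f (E (fst p) (snd p))) (smul (if fst p = snd p then 1 else -1) (T Z)))"
  proof (rule sum.cong[OF refl], rule arg_cong[of _ _ "smul _"])
    fix p :: "bool \<times> bool"
    have 10: "T (act ?W (mat 1) Z) = - T Z" by (rule kills_swap_left[OF T kills nz])
    have 01: "T (act (mat 1) ?W' Z) = - T Z" by (rule kills_swap_right[OF T kills nz])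
    have "act ?W ?W' Z = act ?W (mat 1) (act (mat 1) ?W' Z)"
      using act_act[OF W(1) invertible_mat_1, of "mat 1" ?W' Z] by simp
    then have "T (act ?W ?W' Z) = \<rho> ?W (mat 1) (- T Z)"
      using intertwiner_act[OF T lcf_act[OF Z_lcf invertible_mat_1 W(2)] W(1) invertible_mat_1] 01 by simp
    also have "\<dots> = - T (act ?W (mat 1) Z)"
      using rho_smul[OF W(1) invertible_mat_1, of "-1" "T Z"] intertwiner_act[OF T Z_lcf W(1) invertible_mat_1]
      by simp
    finally have 11: "T (act ?W ?W' Z) = T Z" using 10 by simp
    show "T (A (fst p) (snd p)) = smul (if fst p = snd p then 1 else -1) (T Z)"
      by (cases p; cases "fst p"; cases "snd p") (simp_all add: A_def 10 01 11)
  qed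
  finally have "m = smul (\<Sum>p\<in>UNIV. f (E (fst p) (snd p)) * (if fst p = snd p then 1 else -1)) (T Z)"
    using f(2) f1(2) by (simp only: scale_scale scale_sum_left)
  then show thesis by (rule that)
qed

lemma boundary_multiplicity_one:
  assumes T0: "intertwiner T0" and kills: "\<And>F. F \<in> lcf0 \<Longrightarrow> T0 F = 0" and nz: "F0 \<in> lcf" "T0 F0 \<noteq> 0"
    and T: "intertwiner T"
  obtains c where "\<And>F. F \<in> lcf \<Longrightarrow> T F = smul c (T0 F)"
proof -
  have Z0: "T0 Z \<noteq> 0" using kills_Z_imp_0[OF T0 kills _ nz(1)] nz(2) by blast
  obtain c where c: "T Z = smul c (T0 Z)"
    by (rule iwahori_fixed_line[OF T0 kills Z0 intertwiner_Z_fixed[OF T]])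
  have "T (ind_corner (unif * unif)) = (\<Sum>r\<in>residues. smul c (\<rho> (step r) (mat 1) (T0 Z)))"
    unfolding intertwiner_Z2[OF T] c using rho_smul[OF invertible_step invertible_mat_1] by simp
  also have "\<dots> = smul c (T0 Z)"
    unfolding scale_sum_right[symmetric] intertwiner_Z2[OF T0, symmetric]
    by (simp only: kills_Z2[OF T0 kills])
  finally have Z2: "T (ind_corner (unif * unif)) = T Z" by (simp only: c)
  have diff: "(\<lambda>x. Z x - ind_corner (unif * unif) x) \<in> lcf" by (intro lcf_diff Z_lcf Z2_lcf)
  have d: "invertible (mat2 1 0 0 (unif :: 'f))" by (simp add: invertible_mat2_iff)
  have "iwahori.ind = act (mat 1) (mat2 1 0 0 unif) (\<lambda>x. Z x - ind_corner (unif * unif) x)"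
    by (rule ext, rule iwahori_ind_eq)
  then have "T iwahori.ind = \<rho> (mat 1) (mat2 1 0 0 unif) (T (\<lambda>x. Z x - ind_corner (unif * unif) x))"
    using intertwiner_act[OF T diff invertible_mat_1 d] by simp
  also have "\<dots> = 0"
    by (simp add: intertwiner_diff[OF T Z_lcf Z2_lcf] Z2 rho_0[OF invertible_mat_1 d])
  finally have Tind: "T iwahori.ind = 0" .
  have Tkills: "T F = 0" if F: "F \<in> lcf0" for F
  proof (rule ccontr)
    assume TF: "T F \<noteq> 0"
    \<comment> \<open>\<open>T0 Z\<close> serves as a nonzero vector fixed by the Iwahori subgroup
      on the left. An invariant preimage in \<open>lcf0\<close> is a combination of right translates
      of \<open>iwahori.ind\<close>, all of which \<open>T\<close> kills.\<close>
    obtain h1 where h1: "h1 \<in> lcf0" "T h1 = T0 Z"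
      by (rule intertwiner_surj[OF T invariant_space_lcf0 F TF])
    have "\<rho> g h (T h1) = T h1" if "g \<in> iwahori" "h \<in> {mat 1}" for g h
    proof -
      have "mat 1 \<in> transpose ` (iwahori :: ('f ^ 2 ^ 2) set)"
        using compact_subgroup_iwahori(2) by (simp add: compact_subgroup_def)
      then show ?thesis
        using intertwiner_Z_fixed[OF T0] that unfolding h1(2) iwahori_fixed_def by blast
    qed
    then obtain h where h: "h \<in> lcf0" "T h = T h1"
        "\<And>g k. g \<in> iwahori \<Longrightarrow> k \<in> {mat 1} \<Longrightarrow> act g k h = h"
      using intertwiner_average[OF T invariant_space_lcf0 h1(1) compact_subgroup_iwahori(1,3)] by metis
    have inv: "h (k ** x) = h x" if k: "k \<in> iwahori" for k x
    proof -
      have "act (matrix_inv k) (mat 1) h x = h x" using h(3)[OF iwahori.minv[OF k]] by simp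
      then show ?thesis using iwahori.invertible_H[OF k] by (simp add: act_def matrix_inv_inv)
    qed
    obtain R where R: "finite R" "\<And>g. g \<in> R \<Longrightarrow> invertible g"
        "\<And>x. h x = (\<Sum>r\<in>R. h r * iwahori.ind (x ** matrix_inv r))"
      by (rule iwahori.left_decomposition[OF h(1) inv]) (assumption, rule that)
    have ind: "iwahori.ind \<in> (lcf :: ('f ^ 2 ^ 2 \<Rightarrow> complex) set)" by (rule lcf0_lcf[OF iwahori.ind_lcf0])
    have act: "act (mat 1) (matrix_inv r) iwahori.ind \<in> lcf" if "r \<in> R" for r
      using R(2)[OF that] by (intro lcf_act ind invertible_matrix_inv) auto
    have "h = (\<lambda>x. \<Sum>r\<in>R. h r * act (mat 1) (matrix_inv r) iwahori.ind x)"
      by (rule ext, subst R(3)) (simp add: act_def)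
    then have "T h = (\<Sum>r\<in>R. smul (h r) (T (act (mat 1) (matrix_inv r) iwahori.ind)))"
      using intertwiner_sum[OF T act, of R "\<lambda>r. r" h] by simp
    also have "\<dots> = 0"
      using R(2) by (intro sum.neutral ballI)
        (simp add: intertwiner_act[OF T ind] invertible_matrix_inv Tind rho_0)
    finally show False using h(2) h1(2) Z0 by simp
  qed
  have "T F - smul c (T0 F) = 0" if F: "F \<in> lcf" for F
    by (rule kills_Z_imp_0[OF intertwiner_lincomb[OF T0 T] _ _ F]) (simp_all add: Tkills kills c)
  then show thesis by (intro that[of c]) simp
qed

theorem intertwiner_multiplicity_one:
  assumes T: "intertwiner T" and nz: "F0 \<in> lcf" "T F0 \<noteq> 0" and T': "intertwiner T'"
  obtains c where "\<And>F. F \<in> lcf \<Longrightarrow> T' F = smul c (T F)"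
proof (cases "\<exists>S F. intertwiner S \<and> (\<forall>F\<in>lcf0. S F = 0) \<and> F \<in> lcf \<and> S F \<noteq> 0")
  case True
  then obtain S F1 where S: "intertwiner S" "\<And>F. F \<in> lcf0 \<Longrightarrow> S F = 0" "F1 \<in> lcf" "S F1 \<noteq> 0" by blast
  obtain c where c: "\<And>F. F \<in> lcf \<Longrightarrow> T F = smul c (S F)"
    by (rule boundary_multiplicity_one[OF S T]) (assumption, rule that)
  obtain d where d: "\<And>F. F \<in> lcf \<Longrightarrow> T' F = smul d (S F)"
    by (rule boundary_multiplicity_one[OF S T']) (assumption, rule that)
  \<comment> \<open>Both \<open>T\<close> and \<open>T'\<close> are multiples of the same
    \<open>S\<close>; as \<open>T\<close> is nonzero, its factor can be inverted.\<close>
  have "c \<noteq> 0" using c[OF nz(1)] nz(2) by auto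
  then show thesis using c d by (intro that[of "d / c"]) simp
next
  case False
  then have zero: "S F = 0" if "intertwiner S" "\<And>F. F \<in> lcf0 \<Longrightarrow> S F = 0" "F \<in> lcf" for S F
    using that by blast
  \<comment> \<open>By \<open>zero\<close>, vanishing on \<open>lcf0\<close> would force
    \<open>T\<close> to vanish on \<open>lcf\<close>. The same fact is applied below to the
    difference of \<open>T'\<close> and a multiple of \<open>T\<close>.\<close>
  obtain F1 where F1: "F1 \<in> lcf0" "T F1 \<noteq> 0" using zero[OF T _ nz(1)] nz(2) by blast
  obtain c where c: "\<And>F. F \<in> lcf0 \<Longrightarrow> T' F = smul c (T F)"
    by (rule multiplicity_one_lcf0[OF T T' F1]) (rule that)
  have "T' F - smul c (T F) = 0" if F: "F \<in> lcf" for F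
    by (rule zero[OF intertwiner_lincomb[OF T T'] _ F]) (simp add: c)
  then show thesis by (intro that[of c]) simp
qed

end

section \<open>Descent to the projective space\<close>

lemma proj_class_self: "x \<in> proj_class x"
  unfolding proj_class_def by (rule CollectI, rule exI[of _ 1]) simp

lemma proj_class_scale: "c \<noteq> 0 \<Longrightarrow> proj_class (mat c ** x) = proj_class (x :: 'f::field ^ 2 ^ 2)"
proof
  assume c: "c \<noteq> 0"
  show "proj_class (mat c ** x) \<subseteq> proj_class x"
    unfolding proj_class_def using c by (auto simp: matrix_mul_assoc mat_mult_mat)
  show "proj_class x \<subseteq> proj_class (mat c ** x)"
  proof
    fix y assume "y \<in> proj_class x"
    then obtain d where d: "d \<noteq> 0" "y = mat d ** x" unfolding proj_class_def by blast
    then have "y = mat (d / c) ** (mat c ** x)" "d / c \<noteq> 0"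
      using c by (simp_all add: matrix_mul_assoc mat_mult_mat)
    then show "y \<in> proj_class (mat c ** x)" unfolding proj_class_def by blast
  qed
qed

lemma proj_class_eqD:
  assumes "proj_class x = proj_class y"
  obtains c where "c \<noteq> 0" "x = mat c ** (y :: 'f::field ^ 2 ^ 2)"
proof -
  have "x \<in> proj_class y" using proj_class_self[of x] assms by simp
  then show thesis using that unfolding proj_class_def by blast
qed

lemma proj_class_mult:
  assumes "invertible g" "invertible (h :: 'f::field ^ 2 ^ 2)"
  shows "proj_class (g ** h) = proj_class g \<otimes>\<^bsub>PGL2\<^esub> proj_class h"
proof -
  have coset: "proj_class x = scalars2 #>\<^bsub>GL2\<^esub> x" for x :: "'f ^ 2 ^ 2"
    by (auto simp: r_coset_def GL2_def scalars2_def proj_class_def)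
  show ?thesis
    using normal.rcos_sum[OF normal_scalars2, of g h] assms
    by (simp add: PGL2_def FactGroup_def coset) (simp add: GL2_def)
qed

lemma proj_class_one: "\<one>\<^bsub>PGL2\<^esub> = proj_class (mat 1 :: 'f::field ^ 2 ^ 2)"
  by (auto simp: PGL2_def FactGroup_def scalars2_def proj_class_def)

lemma proj_class_in_carrier: "invertible g \<Longrightarrow> proj_class g \<in> carrier PGL2"
  by (simp add: carrier_PGL2)

lemma proj_class_inv:
  assumes "invertible (g :: 'f::field ^ 2 ^ 2)"
  shows "inv\<^bsub>PGL2\<^esub> (proj_class g) = proj_class (matrix_inv g)"
proof (rule group.inv_equality[OF group_PGL2])
  show "proj_class (matrix_inv g) \<otimes>\<^bsub>PGL2\<^esub> proj_class g = \<one>\<^bsub>PGL2\<^esub>"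
    unfolding proj_class_one proj_class_mult[OF invertible_matrix_inv[OF assms] assms, symmetric]
    using assms by (simp add: matrix_inv_laws)
qed (use assms invertible_matrix_inv in \<open>auto intro: proj_class_in_carrier\<close>)

text \<open>The preimage in GL_2 is \<open>scaled\<close>, which is open because its indicator
  \<open>ind\<close> is locally constant away from 0.\<close>

lemma openin_PGL2_top:
  assumes "compact_open_subgroup H e"
  shows "openin PGL2_top (proj_class ` H)"
proof -
  interpret compact_open_subgroup H e by (rule assms)
  have "{x. invertible x \<and> proj_class x \<in> proj_class ` H} = scaled"
  proof (intro equalityI subsetI CollectI conjI)
    fix x assume "x \<in> {x. invertible x \<and> proj_class x \<in> proj_class ` H}"
    then obtain k where k: "k \<in> H" "proj_class x = proj_class k" by blast
    from proj_class_eqD[OF k(2)] show "x \<in> scaled" using scaledI k(1) by metis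
  next
    fix x assume x: "x \<in> scaled"
    show "invertible x" by (rule scaled_invertible[OF x])
    obtain c k where "c \<noteq> 0" "k \<in> H" "x = mat c ** k" using x unfolding scaled_def by blast
    then show "proj_class x \<in> proj_class ` H" by (simp add: proj_class_scale)
  qed
  moreover have "open scaled"
    unfolding open_iff_mnorm
  proof
    fix x assume x: "x \<in> scaled"
    have "x \<noteq> 0"
    proof
      assume "x = 0"
      then show False using lcf_0[OF lcf0_lcf[OF ind_lcf0]] x by (simp add: ind_def)
    qed
    from lcf_loc[OF lcf0_lcf[OF ind_lcf0] this]
    obtain d where d: "d > 0" "\<And>y. mnorm (y - x) < d \<Longrightarrow> ind y = ind x" by blast
    have "y \<in> scaled" if "mnorm (y - x) < d" for y
      using d(2)[OF that] x by (simp add: ind_def)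
    then show "\<exists>e>0. \<forall>y. mnorm (y - x) < e \<longrightarrow> y \<in> scaled" using d(1) by blast
  qed
  moreover have "scaled \<subseteq> {g. invertible g}" using scaled_invertible by blast
  ultimately show ?thesis
    unfolding PGL2_top_def openin_quotient_topology
    using invertible_H by (auto intro!: open_subset)
qed

lemma compact_cong_subgroup:
  assumes "a \<noteq> 0" "vabs a < 1"
  shows "compact (cong_subgroup (a :: 'f::nonarch_local_field))"
proof -
  have "open {y :: 'f ^ 2 ^ 2. y \<notin> cong_subgroup a}"
    unfolding open_iff_mnorm
  proof
    fix x :: "'f ^ 2 ^ 2" assume x: "x \<in> {y. y \<notin> cong_subgroup a}"
    have "y \<notin> cong_subgroup a" if "mnorm (y - x) < vabs a" for y
      using x that mnorm_add_le[of "x - y" "vabs a" "y - mat 1"]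
      by (auto simp: cong_subgroup_def mnorm_diff_commute)
    then show "\<exists>e>0. \<forall>y. mnorm (y - x) < e \<longrightarrow> y \<in> {y. y \<notin> cong_subgroup a}"
      using assms(1) by (intro exI[of _ "vabs a"]) simp
  qed
  from compact_diff[OF compact_mnorm_le_1 this]
  show ?thesis
    by (rule back_subst[of compact]) (use cong_subgroup_gl2o[OF assms(2)] in \<open>auto simp: gl2o_def\<close>)
qed

lemma compactin_PGL2_top:
  assumes "compact H" "H \<subseteq> {g. invertible g}"
  shows "compactin PGL2_top (proj_class ` H)"
proof (rule image_compactin)
  show "compactin (top_of_set {g. invertible g}) H"
    using assms by (simp add: compactin_subtopology)
  show "continuous_map (top_of_set {g. invertible g}) PGL2_top proj_class"
    unfolding PGL2_top_def by (rule quotient_imp_continuous_map[OF quotient_map_quotient_topology])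
qed

lemma subgroup_proj_class:
  assumes "compact_open_subgroup H e"
  shows "subgroup (proj_class ` H) PGL2"
proof -
  interpret compact_open_subgroup H e by (rule assms)
  show ?thesis
  proof (rule group.subgroupI[OF group_PGL2])
    show "proj_class ` H \<subseteq> carrier PGL2" using proj_class_in_carrier invertible_H by blast
    show "proj_class ` H \<noteq> {}" using one by blast
    show "inv\<^bsub>PGL2\<^esub> x \<in> proj_class ` H" if "x \<in> proj_class ` H" for x
      using that minv by (auto simp: proj_class_inv invertible_H)
    show "x \<otimes>\<^bsub>PGL2\<^esub> y \<in> proj_class ` H" if "x \<in> proj_class ` H" "y \<in> proj_class ` H" for x y
      using that mult by (auto simp: invertible_H simp flip: proj_class_mult)
  qed
qed

text \<open>The image of a congruence subgroup in PGL_2 is a compact open subgroup, and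
  admissibility is applied to the product of two copies of it.\<close>

lemma gl2_rep_of_PGL2_rep:
  fixes smul :: "complex \<Rightarrow> 'v::ab_group_add \<Rightarrow> 'v"
    and \<pi> :: "('f::nonarch_local_field ^ 2 ^ 2) set \<times> ('f ^ 2 ^ 2) set \<Rightarrow> 'v \<Rightarrow> 'v"
  assumes irr: "irreducible_rep (PGL2 \<times>\<times> PGL2) smul \<pi>"
    and adm: "admissible_rep (PGL2 \<times>\<times> PGL2) (prod_topology PGL2_top PGL2_top) smul \<pi>"
  shows "gl2_rep smul (\<lambda>g h. \<pi> (proj_class g, proj_class h))"
proof -
  have rep: "group_rep (PGL2 \<times>\<times> PGL2) smul \<pi>" using irr by (simp add: irreducible_rep_def)
  have vs: "vector_space smul" using rep by (simp add: group_rep_def)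
  have carr: "(proj_class g, proj_class h) \<in> carrier (PGL2 \<times>\<times> PGL2)"
    if "invertible g" "invertible h" for g h :: "'f ^ 2 ^ 2"
    using that by (simp add: proj_class_in_carrier)
  show ?thesis
  proof (intro gl2_rep.intro gl2_rep_axioms.intro vs)
    fix g h g' h' :: "'f ^ 2 ^ 2" and v
    assume gh: "invertible g" "invertible h"
    show "Vector_Spaces.linear smul smul (\<pi> (proj_class g, proj_class h))"
      using rep carr[OF gh] by (simp add: group_rep_def)
    assume gh': "invertible g'" "invertible h'"
    have "\<pi> ((proj_class g, proj_class h) \<otimes>\<^bsub>PGL2 \<times>\<times> PGL2\<^esub> (proj_class g', proj_class h')) =
        \<pi> (proj_class g, proj_class h) \<circ> \<pi> (proj_class g', proj_class h')"
      using rep carr[OF gh] carr[OF gh'] unfolding group_rep_def by blast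
    then show "\<pi> (proj_class (g ** g'), proj_class (h ** h')) v =
        \<pi> (proj_class g, proj_class h) (\<pi> (proj_class g', proj_class h') v)"
      using gh gh' by (simp add: proj_class_mult)
  next
    fix v
    have "\<pi> \<one>\<^bsub>PGL2 \<times>\<times> PGL2\<^esub> = id" using rep by (simp add: group_rep_def)
    then show "\<pi> (proj_class (mat 1), proj_class (mat 1)) v = v"
      by (simp add: one_DirProd proj_class_one)
  next
    fix W assume W: "module.subspace smul W"
      "\<And>(g :: 'f ^ 2 ^ 2) (h :: 'f ^ 2 ^ 2) w. invertible g \<Longrightarrow> invertible h \<Longrightarrow> w \<in> W \<Longrightarrow>
        \<pi> (proj_class g, proj_class h) w \<in> W"
    have "\<pi> p ` W \<subseteq> W" if "p \<in> carrier (PGL2 \<times>\<times> PGL2)" for p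
      using that W(2) by (auto simp: carrier_PGL2)
    then show "W = {0} \<or> W = UNIV" using irr W(1) unfolding irreducible_rep_def by blast
  next
    fix a :: 'f assume a: "a \<noteq> 0" "vabs a < 1"
    note H = compact_open_cong_subgroup[OF a]
    interpret K: compact_open_subgroup "cong_subgroup a" "vabs a" by (rule H)
    let ?K = "(proj_class ` cong_subgroup a) \<times> (proj_class ` cong_subgroup a)"
    have "subgroup ?K (PGL2 \<times>\<times> PGL2)"
      using DirProd_subgroups[OF group_PGL2 subgroup_proj_class[OF H] group_PGL2 subgroup_proj_class[OF H]] .
    moreover have "openin (prod_topology PGL2_top PGL2_top) ?K"
      using openin_PGL2_top[OF H] by (simp add: openin_prod_Times_iff)
    moreover have "compactin (prod_topology PGL2_top PGL2_top) ?K"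
      using compactin_PGL2_top[OF compact_cong_subgroup[OF a]] K.invertible_H
      by (auto simp: compactin_Times)
    ultimately have "finite_dim smul {v. \<forall>k\<in>?K. \<pi> k v = v}"
      using adm unfolding admissible_rep_def by blast
    then show "finite_dim smul {v. \<forall>g\<in>cong_subgroup a. \<forall>h\<in>cong_subgroup a. \<pi> (proj_class g, proj_class h) v = v}"
      by simp
  qed
qed

section \<open>Functions on the projective space as homogeneous functions on matrices\<close>

lemma topspace_Pgl2_top: "topspace (Pgl2_top :: ('f::{field,topological_space} ^ 2 ^ 2) set topology) = proj_class ` {x. x \<noteq> 0}"
  by (simp add: Pgl2_top_def topspace_quotient_topology)

lemma continuous_map_proj_class:
  "continuous_map (top_of_set {x. x \<noteq> 0}) (Pgl2_top :: ('f::{field,topological_space} ^ 2 ^ 2) set topology) proj_class"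
  unfolding Pgl2_top_def by (rule quotient_imp_continuous_map[OF quotient_map_quotient_topology])

lemma open_nonzero: "open {x :: 'f::nonarch_local_field ^ 2 ^ 2. x \<noteq> 0}"
  unfolding open_iff_mnorm
proof
  fix x :: "'f ^ 2 ^ 2" assume x: "x \<in> {x. x \<noteq> 0}"
  have "y \<noteq> 0" if "mnorm (y - x) < mnorm x" for y
    using mnorm_eq_of_close[OF that] x by auto
  then show "\<exists>e>0. \<forall>y. mnorm (y - x) < e \<longrightarrow> y \<in> {x. x \<noteq> 0}" using x by (intro exI[of _ "mnorm x"]) auto
qed

text \<open>Every point has a primitive representative, and primitive matrices form a compact set.
  So the support condition in \<open>schwartz\<close> holds for every function on this
  space.\<close>

lemma compact_space_Pgl2_top: "compact_space (Pgl2_top :: ('f::nonarch_local_field ^ 2 ^ 2) set topology)"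
proof -
  have "compactin (top_of_set {x :: 'f ^ 2 ^ 2. x \<noteq> 0}) {x. mnorm x = 1}"
    using compact_mnorm_eq_1 by (auto simp: compactin_subtopology)
  from image_compactin[OF this continuous_map_proj_class]
  have "compactin Pgl2_top (proj_class ` {x :: 'f ^ 2 ^ 2. mnorm x = 1})" .
  also have "proj_class ` {x :: 'f ^ 2 ^ 2. mnorm x = 1} = proj_class ` {x. x \<noteq> 0}"
  proof (intro equalityI subsetI)
    fix X assume "X \<in> proj_class ` {x :: 'f ^ 2 ^ 2. x \<noteq> 0}"
    then obtain x where x: "x \<noteq> 0" "X = proj_class x" by blast
    obtain c where "c \<noteq> 0" "mnorm (mat c ** x) = 1" by (rule primitive_multiple[OF x(1)])
    then show "X \<in> proj_class ` {x. mnorm x = 1}"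
      using x(2) by (intro image_eqI[of _ _ "mat c ** x"]) (simp_all add: proj_class_scale)
  next
    fix X assume "X \<in> proj_class ` {x :: 'f ^ 2 ^ 2. mnorm x = 1}"
    then obtain x where x: "mnorm x = 1" "X = proj_class x" by blast
    have "x \<noteq> 0"
    proof
      assume "x = 0"
      then show False using x(1) by simp
    qed
    then show "X \<in> proj_class ` {x. x \<noteq> 0}" using x(2) by blast
  qed
  finally show ?thesis by (simp add: compact_space_def topspace_Pgl2_top)
qed

text \<open>The choice of the representative does not matter for \<open>F\<close> in
  \<open>lcf\<close>, which is constant on classes.\<close>

definition lift :: "('f::nonarch_local_field ^ 2 ^ 2 \<Rightarrow> complex) \<Rightarrow> ('f ^ 2 ^ 2) set \<Rightarrow> complex" where
  "lift F X = (if X \<in> topspace Pgl2_top then F (SOME x. x \<in> X) else 0)"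

lemma proj_class_in_topspace: "x \<noteq> 0 \<Longrightarrow> proj_class x \<in> topspace (Pgl2_top :: ('f::nonarch_local_field ^ 2 ^ 2) set topology)"
  by (simp add: topspace_Pgl2_top)

lemma lift_proj_class:
  assumes "F \<in> lcf" "x \<noteq> 0"
  shows "lift F (proj_class x) = F x"
proof -
  have "(SOME y. y \<in> proj_class x) \<in> proj_class x" by (rule someI[of _ x]) (rule proj_class_self)
  then obtain c where "c \<noteq> 0" "(SOME y. y \<in> proj_class x) = mat c ** x" unfolding proj_class_def by blast
  then show ?thesis
    using lcf_scale[OF assms(1)] proj_class_in_topspace[OF assms(2)] by (simp add: lift_def)
qed

lemma lift_schwartz:
  assumes F: "F \<in> lcf"
  shows "lift F \<in> schwartz Pgl2_top"
  unfolding schwartz_def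
proof (intro CollectI conjI ballI allI impI)
  show "lift F y = 0" if "y \<notin> topspace Pgl2_top" for y using that by (simp add: lift_def)
  show "compactin Pgl2_top (Pgl2_top closure_of {y \<in> topspace Pgl2_top. lift F y \<noteq> 0})"
    by (intro closedin_compact_space compact_space_Pgl2_top closedin_closure_of)
  fix y :: "('a ^ 2 ^ 2) set" assume "y \<in> topspace Pgl2_top"
  then obtain x where x: "x \<noteq> 0" "y = proj_class x" unfolding topspace_Pgl2_top by blast
  let ?U = "proj_class ` {z. z \<noteq> 0 \<and> F z = F x}"
  \<comment> \<open>The set on which \<open>F\<close> takes the value \<open>F x\<close> is stable
    under nonzero scalars, hence is the full preimage of \<open>?U\<close>.\<close>
  have pre: "{z \<in> {z. z \<noteq> 0}. proj_class z \<in> ?U} = {z. z \<noteq> 0 \<and> F z = F x}"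
  proof (intro equalityI subsetI CollectI conjI)
    fix z assume z: "z \<in> {z \<in> {z. z \<noteq> 0}. proj_class z \<in> ?U}"
    then show "z \<noteq> 0" by simp
    from z obtain w where w: "proj_class z = proj_class w" "F w = F x" by blast
    obtain c where "c \<noteq> 0" "z = mat c ** w" by (rule proj_class_eqD[OF w(1)])
    then show "F z = F x" using lcf_scale[OF F] w(2) by simp
  qed auto
  have "open {z. z \<noteq> 0 \<and> F z = F x}"
    unfolding open_iff_mnorm
  proof
    fix z assume z: "z \<in> {z. z \<noteq> 0 \<and> F z = F x}"
    then have "z \<noteq> 0" by simp
    from lcf_loc[OF F this] obtain d where d: "d > 0" "\<And>w. mnorm (w - z) < d \<Longrightarrow> F w = F z" by blast
    have "w \<noteq> 0 \<and> F w = F x" if w: "mnorm (w - z) < min d (mnorm z)" for w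
      using d(2)[of w] w z mnorm_eq_of_close[of w z] by auto
    moreover have "min d (mnorm z) > 0" using d(1) z by simp
    ultimately show "\<exists>e>0. \<forall>w. mnorm (w - z) < e \<longrightarrow> w \<in> {z. z \<noteq> 0 \<and> F z = F x}" by blast
  qed
  then have "openin (top_of_set {z. z \<noteq> 0}) {z. z \<noteq> 0 \<and> F z = F x}"
    by (simp add: openin_open_eq[OF open_nonzero] subset_iff)
  then have "openin Pgl2_top ?U"
    unfolding Pgl2_top_def openin_quotient_topology topspace_euclidean_subtopology pre by blast
  moreover have "y \<in> ?U" using x by blast
  moreover have "lift F z = lift F y" if "z \<in> ?U" for z
    using that lift_proj_class[OF F] x by auto
  ultimately show "\<exists>U. openin Pgl2_top U \<and> y \<in> U \<and> (\<forall>z\<in>U. lift F z = lift F y)" by blast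
qed

lemma schwartz_eq_lift:
  assumes f: "f \<in> schwartz (Pgl2_top :: ('f::nonarch_local_field ^ 2 ^ 2) set topology)"
  shows "(\<lambda>x. f (proj_class x)) \<in> lcf" "lift (\<lambda>x. f (proj_class x)) = f"
proof -
  have zero: "f y = 0" if "y \<notin> topspace Pgl2_top" for y
    using f that unfolding schwartz_def by blast
  \<comment> \<open>The class of the zero matrix is no point of the projective space, so
    \<open>f\<close> has its default value 0 there, as \<open>lcf\<close> demands.\<close>
  have "proj_class (0 :: 'f ^ 2 ^ 2) \<notin> topspace Pgl2_top"
  proof
    assume "proj_class (0 :: 'f ^ 2 ^ 2) \<in> topspace Pgl2_top"
    then obtain x :: "'f ^ 2 ^ 2" where x: "x \<noteq> 0" "proj_class x = proj_class 0"
      unfolding topspace_Pgl2_top by (metis (mono_tags, lifting) imageE mem_Collect_eq)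
    obtain c where "x = mat c ** 0" by (rule proj_class_eqD[OF x(2)])
    then show False using x(1) by (simp add: vec_eq_iff matrix_matrix_mult_def)
  qed
  then have "f (proj_class 0) = 0" by (rule zero)
  moreover have "\<exists>e>0. \<forall>y. mnorm (y - x) < e \<longrightarrow> f (proj_class y) = f (proj_class x)" if x: "x \<noteq> 0" for x
  proof -
    obtain U where U: "openin Pgl2_top U" "proj_class x \<in> U" "\<forall>z\<in>U. f z = f (proj_class x)"
      using f proj_class_in_topspace[OF x] unfolding schwartz_def by blast
    from U(1) have "openin (top_of_set {z. z \<noteq> 0}) {z. z \<noteq> 0 \<and> proj_class z \<in> U}"
      unfolding Pgl2_top_def openin_quotient_topology by simp
    then have "open {z. z \<noteq> 0 \<and> proj_class z \<in> U}"
      by (simp add: openin_open_eq[OF open_nonzero])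
    moreover have "x \<in> {z. z \<noteq> 0 \<and> proj_class z \<in> U}" using x U(2) by simp
    ultimately obtain e where "e > 0" "\<And>y. mnorm (y - x) < e \<Longrightarrow> y \<in> {z. z \<noteq> 0 \<and> proj_class z \<in> U}"
      unfolding open_iff_mnorm by blast
    then show ?thesis using U(3) by blast
  qed
  ultimately show lcf: "(\<lambda>x. f (proj_class x)) \<in> lcf"
    unfolding lcf_def by (simp add: proj_class_scale)
  show "lift (\<lambda>x. f (proj_class x)) = f"
  proof
    fix X
    show "lift (\<lambda>x. f (proj_class x)) X = f X"
    proof (cases "X \<in> topspace Pgl2_top")
      case True
      then obtain x where "x \<noteq> 0" "X = proj_class x" unfolding topspace_Pgl2_top by blast
      then show ?thesis using lift_proj_class[OF lcf] by simp
    qed (simp add: lift_def zero)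
  qed
qed

lemma lift_act:
  assumes F: "F \<in> lcf" and gh: "invertible g" "invertible h"
  shows "lift (act g h F) = translate (PGL2 \<times>\<times> PGL2) Pgl2_top pgl_act (proj_class g, proj_class h) (lift F)"
proof
  fix X
  show "lift (act g h F) X = translate (PGL2 \<times>\<times> PGL2) Pgl2_top pgl_act (proj_class g, proj_class h) (lift F) X"
  proof (cases "X \<in> topspace Pgl2_top")
    case True
    then obtain x where x: "x \<noteq> 0" "X = proj_class x" unfolding topspace_Pgl2_top by blast
    have inv: "inv\<^bsub>PGL2 \<times>\<times> PGL2\<^esub> (proj_class g, proj_class h) = (proj_class (matrix_inv g), proj_class (matrix_inv h))"
      using gh by (simp add: inv_DirProd[OF group_PGL2 group_PGL2] proj_class_in_carrier proj_class_inv)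
    have "pgl_act (proj_class (matrix_inv g), proj_class (matrix_inv h)) (proj_class x) =
        proj_class (matrix_inv g ** x ** h)"
      using pgl_act_proj_class[OF invertible_matrix_inv[OF gh(2)]] by (simp add: matrix_inv_inv[OF gh(2)])
    moreover have "matrix_inv g ** x ** h \<noteq> 0"
      using x(1) mult_invertible_eq_0_iff[OF invertible_matrix_inv[OF gh(1)] gh(2)] by blast
    ultimately have "translate (PGL2 \<times>\<times> PGL2) Pgl2_top pgl_act (proj_class g, proj_class h) (lift F) X =
        F (matrix_inv g ** x ** h)"
      using True lift_proj_class[OF F] by (simp add: translate_def inv x(2))
    moreover have "lift (act g h F) X = act g h F x"
      unfolding x(2) by (rule lift_proj_class[OF lcf_act[OF F gh] x(1)])
    ultimately show ?thesis by (simp add: act_def)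
  qed (simp add: lift_def translate_def)
qed

lemma Hom_schwartz_intertwiner:
  assumes rep: "gl2_rep smul (\<lambda>g h. \<pi> (proj_class g, proj_class h))"
    and T: "T \<in> Hom_schwartz (PGL2 \<times>\<times> PGL2) Pgl2_top pgl_act smul \<pi>"
  shows "gl2_rep.intertwiner smul (\<lambda>g h. \<pi> (proj_class g, proj_class h)) (\<lambda>F. T (lift F))"
proof -
  interpret gl2_rep smul "\<lambda>g h. \<pi> (proj_class g, proj_class h)" by (rule rep)
  show ?thesis
    unfolding intertwiner_def
  proof (intro conjI ballI allI impI)
    fix F G :: "'b ^ 2 ^ 2 \<Rightarrow> complex" and c g h assume F: "F \<in> lcf"
    have "lift (\<lambda>x. F x + G x) = (\<lambda>y. lift F y + lift G y)" by (auto simp: lift_def)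
    then show "T (lift (\<lambda>x. F x + G x)) = T (lift F) + T (lift G)" if "G \<in> lcf"
      using T lift_schwartz[OF F] lift_schwartz[OF that] by (simp add: Hom_schwartz_def)
    have "lift (\<lambda>x. c * F x) = (\<lambda>y. c * lift F y)" by (auto simp: lift_def)
    then show "T (lift (\<lambda>x. c * F x)) = smul c (T (lift F))"
      using T lift_schwartz[OF F] by (simp add: Hom_schwartz_def)
    show "T (lift (act g h F)) = \<pi> (proj_class g, proj_class h) (T (lift F))"
      if gh: "invertible g" "invertible h"
    proof -
      have "(proj_class g, proj_class h) \<in> carrier (PGL2 \<times>\<times> PGL2)"
        using gh by (simp add: proj_class_in_carrier)
      then show ?thesis
        using T lift_schwartz[OF F] unfolding lift_act[OF F gh] Hom_schwartz_def by blast
    qed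
  qed
qed

lemma vector_space_hom_smul:
  fixes smul :: "complex \<Rightarrow> 'v::ab_group_add \<Rightarrow> 'v"
  assumes "vector_space smul"
  shows "vector_space (hom_smul smul :: complex \<Rightarrow> (('y \<Rightarrow> complex) \<Rightarrow> 'v) \<Rightarrow> ('y \<Rightarrow> complex) \<Rightarrow> 'v)"
proof -
  interpret vector_space smul by (rule assms)
  show ?thesis
    by unfold_locales (auto simp: hom_smul_def fun_eq_iff scale_right_distrib scale_left_distrib)
qed

theorem theoremA:
  fixes smul :: "complex \<Rightarrow> 'v::ab_group_add \<Rightarrow> 'v"
    and \<pi> :: "('f::nonarch_local_field ^ 2 ^ 2) set \<times> ('f ^ 2 ^ 2) set \<Rightarrow> 'v \<Rightarrow> 'v"
  assumes "irreducible_rep (PGL2 \<times>\<times> PGL2) smul \<pi>"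
    and "admissible_rep (PGL2 \<times>\<times> PGL2) (prod_topology PGL2_top PGL2_top) smul \<pi>"
  shows "finite_dim (hom_smul smul) (Hom_schwartz (PGL2 \<times>\<times> PGL2) Pgl2_top pgl_act smul \<pi>) \<and>
    vector_space.dim (hom_smul smul)
      (Hom_schwartz (PGL2 \<times>\<times> PGL2) Pgl2_top pgl_act smul \<pi>) \<le> 1"
proof -
  let ?Hom = "Hom_schwartz (PGL2 \<times>\<times> PGL2) Pgl2_top pgl_act smul \<pi>"
  have rep: "gl2_rep smul (\<lambda>g h. \<pi> (proj_class g, proj_class h))"
    by (rule gl2_rep_of_PGL2_rep[OF assms])
  interpret gl2_rep smul "\<lambda>g h. \<pi> (proj_class g, proj_class h)" by (rule rep)
  interpret V: vector_space "hom_smul smul :: complex \<Rightarrow> ((('f ^ 2 ^ 2) set \<Rightarrow> complex) \<Rightarrow> 'v) \<Rightarrow> _"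
    by (rule vector_space_hom_smul[OF vector_space_axioms])
  \<comment> \<open>A spanning set of at most one element gives both the finite dimension and the
    bound on \<open>dim\<close>.\<close>
  have "\<exists>B. finite B \<and> card B \<le> 1 \<and> B \<subseteq> ?Hom \<and> ?Hom \<subseteq> V.span B"
  proof (cases "?Hom \<subseteq> {0}")
    case True
    then show ?thesis by (intro exI[of _ "{}"]) simp
  next
    case False
    then obtain T0 where T0: "T0 \<in> ?Hom" "T0 \<noteq> 0" by blast
    \<comment> \<open>Members of \<open>?Hom\<close> vanish outside \<open>schwartz Pgl2_top\<close>
      by convention, so this \<open>f\<close> is a Schwartz function and its pullback to matrices
      shows that the intertwiner of \<open>T0\<close> is nonzero.\<close>
    then obtain f where f: "T0 f \<noteq> 0" by (auto simp: fun_eq_iff)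
    have out: "T f = 0" if "T \<in> ?Hom" "f \<notin> schwartz Pgl2_top" for T f
      using that by (simp add: Hom_schwartz_def)
    have fs: "f \<in> schwartz Pgl2_top" using f out[OF T0(1)] by blast
    have nz: "T0 (lift (\<lambda>x. f (proj_class x))) \<noteq> 0" using f schwartz_eq_lift(2)[OF fs] by simp
    have "T \<in> V.span {T0}" if T: "T \<in> ?Hom" for T
    proof -
      obtain c where c: "\<And>F. F \<in> lcf \<Longrightarrow> T (lift F) = smul c (T0 (lift F))"
        by (rule intertwiner_multiplicity_one[OF Hom_schwartz_intertwiner[OF rep T0(1)]
              schwartz_eq_lift(1)[OF fs] nz Hom_schwartz_intertwiner[OF rep T]]) (rule that)
      have "T f = smul c (T0 f)" for f
      proof (cases "f \<in> schwartz Pgl2_top")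
        case True
        then show ?thesis using c[OF schwartz_eq_lift(1)[OF True]] schwartz_eq_lift(2)[OF True] by simp
      qed (simp add: out[OF T] out[OF T0(1)])
      then have "T = hom_smul smul c T0" by (simp add: hom_smul_def fun_eq_iff)
      then show ?thesis by (simp add: V.span_scale V.span_base)
    qed
    then show ?thesis using T0(1) by (intro exI[of _ "{T0}"]) auto
  qed
  then obtain B where B: "finite B" "card B \<le> 1" "B \<subseteq> ?Hom" "?Hom \<subseteq> V.span B" by blast
  then have "V.dim ?Hom \<le> 1" using V.dim_le_card[OF B(4,1)] by simp
  then show ?thesis using B unfolding finite_dim_def by blast
qed

end
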